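(* Let $A_N$ and $B_N$ be overlapping real Wigner matrices (as defined in the context), with asymptotic size parameters $a,b,\Delta>0$ and moment parameters $d_2, m_4$. Let $T_k$ denote the Chebyshev polynomials of the first kind, $T_k(\cos\theta)=\cos k\theta$. Then for all integers $k,l\ge 1$, as $N\to\infty$, the joint distribution of the centered linear statistics $\mathcal N^o(T_k,A_N)$ and $\mathcal N^o(T_l,B_N)$ converges (weakly) to a two-variate Gaussian distribution with the covariance (between the two coordinates) equal to $$\begin{cases}\frac{k}{2}\left(\frac{\Delta}{\sqrt{ab}}\right)^k, & \text{if } k=l\ge 3,\\[2pt] \frac{m_4-1}{2}\left(\frac{\Delta}{\sqrt{ab}}\right)^2, & \text{if } k=l=2,\\[2pt] \frac{d_2}{4}\,\frac{\Delta}{\sqrt{ab}}, & \text{if } k=l=1,\\[2pt] 0, & \text{otherwise.}\end{cases}$$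
   Context: Setting. $X=(X_{ij})_{i,j\ge1}$ is an infinite real symmetric random matrix. Its entries above the main diagonal are independent and identically distributed; the entries on the main diagonal are independent, with a common distribution that may differ from that of the off-diagonal entries, and independent of the off-diagonal entries. The off-diagonal entries have all moments finite, with $\mathbb E X_{ij}=0$, $\mathbb E X_{ij}^2=1$, $\mathbb E X_{ij}^4=m_4$. The diagonal entries have all moments finite, with $\mathbb E X_{ii}=0$, $\mathbb E X_{ii}^2=d_2$. Overlapping real Wigner matrices: for each $N$, $A_N$ and $B_N$ are (finite, principal, hence symmetric) submatrices of $X$; $A_N$ has $a^{(N)}$ rows and columns, $B_N$ has $b^{(N)}$ rows and columns, and they have $\Delta^{(N)}$ rows and columns (i.e. indices) in common. There is a parameter $t_N\to\infty$ such that $a^{(N)}/t_N\to a$, $b^{(N)}/t_N\to b$, $\Delta^{(N)}/t_N\to\Delta$, where $a,b,\Delta$ are positive. Normalization: $\widetilde A_N:=\frac{1}{2\sqrt{a^{(N)}}}A_N$, $\widetilde B_N:=\frac{1}{2\sqrt{b^{(N)}}}B_N$. Linear statistics: for $f:\mathbb R\to\mathbb R$, $\mathcal N(f,A_N):=\mathrm{Tr}[f(\widetilde A_N)]=\sum_i f(\lambda_i)$, where $\lambda_i$ are the eigenvalues of $\widetilde A_N$, and $\mathcal N^o(f,A_N):=\mathcal N(f,A_N)-\mathbb E\,\mathcal N(f,A_N)$; similarly for $B_N$ with $\widetilde B_N$. *)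

theory Defs
  imports "HOL-Probability.Probability" "Jordan_Normal_Form.Char_Poly"
    "Jordan_Normal_Form.DL_Submatrix"
begin

text \<open>Infinite real symmetric Wigner matrix. The index set \<open>{1, 2, \<dots>}\<close> is relabelled as
  \<^typ>\<open>nat\<close>. Independence over the pairs \<open>i \<le> j\<close> is joint independence of all entries on and
  above the diagonal.\<close>

locale wigner_matrix = prob_space M for M :: "'w measure" +
  fixes X :: "nat \<Rightarrow> nat \<Rightarrow> 'w \<Rightarrow> real" and d2 m4 :: real
  assumes symmetric: "\<And>i j. X i j = X j i"
    and indep: "indep_vars (\<lambda>_. borel) (\<lambda>(i, j). X i j) {(i, j). i \<le> j}"
    and offdiag_ident: "\<And>i j i' j'. i < j \<Longrightarrow> i' < j' \<Longrightarrow>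
          distr M borel (X i j) = distr M borel (X i' j')"
    and diag_ident: "\<And>i i'. distr M borel (X i i) = distr M borel (X i' i')"
    and moments_finite: "\<And>i j n. integrable M (\<lambda>\<omega>. X i j \<omega> ^ n)"
    and offdiag_mean: "\<And>i j. i < j \<Longrightarrow> expectation (X i j) = 0"
    and offdiag_second: "\<And>i j. i < j \<Longrightarrow> expectation (\<lambda>\<omega>. X i j \<omega> ^ 2) = 1"
    and offdiag_fourth: "\<And>i j. i < j \<Longrightarrow> expectation (\<lambda>\<omega>. X i j \<omega> ^ 4) = m4"
    and diag_mean: "\<And>i. expectation (X i i) = 0"
    and diag_second: "\<And>i. expectation (\<lambda>\<omega>. X i i \<omega> ^ 2) = d2"

text \<open>\<^term>\<open>pick I r\<close> is the \<open>r\<close>-th smallest element of \<open>I\<close>, counting from 0; the definition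
  is meaningful for finite \<open>I\<close>.\<close>

definition principal_submatrix ::
    "(nat \<Rightarrow> nat \<Rightarrow> 'w \<Rightarrow> real) \<Rightarrow> nat set \<Rightarrow> 'w \<Rightarrow> real mat" where
  "principal_submatrix X I \<omega> =
     Matrix.mat (card I) (card I) (\<lambda>(r, s). X (pick I r) (pick I s) \<omega>)"

definition normalized_submatrix ::
    "(nat \<Rightarrow> nat \<Rightarrow> 'w \<Rightarrow> real) \<Rightarrow> nat set \<Rightarrow> 'w \<Rightarrow> real mat" where
  "normalized_submatrix X I \<omega> =
     (1 / (2 * sqrt (real (card I)))) \<cdot>\<^sub>m principal_submatrix X I \<omega>"

text \<open>\<^const>\<open>proots\<close> is the multiset of roots, so eigenvalues are summed with multiplicity. For a
  symmetric matrix all roots of the characteristic polynomial are real, and this is \<open>Tr f(A)\<close>.\<close>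

definition eigenvalue_sum :: "(real \<Rightarrow> real) \<Rightarrow> real mat \<Rightarrow> real" where
  "eigenvalue_sum f A = (\<Sum>x\<in>#proots (char_poly A). f x)"

definition linear_stat ::
    "(nat \<Rightarrow> nat \<Rightarrow> 'w \<Rightarrow> real) \<Rightarrow> (real \<Rightarrow> real) \<Rightarrow> nat set \<Rightarrow> 'w \<Rightarrow> real" where
  "linear_stat X f I \<omega> = eigenvalue_sum f (normalized_submatrix X I \<omega>)"

definition centered_linear_stat ::
    "'w measure \<Rightarrow> (nat \<Rightarrow> nat \<Rightarrow> 'w \<Rightarrow> real) \<Rightarrow> (real \<Rightarrow> real) \<Rightarrow> nat set \<Rightarrow> 'w \<Rightarrow> real" where
  "centered_linear_stat M X f I \<omega> =
     linear_stat X f I \<omega> - (\<integral>\<omega>'. linear_stat X f I \<omega>' \<partial>M)"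

fun cheb_T :: "nat \<Rightarrow> real poly" where
  "cheb_T 0 = 1"
| "cheb_T (Suc 0) = [:0, 1:]"
| "cheb_T (Suc (Suc n)) = [:0, 2:] * cheb_T (Suc n) - cheb_T n"

lemma cheb_T_cos: "poly (cheb_T n) (cos \<theta>) = cos (real n * \<theta>)"
proof (induction n rule: cheb_T.induct)
  case (3 n)
  have "cos (real (Suc (Suc n)) * \<theta>) + cos (real n * \<theta>)
          = cos (real (Suc n) * \<theta> + \<theta>) + cos (real (Suc n) * \<theta> - \<theta>)"
    by (simp add: algebra_simps)
  also have "\<dots> = 2 * cos \<theta> * cos (real (Suc n) * \<theta>)"
    unfolding cos_add cos_diff by simp
  finally show ?case using 3 by (simp add: algebra_simps)
qed simp_all

lemma cheb_T_unique:
  assumes "\<And>\<theta>. poly p (cos \<theta>) = cos (real n * \<theta>)"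
  shows "p = cheb_T n"
proof -
  have "poly p x = poly (cheb_T n) x" if "x \<in> {-1..1}" for x
    using assms[of "arccos x"] cheb_T_cos[of n "arccos x"] that by simp
  then have "{-1..1} \<subseteq> {x. poly (p - cheb_T n) x = 0}" by auto
  moreover have "infinite {-1..1::real}" by (simp add: infinite_Icc)
  ultimately have "p - cheb_T n = 0"
    using poly_roots_finite finite_subset by blast
  then show ?thesis by simp
qed

text \<open>A Gaussian law may be degenerate: standard deviation 0 gives a point mass. This does occur
  as a limit here, e.g. when \<open>d2 = 0\<close> or \<open>m4 = 1\<close>.\<close>

definition gaussian_1d :: "real measure \<Rightarrow> bool" where
  "gaussian_1d \<mu> \<longleftrightarrow>
     (\<exists>m. \<mu> = return borel m) \<or> (\<exists>m s. s > 0 \<and> \<mu> = density lborel (normal_density m s))"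

definition gaussian_2d :: "(real \<times> real) measure \<Rightarrow> bool" where
  "gaussian_2d G \<longleftrightarrow> prob_space G \<and> sets G = sets borel \<and>
     (\<forall>u v. gaussian_1d (distr G borel (\<lambda>(x, y). u * x + v * y)))"

definition coord_covariance :: "(real \<times> real) measure \<Rightarrow> real" where
  "coord_covariance G =
     (\<integral>z. (fst z - (\<integral>z'. fst z' \<partial>G)) * (snd z - (\<integral>z'. snd z' \<partial>G)) \<partial>G)"

text \<open>The library's \<^const>\<open>weak_conv_m\<close> is restricted to laws on the real line.\<close>

definition weakly_converges ::
    "(nat \<Rightarrow> 'b::topological_space measure) \<Rightarrow> 'b measure \<Rightarrow> bool" where
  "weakly_converges \<mu> G \<longleftrightarrow>
     (\<forall>g::'b \<Rightarrow> real. continuous_on UNIV g \<longrightarrow> bounded (range g) \<longrightarrow>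
        (\<lambda>n. \<integral>z. g z \<partial>\<mu> n) \<longlonglongrightarrow> (\<integral>z. g z \<partial>G))"

end

theory Submission
  imports Defs "Jordan_Normal_Form.Schur_Decomposition"
begin

text \<open>Write \<open>2 T_k(x) = U_k(x) - U_{k-2}(x)\<close>. Expanding the trace of \<open>2 T_k(A / (2 sqrt n))\<close> over closed
  walks of length \<open>k\<close>, each lower order term of the Chebyshev polynomial can be absorbed by the walks that
  backtrack: a backtracking pair of steps along an edge \<open>e\<close> gets the weight \<open>X_e^2 - 1\<close> instead of
  \<open>X_e^2\<close>. Up to a constant, the linear statistic is therefore a normalized sum of walk weights in which
  both a step along a fresh edge and an isolated backtracking step are centered.

  A mixed moment of such sums is a sum over tuples of walks. A tuple in which some vertex is visited
  exactly once has expectation zero by this centering. Tuples in which all vertices are visited at least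
  twice, and one of them three times, are too few to matter. If all vertices are visited exactly twice, the
  expectation vanishes unless the first walk is a simple cycle and some other walk is the same cycle up to
  rotation and reflection; removing this pair leaves a tuple of the same kind. This gives the recursion
  \<open>E W^(p+2) = (p+1) Var(W) E W^p + o(1)\<close>, which is the moment recursion of a Gaussian law, for every linear
  combination \<open>W\<close> of the two statistics.\<close>

subsection \<open>Weights of walks\<close>

text \<open>The constants in the covariance are a count. A simple cycle of length k and its partner
  contribute the second moment of the centered weight: 1 for k \<ge> 3, \<open>m4 - 1\<close> for a
  doubled edge, \<open>d2\<close> for a loop. The partner may be any of the 2k rotations and
  reflections (2 for k = 2, 1 for k = 1), and the factor 1/2 in each statistic gives 1/4. A cycle
  seen by both matrices has its k vertices among the common indices: about (\<Delta> t)^k choices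
  against the normalization (a t)^(-k/2) (b t)^(-k/2). This balance is exact, so a single visit in
  excess of two per vertex already costs a factor of order 1 / sqrt t.

  Both statistics are written as one weighted sum over walks in the union of the two index sets, so
  that one recursion covers all linear combinations. The limit law may be degenerate; it is
  therefore built as a linear image of two independent standard normal variables, which works for
  all variances and all correlations in [0, 1], and it is recognized by its characteristic
  function.\<close>

text \<open>Summed over all walks, these weights satisfy the Chebyshev recursion \<open>U_{k+2} = x U_{k+1} - n U_k\<close>:
  the subtracted term matches a backtracking step, whose middle vertex ranges over \<open>n\<close> values.\<close>

fun path_weight :: "('v \<Rightarrow> 'v \<Rightarrow> 'a::comm_ring_1) \<Rightarrow> 'v list \<Rightarrow> 'a" where
  "path_weight x (u # v # z # r) = x u v * path_weight x (v # z # r) -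
     (if u = z then path_weight x (z # r) else 0)"
| "path_weight x [u, v] = x u v"
| "path_weight x _ = 1"

text \<open>The subtracted term is for backtracking at the base point. In a closed walk of length 2 the two
  steps form a single backtracking pair, which \<open>path_weight\<close> has already taken care of.\<close>

definition cycle_weight :: "('v \<Rightarrow> 'v \<Rightarrow> 'a::comm_ring_1) \<Rightarrow> 'v list \<Rightarrow> 'a" where
  "cycle_weight x w = path_weight x (w @ [hd w]) -
     (if length w \<ge> 3 \<and> last w = w ! 1 then path_weight x (tl w) else 0)"

text \<open>Sorting the ends makes edges undirected and lets them range over the index set of the
  independent entries. A loop is \<open>(u, u)\<close>.\<close>

definition edge :: "nat \<Rightarrow> nat \<Rightarrow> nat \<times> nat" where
  "edge u v = (min u v, max u v)"

fun path_edges :: "nat list \<Rightarrow> (nat \<times> nat) list" where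
  "path_edges (u # v # r) = edge u v # path_edges (v # r)"
| "path_edges _ = []"

definition cycle_edges :: "nat list \<Rightarrow> (nat \<times> nat) list" where
  "cycle_edges w = path_edges (w @ [hd w])"

definition dihedral_class :: "'v list \<Rightarrow> 'v list set" where
  "dihedral_class w = (\<Union>i. {rotate i w, rotate i (rev w)})"

lemma edge_commute: "edge u v = edge v u"
  by (simp add: edge_def min.commute max.commute)

lemma edge_eq_iff: "edge u v = edge a b \<longleftrightarrow> u = a \<and> v = b \<or> u = b \<and> v = a"
  by (auto simp: edge_def min_def max_def)

text \<open>The defining recursion works from the front. Expanding the first step and expanding the
  last step commute, so the same recursion holds from the back; invariance under reversal rests on
  this.\<close>

lemma path_weight_snoc:
  "path_weight x (p @ [z, u, v]) = path_weight x (p @ [z, u]) * x u v -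
     (if z = v then path_weight x (p @ [z]) else 0)"
proof (induction p rule: induct_list012)
  case (3 a b p)
  show ?case
  proof (cases p)
    case (Cons c q)
    with 3 show ?thesis by (cases "a = c"; cases "z = v"; simp) (simp_all add: algebra_simps)
  qed (use 3 in \<open>simp add: algebra_simps\<close>)
qed (simp_all add: algebra_simps)

lemma path_weight_rev:
  assumes sym: "\<forall>u v. x u v = x v u"
  shows "path_weight x (rev xs) = path_weight x xs"
  using sym
  by (induction x xs rule: path_weight.induct) (auto simp: path_weight_snoc mult.commute)

lemma cycle_weight_singleton: "cycle_weight x [a] = x a a"
  by (simp add: cycle_weight_def)

lemma cycle_weight_pair: "cycle_weight x [a, b] = x a b * x b a - 1"
  by (simp add: cycle_weight_def)

text \<open>Both sides expand to one product minus two backtracking terms, one at \<open>a\<close>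
  and one at \<open>b\<close>. Rotation only exchanges which of them stems from
  \<open>path_weight\<close> and which is the base point correction.\<close>

lemma cycle_weight_rotate1:
  assumes sym: "\<forall>u v. x u v = x v u"
  shows "cycle_weight x (rotate1 w) = cycle_weight x w"
proof (cases "length w \<ge> 3")
  case True
  then obtain a b m z where w: "w = a # b # m @ [z]"
    by (metis One_nat_def Suc_le_length_iff append_butlast_last_id length_0_conv
        numeral_3_eq_3 list.distinct(1))
  have 1: "path_weight x ((a # b # m @ [z]) @ [a]) = x a b * path_weight x (b # m @ [z, a])
      - (if a = hd (m @ [z]) then path_weight x (m @ [z, a]) else 0)"
    by (cases m) auto
  have 2: "path_weight x ((b # m @ [z, a]) @ [b]) = path_weight x (b # m @ [z, a]) * x a b
      - (if z = b then path_weight x (b # m @ [z]) else 0)"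
    using path_weight_snoc[of x "b # m" z a b] by simp
  show ?thesis unfolding cycle_weight_def
    by (cases m) (use 1 2 in \<open>auto simp: w algebra_simps nth_append\<close>)
next
  case False
  then consider "w = []" | a where "w = [a]" | a b where "w = [a, b]"
    by (cases w; cases "tl w"; cases "tl (tl w)") auto
  then show ?thesis
    by cases (auto simp: cycle_weight_def sym[rule_format])
qed

lemma cycle_weight_rotate:
  assumes sym: "\<forall>u v. x u v = x v u"
  shows "cycle_weight x (rotate i w) = cycle_weight x w"
  by (induction i) (auto simp: cycle_weight_rotate1[OF sym])

lemma cycle_weight_swap:
  assumes sym: "\<forall>u v. x u v = x v u"
  shows "cycle_weight x (p @ q) = cycle_weight x (q @ p)"
  using cycle_weight_rotate[OF sym, of "length p" "p @ q"] by (simp add: rotate_append)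

text \<open>Reversal moves the base point to the end of the list. Once it is rotated back to the
  front, the closed path is literally the reversed one.\<close>

lemma cycle_weight_rev:
  assumes sym: "\<forall>u v. x u v = x v u"
  shows "cycle_weight x (rev w) = cycle_weight x w"
proof (cases w)
  case (Cons a t)
  have "cycle_weight x (rev w) = cycle_weight x (a # rev t)"
    using cycle_weight_swap[OF sym, of "rev t" "[a]"] Cons by simp
  also have "\<dots> = cycle_weight x w"
  proof -
    have "path_weight x ((a # rev t) @ [a]) = path_weight x (a # t @ [a])"
      using path_weight_rev[OF sym, of "a # t @ [a]"] by simp
    moreover have "last (rev t) = rev t ! 0 \<longleftrightarrow> last t = t ! 0" if "t \<noteq> []"
      using that by (simp add: last_rev hd_conv_nth rev_nth last_conv_nth) auto
    ultimately show ?thesis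
      by (auto simp: cycle_weight_def Cons path_weight_rev[OF sym])
  qed
  finally show ?thesis .
qed simp

lemma cycle_weight_dihedral:
  assumes sym: "\<forall>u v. x u v = x v u" and "w' \<in> dihedral_class w"
  shows "cycle_weight x w' = cycle_weight x w"
  using assms(2) by (auto simp: dihedral_class_def cycle_weight_rotate[OF sym] cycle_weight_rev[OF sym])

lemma last_path_edge: "edge (last (b # r)) a \<in> set (path_edges ((b # r) @ [a]))"
  by (induction r arbitrary: b) auto

text \<open>A backtracking term at either end of this edge would need a second step along
  it.\<close>

lemma cycle_weight_once:
  assumes "edge a b \<notin> set (path_edges (b # r @ [a]))"
  shows "cycle_weight x (a # b # r) = x a b * path_weight x (b # r @ [a])"
proof -
  have "a \<noteq> hd (r @ [a])"  if "r \<noteq> []"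
    using that assms by (cases r) (auto simp: edge_eq_iff)
  moreover have "last (b # r) \<noteq> b" 
  proof
    assume l: "last (b # r) = b"
    have "edge (last (b # r)) a \<in> set (path_edges ((b # r) @ [a]))"
      by (rule last_path_edge)
    with l assms show False by (simp add: edge_commute)
  qed
  ultimately show ?thesis
    by (cases r) (auto simp: cycle_weight_def)
qed

text \<open>The subtraction built into \<open>path_weight\<close> shows up as centering: for
  \<open>a \<noteq> b\<close> and entries of unit variance the first factor has mean zero.\<close>

lemma cycle_weight_backtrack:
  assumes "edge a b \<notin> set (path_edges (a # r @ [a]))"
  shows "cycle_weight x (a # b # a # r) = (x a b * x b a - 1) * path_weight x (a # r @ [a])"
proof -
  have "b \<noteq> hd (r @ [a])"
    using assms by (cases r) (auto simp: edge_eq_iff)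
  moreover have "last (a # r) \<noteq> b" 
  proof
    assume l: "last (a # r) = b"
    have "edge (last (a # r)) a \<in> set (path_edges ((a # r) @ [a]))"
      by (rule last_path_edge)
    with l assms show False by (simp add: edge_commute)
  qed
  ultimately show ?thesis
    by (cases r) (auto simp: cycle_weight_def algebra_simps)
qed

lemma path_weight_distinct_Cons:
  assumes "u \<notin> set xs"
  shows "path_weight x (u # v # xs) = x u v * path_weight x (v # xs)"
  using assms by (cases xs) auto

section \<open>Edges of walks, and simple cycles up to rotation and reflection\<close>

lemma path_edges_snoc: "path_edges (p @ [u, v]) = path_edges (p @ [u]) @ [edge u v]"
  by (induction p rule: path_edges.induct) auto

lemma set_path_edges: "set (path_edges xs) = {edge (xs ! i) (xs ! Suc i) | i. Suc i < length xs}"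
proof (induction xs rule: path_edges.induct)
  case (1 u v r)
  have "{edge ((u # v # r) ! i) ((u # v # r) ! Suc i) | i. Suc i < length (u # v # r)} =
        insert (edge u v) {edge ((v # r) ! i) ((v # r) ! Suc i) | i. Suc i < length (v # r)}"
    (is "?L = ?R")
  proof
    show "?L \<subseteq> ?R"
    proof
      fix e assume "e \<in> ?L"
      then obtain i where "e = edge ((u # v # r) ! i) ((u # v # r) ! Suc i)" "Suc i < length (u # v # r)"
        by blast
      then show "e \<in> ?R" by (cases i) auto
    qed
    show "?R \<subseteq> ?L" 
    proof
      fix e assume "e \<in> ?R"
      then consider "e = edge u v" | i where "e = edge ((v # r) ! i) ((v # r) ! Suc i)" "Suc i < length (v # r)"
        by blast
      then show "e \<in> ?L"
        by cases (auto intro: exI[of _ 0] exI[of _ "Suc _"])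
    qed
  qed
  with 1 show ?case by simp
qed auto

lemma set_cycle_edges:
  "set (cycle_edges w) = {edge (w ! i) (w ! (Suc i mod length w)) | i. i < length w}"
proof -
  have *: "edge ((w @ [hd w]) ! i) ((w @ [hd w]) ! Suc i) = edge (w ! i) (w ! (Suc i mod length w))"
    if "i < length w" for i
  proof (cases "Suc i = length w")
    case True
    then have "hd w = w ! 0" by (cases w) auto
    with True show ?thesis by (simp add: nth_append)
  next
    case False
    then show ?thesis using that by (simp add: nth_append)
  qed
  show ?thesis
    unfolding cycle_edges_def set_path_edges using * by (intro Collect_cong ex_cong1) auto
qed

lemma length_path_edges: "length (path_edges xs) = length xs - 1"
  by (induction xs rule: path_edges.induct) auto

lemma length_cycle_edges: "length (cycle_edges w) = length w"
  by (simp add: cycle_edges_def length_path_edges)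

lemma path_edges_vertices: "edge u v \<in> set (path_edges xs) \<Longrightarrow> u \<in> set xs \<and> v \<in> set xs"
  unfolding set_path_edges by (auto simp: edge_eq_iff)

lemma cycle_edges_vertices: "edge u v \<in> set (cycle_edges w) \<Longrightarrow> u \<in> set w \<and> v \<in> set w"
  unfolding cycle_edges_def by (cases w) (auto dest: path_edges_vertices)

lemma set_cycle_edges_rotate1: "set (cycle_edges (rotate1 w)) = set (cycle_edges w)"
proof -
  show ?thesis
  proof (cases w)
    case (Cons a t)
    then show ?thesis
      using path_edges_snoc[of t a "hd (t @ [a])"] by (cases t) (auto simp: cycle_edges_def)
  qed simp
qed

lemma set_cycle_edges_rotate: "set (cycle_edges (rotate i w)) = set (cycle_edges w)"
  by (induction i) (auto simp: set_cycle_edges_rotate1)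

lemma set_path_edges_rev: "set (path_edges (rev xs)) = set (path_edges xs)"
proof -
  show ?thesis
    by (induction xs rule: path_edges.induct) (auto simp: path_edges_snoc edge_commute)
qed

lemma set_cycle_edges_rev: "set (cycle_edges (rev w)) = set (cycle_edges w)"
proof (cases w)
  case (Cons a t)
  have "set (cycle_edges (rev w)) = set (cycle_edges (a # rev t))"
    using set_cycle_edges_rotate[of "length t" "rev w"] rotate_append[of "rev t" "[a]"] Cons
    by simp
  also have "\<dots> = set (path_edges (rev (a # t @ [a])))"
    by (simp add: cycle_edges_def)
  also have "\<dots> = set (cycle_edges w)"
    unfolding set_path_edges_rev by (simp add: cycle_edges_def Cons)
  finally show ?thesis .
qed simp

lemma mset_rotate: "mset (rotate i w) = mset w"
proof (induction i)
  case (Suc i)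
  then show ?case by (cases "rotate i w") auto
qed simp

lemma dihedral_class_props:
  assumes "w' \<in> dihedral_class w"
  shows "mset w' = mset w" "length w' = length w" "set w' = set w" "distinct w' = distinct w"
    "set (cycle_edges w') = set (cycle_edges w)"
  using assms
  by (auto simp: dihedral_class_def set_cycle_edges_rotate set_cycle_edges_rev mset_rotate)

lemma dihedral_class_rotate: "w' \<in> dihedral_class w \<Longrightarrow> rotate i w' \<in> dihedral_class w"
  by (auto simp: dihedral_class_def rotate_rotate)

lemma self_in_dihedral_class: "w \<in> dihedral_class w"
  by (auto simp: dihedral_class_def intro: exI[of _ 0])

text \<open>Connectedness of a closed walk: it has to cross between \<open>P\<close> and its
  complement, and as edges are undirected the crossing can be read in the wanted direction.\<close>

lemma cycle_split_edge:
  assumes "a \<in> set w" "P a" "b \<in> set w" "\<not> P b"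
  obtains u v where "edge u v \<in> set (cycle_edges w)" "P u" "\<not> P v"
proof -
  have *: "\<exists>u v. edge u v \<in> set (path_edges xs) \<and> P u \<and> \<not> P v"
    if "a \<in> set xs" "P a" "b \<in> set xs" "\<not> P b" for xs a b
    using that
  proof (induction xs arbitrary: a b rule: path_edges.induct)
    case (1 u v r)
    show ?case
    proof (cases "P u = P v")
      case True
      with 1(2-) have "\<exists>a' b'. a' \<in> set (v # r) \<and> b' \<in> set (v # r) \<and> P a' \<and> \<not> P b'"
        by auto
      then obtain a' b' where "a' \<in> set (v # r)" "b' \<in> set (v # r)" "P a'" "\<not> P b'" by blast
      with 1(1)[of a' b'] show ?thesis by auto
    next
      case False
      then show ?thesis
        using edge_commute[of u v]
        by (cases "P u") (simp; metis)+
    qed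
  qed auto
  from *[of a "w @ [hd w]" b] assms that show thesis
    unfolding cycle_edges_def by auto
qed

text \<open>The vertices of \<open>w'\<close> are forced one at a time. A simple cycle has only two
  edges at a vertex; one leads back to the vertex matched before, so the next edge of
  \<open>w\<close> must be the forward edge of \<open>w'\<close>. Only the direction of the first
  step is free, and it decides between equality and reflection.\<close>

lemma dihedral_class_if_edges_same_hd:
  assumes "distinct w" "distinct w'" "set w' = set w" "set (cycle_edges w) \<subseteq> set (cycle_edges w')"
    and hd: "hd w' = hd w"
  shows "w' \<in> dihedral_class w"
proof -
  define k where "k = length w"
  have k': "length w' = k"
    using assms(1-3) by (metis distinct_card k_def)
  have nth0: "w' ! 0 = w ! 0" if "k > 0"
    using hd that k' k_def by (metis hd_conv_nth length_0_conv less_numeral_extra(3))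
  consider "k = 0" | "k = 1" | "k = 2" | "k \<ge> 3"
    by linarith
  then show ?thesis
  proof cases
    case 1
    then show ?thesis using k' k_def self_in_dihedral_class by auto
  next
    case 2
    then have "w' = w" using k' k_def nth0 by (auto intro!: nth_equalityI)
    then show ?thesis using self_in_dihedral_class by auto
  next
    case 3
    then obtain a b where w: "w = [a, b]"
      unfolding k_def by (metis One_nat_def Suc_1 length_0_conv length_Suc_conv)
    obtain c d where w': "w' = [c, d]"
      using 3 k' by (metis One_nat_def Suc_1 length_0_conv length_Suc_conv)
    have "w' = w" using assms(1-3) hd by (auto simp: w w' doubleton_eq_iff)
    then show ?thesis using self_in_dihedral_class by auto
  next
    case 4
    have eq: "u = w" if u: "distinct u" "length u = k" "set (cycle_edges w) \<subseteq> set (cycle_edges u)"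
      "u ! 0 = w ! 0" "u ! 1 = w ! 1" for u
    proof -
      have "i < k \<Longrightarrow> u ! i = w ! i" for i
      proof (induction i rule: less_induct)
        case (less i)
        show ?case
        proof (cases "i \<le> 1")
          case True
          then show ?thesis using u by (cases i) auto
        next
          case False
          then obtain m where m: "i = Suc (Suc m)"
            by (metis One_nat_def bot_nat_0.extremum not0_implies_Suc not_less_eq_eq)
          have IH: "u ! m = w ! m" "u ! Suc m = w ! Suc m"
            using less m by auto
          have "edge (w ! Suc m) (w ! i) \<in> set (cycle_edges w)"
            unfolding set_cycle_edges using less.prems m k_def
            by (auto intro!: exI[of _ "Suc m"])
          with u(3) have "edge (w ! Suc m) (w ! i) \<in> set (cycle_edges u)" by blast
          then obtain j where j: "j < k" "edge (w ! Suc m) (w ! i) = edge (u ! j) (u ! (Suc j mod k))"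
            unfolding set_cycle_edges using u(2) by auto
          from j(2) show ?thesis unfolding edge_eq_iff
          proof (elim disjE conjE)
            assume *: "w ! Suc m = u ! j" "w ! i = u ! (Suc j mod k)"
            then have "u ! j = u ! Suc m" using IH by (simp only:)
            then have "j = Suc m"
              by (subst (asm) nth_eq_iff_index_eq) (use u(1,2) j(1) less.prems m in auto)
            with *(2) show ?thesis using less.prems m by simp
          next
            \<comment> \<open>This would be the backward edge, whose other end \<open>w ! m\<close>
              has already occurred.\<close>
            assume *: "w ! Suc m = u ! (Suc j mod k)" "w ! i = u ! j"
            then have "u ! (Suc j mod k) = u ! Suc m" using IH by (simp only:)
            then have "Suc j mod k = Suc m"
              by (subst (asm) nth_eq_iff_index_eq) (use u(1,2) j(1) less.prems m in auto)
            then have "j = m" using j(1) by (cases "Suc j = k") auto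
            with *(2) IH(1) have "w ! i = w ! m" by (simp only:)
            then have "i = m"
              by (subst (asm) nth_eq_iff_index_eq) (use assms(1) less.prems m k_def in auto)
            then show ?thesis using m by simp
          qed
        qed
      qed
      then show "u = w" using u(2) k_def by (auto intro: nth_equalityI)
    qed
    have "edge (w ! 0) (w ! 1) \<in> set (cycle_edges w)"
      unfolding set_cycle_edges using 4 k_def by (auto intro!: exI[of _ 0])
    with assms(4) have "edge (w ! 0) (w ! 1) \<in> set (cycle_edges w')" by blast
    then obtain j where j: "j < k" "edge (w ! 0) (w ! 1) = edge (w' ! j) (w' ! (Suc j mod k))"
      unfolding set_cycle_edges using k' by auto
    from j(2) show ?thesis unfolding edge_eq_iff
    proof (elim disjE conjE)
      assume *: "w ! 0 = w' ! j" "w ! 1 = w' ! (Suc j mod k)"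
      then have "w' ! j = w' ! 0" using nth0 4 by simp
      then have "j = 0"
        by (subst (asm) nth_eq_iff_index_eq) (use 4 assms(2) k' j(1) in auto)
      with * have "w' ! 1 = w ! 1" using 4 by auto
      then have "w' = w" using eq[OF assms(2) k' assms(4)] nth0 4 by auto
      then show ?thesis using self_in_dihedral_class by auto
    next
      assume *: "w ! 0 = w' ! (Suc j mod k)" "w ! 1 = w' ! j"
      have "Suc j mod k < k" using 4 by auto
      have "w' ! (Suc j mod k) = w' ! 0" using nth0 4 * by simp
      then have "Suc j mod k = 0"
        by (subst (asm) nth_eq_iff_index_eq) (use 4 assms(2) k' j(1) in auto)
      then have j: "j = k - 1" using j(1) by (cases "Suc j = k") auto
      \<comment> \<open>The first edge of \<open>w\<close> is the closing edge of \<open>w'\<close>,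
        so \<open>w'\<close> runs backwards. Its reversal with the same base point is
        \<open>a # rev t\<close>, and \<open>eq\<close> applies to that.\<close>
      obtain a t where w': "w' = a # t" using k' 4 by (cases w') auto
      have len: "length t = k - 1" "t \<noteq> []" using k' 4 w' by auto
      have rot: "a # rev t = rotate (length t) (rev w')"
        using rotate_append[of "rev t" "[a]"] by (simp add: w')
      have "a # rev t = w"
      proof (rule eq)
        show "set (cycle_edges w) \<subseteq> set (cycle_edges (a # rev t))"
          unfolding rot set_cycle_edges_rotate set_cycle_edges_rev by (rule assms(4))
        show "(a # rev t) ! 1 = w ! 1"
          using * j len w' 4 by (simp add: rev_nth)
      qed (use assms(2) w' len nth0 4 in auto)
      then have "w = a # rev t" by simp
      then have "w' = rotate (length t) (rev w)"
        using rotate_append[of t "[a]"] by (simp add: w')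
      then show ?thesis by (auto simp: dihedral_class_def)
    qed
  qed
qed

lemma dihedral_class_if_edges:
  assumes "distinct w" "distinct w'" "set w' = set w" "set (cycle_edges w) \<subseteq> set (cycle_edges w')"
  shows "w' \<in> dihedral_class w"
proof (cases "w = []")
  case True
  then show ?thesis using assms self_in_dihedral_class by auto
next
  case False
  then have "hd w \<in> set w'" using assms by auto
  then obtain p q where w': "w' = p @ hd w # q" by (auto dest: split_list)
  then have rot: "rotate (length p) w' = hd w # q @ p" by (simp add: rotate_append)
  have "rotate (length p) w' \<in> dihedral_class w"
  proof (rule dihedral_class_if_edges_same_hd)
    show "set (cycle_edges w) \<subseteq> set (cycle_edges (rotate (length p) w'))"
      unfolding set_cycle_edges_rotate by (rule assms)
    show "hd (rotate (length p) w') = hd w" unfolding rot by simp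
  qed (use assms in auto)
  then have "rotate (length (hd w # q)) (rotate (length p) w') \<in> dihedral_class w"
    by (rule dihedral_class_rotate)
  moreover have "rotate (length (hd w # q)) (rotate (length p) w') = w'"
    unfolding rot using rotate_append[of "hd w # q" p] w' by simp
  ultimately show ?thesis by simp
qed

text \<open>There are k rotations and k reflections. For k \<le> 2 every reflection is a rotation,
  for k \<ge> 3 none is.\<close>

lemma card_dihedral_class:
  assumes "distinct w" "w \<noteq> []"
  shows "card (dihedral_class w) = (if length w = 1 then 1 else if length w = 2 then 2 else 2 * length w)"
proof -
  define k where "k = length w"
  have "k > 0" using assms k_def by auto
  define A where "A = (\<lambda>i. rotate i w) ` {..<k}"
  define B where "B = (\<lambda>i. rotate i (rev w)) ` {..<k}"
  have D: "dihedral_class w = A \<union> B"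
  proof -
    have "rotate i u \<in> (\<lambda>i. rotate i u) ` {..<k}" if "length u = k" for i and u :: "'a list"
      using rotate_conv_mod[of i u] that \<open>k > 0\<close> by (auto intro!: image_eqI[of _ _ "i mod k"])
    then show ?thesis unfolding dihedral_class_def A_def B_def using k_def by auto
  qed
  have inj: "inj_on (\<lambda>i. rotate i u) {..<k}" if "length u = k" "distinct u" for u :: "'a list"
  proof (rule inj_onI)
    fix i j assume *: "i \<in> {..<k}" "j \<in> {..<k}" "rotate i u = rotate j u"
    then have "u ! i = u ! j"
      using hd_rotate_conv_nth[of u i] hd_rotate_conv_nth[of u j] that \<open>k > 0\<close> by fastforce
    then show "i = j" using that * by (simp add: nth_eq_iff_index_eq)
  qed
  have cA: "card A = k" unfolding A_def using inj[of w] assms k_def by (simp add: card_image)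
  have cB: "card B = k" unfolding B_def using inj[of "rev w"] assms k_def by (simp add: card_image)
  consider "k = 1" | "k = 2" | "k \<ge> 3" using \<open>k > 0\<close> by linarith
  then show ?thesis
  proof cases
    case 1
    then obtain a where "w = [a]" using k_def by (cases w) auto
    then have "A = B" unfolding A_def B_def by simp
    then show ?thesis using 1 cA D k_def by simp
  next
    case 2
    then obtain a b where w: "w = [a, b]"
      unfolding k_def by (metis One_nat_def Suc_1 length_0_conv length_Suc_conv)
    have "{..<k} = {0, 1}" using 2 by auto
    then have "A = B" unfolding A_def B_def w by auto
    then show ?thesis using 2 cA D k_def by simp
  next
    case 3
    \<comment> \<open>A rotation runs forwards through \<open>w\<close> and a reflection backwards.
      Comparing the positions 0 and 1 would give 1 = -1 modulo k.\<close>
    have "A \<inter> B = {}"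
    proof (rule ccontr)
      assume "A \<inter> B \<noteq> {}"
      then obtain i j where ij: "i < k" "j < k" "rotate i w = rotate j (rev w)"
        unfolding A_def B_def by auto
      have *: "w ! ((m + i) mod k) = w ! (k - 1 - (m + j) mod k)" if "m < k" for m
      proof -
        have "rotate i w ! m = rotate j (rev w) ! m" using ij by simp
        moreover have "(m + j) mod k < k" using \<open>k > 0\<close> by simp
        ultimately show ?thesis using that k_def by (simp add: nth_rotate rev_nth add.commute)
      qed
      have **: "(m + i) mod k = k - 1 - (m + j) mod k" if "m < k" for m
        using *[OF that] assms(1) \<open>k > 0\<close> k_def
          nth_eq_iff_index_eq[of w "(m + i) mod k" "k - 1 - (m + j) mod k"] by simp
      have a: "i = k - 1 - j" using **[of 0] ij \<open>k > 0\<close> by simp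
      have "(1 + i) mod k = k - 1 - (1 + j) mod k" using **[of 1] 3 by simp
      then show False using a ij 3
        by (cases "j = 0"; cases "Suc j = k") auto
    qed
    then show ?thesis using 3 cA cB D k_def
      by (simp add: card_Un_disjoint A_def B_def)
  qed
qed

text \<open>Such a list is an alphabet of \<open>s\<close> entries read through a list of
  \<open>K\<close> indices.\<close>

lemma card_lists_few_values:
  fixes V :: "'a set"
  assumes "finite V" "K > 0"
  shows "card {xs. set xs \<subseteq> V \<and> length xs = K \<and> card (set xs) \<le> s} \<le> card V ^ s * s ^ K"
proof -
  let ?Y = "{ys. set ys \<subseteq> V \<and> length ys = s}" and ?J = "{js. set js \<subseteq> {..<s} \<and> length js = K}"
  have "{xs. set xs \<subseteq> V \<and> length xs = K \<and> card (set xs) \<le> s} \<subseteq>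
        (\<lambda>(ys, js). map ((!) ys) js) ` (?Y \<times> ?J)"
  proof
    fix xs assume "xs \<in> {xs. set xs \<subseteq> V \<and> length xs = K \<and> card (set xs) \<le> s}"
    then have xs: "set xs \<subseteq> V" "length xs = K" "card (set xs) \<le> s" by auto
    have "xs \<noteq> []" using xs(2) assms(2) by auto
    \<comment> \<open>Repeating an entry pads the alphabet to length exactly \<open>s\<close>; this
      takes a nonempty list, hence \<open>K > 0\<close>.\<close>
    define ys where "ys = remdups xs @ replicate (s - card (set xs)) (hd xs)"
    have ys: "set ys = set xs" "length ys = s"
      using xs(3) \<open>xs \<noteq> []\<close> by (auto simp: ys_def length_remdups_card_conv)
    have "\<forall>x \<in> set xs. \<exists>j. j < s \<and> ys ! j = x"
      using ys by (metis in_set_conv_nth)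
    then obtain f where f: "\<And>x. x \<in> set xs \<Longrightarrow> f x < s \<and> ys ! f x = x" by metis
    have "xs = map ((!) ys) (map f xs)" using f by (auto simp: map_idI)
    moreover have "ys \<in> ?Y" using ys xs by auto
    moreover have "map f xs \<in> ?J" using f xs by auto
    ultimately show "xs \<in> (\<lambda>(ys, js). map ((!) ys) js) ` (?Y \<times> ?J)"
      by (intro image_eqI[of _ _ "(ys, map f xs)"]) auto
  qed
  then have "card {xs. set xs \<subseteq> V \<and> length xs = K \<and> card (set xs) \<le> s} \<le>
        card ((\<lambda>(ys, js). map ((!) ys) js) ` (?Y \<times> ?J))"
    by (intro card_mono finite_imageI finite_cartesian_product finite_lists_length_eq) (use assms in auto)
  also have "\<dots> \<le> card (?Y \<times> ?J)"
    by (intro card_image_le finite_cartesian_product finite_lists_length_eq) (use assms in auto)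
  also have "\<dots> = card V ^ s * s ^ K"
    using assms card_lists_length_eq[of V s] card_lists_length_eq[of "{..<s}" K]
    by (simp add: card_cartesian_product)
  finally show ?thesis .
qed

subsection \<open>Expectations of products of walk weights\<close>

text \<open>Rotate the walk to start at \<open>x\<close>. If the two neighbours of \<open>x\<close>
  differ, each edge at \<open>x\<close> is used once and its entry splits off, after a reflection if
  \<open>v\<close> is the last vertex. If they coincide, the walk backtracks at \<open>x\<close>,
  and starting from the neighbour exposes the centered square. The rest \<open>xs\<close> is chosen
  before the matrix \<open>a\<close>, so it is the same for all outcomes of a random matrix.\<close>

lemma cycle_weight_factor:
  assumes "count_list w x = 1" "edge x v \<in> set (cycle_edges w)"
  obtains xs where "edge x v \<notin> set (path_edges xs)"
    and "(\<forall>a::nat \<Rightarrow> nat \<Rightarrow> real. (\<forall>u v. a u v = a v u) \<longrightarrow> cycle_weight a w = a x v * path_weight a xs) \<or>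
      x \<noteq> v \<and> (\<forall>a::nat \<Rightarrow> nat \<Rightarrow> real. (\<forall>u v. a u v = a v u) \<longrightarrow>
        cycle_weight a w = ((a x v)\<^sup>2 - 1) * path_weight a xs)"
proof -
  have "x \<in> set w" using assms(1) by (metis count_list_0_iff zero_neq_one)
  then obtain p q where w: "w = p @ x # q" by (auto dest: split_list)
  define t where "t = q @ p"
  have x: "x \<notin> set t" using assms(1) by (simp add: w t_def count_list_0_iff)
  have rot: "rotate (length p) w = x # t" by (simp add: w t_def rotate_append)
  have cw: "cycle_weight a w = cycle_weight a (x # t)" if "\<forall>u v. a u v = a v u" for a :: "nat \<Rightarrow> nat \<Rightarrow> real"
    using cycle_weight_rotate[OF that, of "length p" w] rot by simp
  have e: "edge x v \<in> set (cycle_edges (x # t))"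
    using assms(2) set_cycle_edges_rotate[of "length p" w] rot by simp
  have key: "edge x b \<notin> set (path_edges (b # (m @ [c]) @ [x])) \<and>
      (\<forall>a::nat \<Rightarrow> nat \<Rightarrow> real. cycle_weight a (x # b # m @ [c]) = a x b * path_weight a (b # (m @ [c]) @ [x]))"
    if "x \<notin> set (b # m @ [c])" "b \<noteq> c" for b m c
  proof -
    have "edge x b \<notin> set (path_edges (b # m @ [c]))" using that(1) path_edges_vertices by blast
    moreover have "edge c x \<noteq> edge x b" using that by (auto simp: edge_eq_iff)
    ultimately have "edge x b \<notin> set (path_edges (b # (m @ [c]) @ [x]))"
      using path_edges_snoc[of "b # m" c x] by auto
    then show ?thesis using cycle_weight_once[of x b "m @ [c]"]
      by (intro conjI allI) simp_all
  qed
  have "t = [] \<or> (\<exists>b. t = [b]) \<or> (\<exists>b m c. t = b # m @ [c])"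
    by (cases t; cases "tl t" rule: rev_cases) auto
  then consider "t = []" | b where "t = [b]" | b m where "t = b # m @ [b]" | b m c where "t = b # m @ [c]" "b \<noteq> c"
    by metis
  then show thesis
  proof cases
    case 1
    then have "v = x" using e by (auto simp: cycle_edges_def edge_eq_iff)
    then show ?thesis using that[of "[]"] cw 1 by (simp add: cycle_weight_singleton)
  next
    case (2 b)
    then have "v = b" "x \<noteq> b" using e x by (auto simp: cycle_edges_def edge_eq_iff)
    then show ?thesis using that[of "[]"] cw 2 by (simp add: cycle_weight_pair power2_eq_square)
  next
    case (3 b m)
    have nx: "edge x v \<notin> set (path_edges (b # m @ [b]))" 
      using x 3 path_edges_vertices by blast
    have "set (cycle_edges (x # t)) = {edge x b} \<union> set (path_edges (b # m @ [b])) \<union> {edge b x}"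
      using path_edges_snoc[of "b # m" b x] by (auto simp: 3 cycle_edges_def)
    with e nx have v: "v = b" by (auto simp: edge_eq_iff)
    have "cycle_weight a w = ((a x v)\<^sup>2 - 1) * path_weight a (b # m @ [b])"
      if "\<forall>u v. a u v = a v u" for a :: "nat \<Rightarrow> nat \<Rightarrow> real"
    proof -
      have "cycle_weight a w = cycle_weight a (b # x # b # m)"
        using cw[OF that] cycle_weight_swap[OF that, of "x # b # m" "[b]"] 3 by simp
      also have "\<dots> = (a b x * a x b - 1) * path_weight a (b # m @ [b])"
        by (rule cycle_weight_backtrack) (use nx v in \<open>simp add: edge_commute\<close>)
      finally show ?thesis using that v by (simp add: power2_eq_square)
    qed
    then show ?thesis using that[of "b # m @ [b]"] nx x 3 v by auto
  next
    case (4 b m c)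
    have "edge x v \<notin> set (path_edges (b # m @ [c]))" 
      using x 4 path_edges_vertices by blast
    moreover have "set (cycle_edges (x # t)) = {edge x b} \<union> set (path_edges (b # m @ [c])) \<union> {edge c x}"
      using path_edges_snoc[of "b # m" c x] by (auto simp: 4 cycle_edges_def)
    ultimately have "v = b \<or> v = c" using e by (auto simp: edge_eq_iff)
    then show ?thesis
    proof
      assume "v = b"
      then show ?thesis using key[of b m c] x 4 cw that by auto
    next
      assume "v = c"
      have "cycle_weight a w = cycle_weight a (x # c # rev m @ [b])"
        if "\<forall>u v. a u v = a v u" for a :: "nat \<Rightarrow> nat \<Rightarrow> real"
        using cw[OF that] cycle_weight_rev[OF that, of "x # t"]
          cycle_weight_swap[OF that, of "c # rev m @ [b]" "[x]"] 4 by simp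
      then show ?thesis using key[of c "rev m" b] x 4 \<open>v = c\<close> that by auto
    qed
  qed
qed

section \<open>Polynomials in the matrix entries and their independence\<close>

context wigner_matrix
begin

definition Z :: "nat \<times> nat \<Rightarrow> 'w \<Rightarrow> real" where "Z e = X (fst e) (snd e)"

definition edges :: "(nat \<times> nat) set" where "edges = {(i, j). i \<le> j}"

lemma edge_in_edges [simp]: "edge u v \<in> edges"
  by (auto simp: edges_def edge_def)

lemma Z_edge: "Z (edge u v) = X u v"
  by (auto simp: Z_def edge_def min_def max_def symmetric)

text \<open>The set \<open>S\<close> records the entries on which a variable depends. Disjoint sets
  then give independence, and the polynomial form gives finite moments of all orders.\<close>

inductive poly_on :: "(nat \<times> nat) set \<Rightarrow> ('w \<Rightarrow> real) \<Rightarrow> bool" for S where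
  const: "poly_on S (\<lambda>_. c)"
| var: "e \<in> S \<Longrightarrow> poly_on S (Z e)"
| add: "poly_on S f \<Longrightarrow> poly_on S g \<Longrightarrow> poly_on S (\<lambda>\<omega>. f \<omega> + g \<omega>)"
| mult: "poly_on S f \<Longrightarrow> poly_on S g \<Longrightarrow> poly_on S (\<lambda>\<omega>. f \<omega> * g \<omega>)"

lemma poly_on_mono: "poly_on S f \<Longrightarrow> S \<subseteq> T \<Longrightarrow> poly_on T f"
  by (induction rule: poly_on.induct) (auto intro: poly_on.intros)

lemma poly_on_diff: "poly_on S f \<Longrightarrow> poly_on S g \<Longrightarrow> poly_on S (\<lambda>\<omega>. f \<omega> - g \<omega>)"
  using poly_on.add[OF _ poly_on.mult[OF poly_on.const[of S "-1"]], of f g] by simp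

lemma poly_on_prod: "(\<And>i. i \<in> R \<Longrightarrow> poly_on S (f i)) \<Longrightarrow> poly_on S (\<lambda>\<omega>. \<Prod>i\<in>R. f i \<omega>)"
  by (induction R rule: infinite_finite_induct) (auto intro: poly_on.intros)

lemma poly_on_sum: "(\<And>i. i \<in> R \<Longrightarrow> poly_on S (f i)) \<Longrightarrow> poly_on S (\<lambda>\<omega>. \<Sum>i\<in>R. f i \<omega>)"
  by (induction R rule: infinite_finite_induct) (auto intro: poly_on.intros)

lemma poly_on_power: "poly_on S f \<Longrightarrow> poly_on S (\<lambda>\<omega>. f \<omega> ^ n)"
  by (induction n) (auto intro: poly_on.intros)

lemma X_measurable [measurable]: "X i j \<in> borel_measurable M"
  using borel_measurable_integrable[OF moments_finite[of i j 1]] by simp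

text \<open>All powers are carried through the induction because integrability alone does not
  survive products.\<close>

lemma poly_on_moments:
  assumes "poly_on S f"
  shows "f \<in> borel_measurable M \<and> (\<forall>n. integrable M (\<lambda>\<omega>. \<bar>f \<omega>\<bar> ^ n))"
  using assms
proof (induction rule: poly_on.induct)
  case (var e)
  have "integrable M (\<lambda>\<omega>. \<bar>Z e \<omega>\<bar> ^ n)" for n
    using integrable_abs[OF moments_finite[of "fst e" "snd e" n]] by (simp add: Z_def power_abs)
  then show ?case by (auto simp: Z_def)
next
  case (add f g)
  have [measurable]: "f \<in> borel_measurable M" "g \<in> borel_measurable M" using add by auto
  have "integrable M (\<lambda>\<omega>. \<bar>f \<omega> + g \<omega>\<bar> ^ n)" for n
  proof (rule Bochner_Integration.integrable_bound[of _ "\<lambda>\<omega>. 2 ^ n * (\<bar>f \<omega>\<bar> ^ n + \<bar>g \<omega>\<bar> ^ n)"])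
    have "\<bar>a + b\<bar> ^ n \<le> 2 ^ n * (\<bar>a\<bar> ^ n + \<bar>b\<bar> ^ n)" for a b :: real
    proof -
      have "\<bar>a + b\<bar> ^ n \<le> (2 * max \<bar>a\<bar> \<bar>b\<bar>) ^ n" by (intro power_mono) auto
      also have "\<dots> \<le> 2 ^ n * (\<bar>a\<bar> ^ n + \<bar>b\<bar> ^ n)"
        unfolding power_mult_distrib by (intro mult_left_mono) (auto simp: max_def)
      finally show ?thesis .
    qed
    then show "AE \<omega> in M. norm (\<bar>f \<omega> + g \<omega>\<bar> ^ n) \<le> norm (2 ^ n * (\<bar>f \<omega>\<bar> ^ n + \<bar>g \<omega>\<bar> ^ n))"
      by auto
  qed (use add in auto)
  then show ?case by auto
next
  case (mult f g)
  have [measurable]: "f \<in> borel_measurable M" "g \<in> borel_measurable M" using mult by auto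
  have "integrable M (\<lambda>\<omega>. \<bar>f \<omega> * g \<omega>\<bar> ^ n)" for n
  proof (rule Bochner_Integration.integrable_bound[of _ "\<lambda>\<omega>. \<bar>f \<omega>\<bar> ^ (2 * n) + \<bar>g \<omega>\<bar> ^ (2 * n)"])
    have "\<bar>a * b\<bar> ^ n \<le> \<bar>a\<bar> ^ (2 * n) + \<bar>b\<bar> ^ (2 * n)" for a b :: real
    proof -
      have "2 * \<bar>a\<bar> ^ n * \<bar>b\<bar> ^ n \<le> (\<bar>a\<bar> ^ n)\<^sup>2 + (\<bar>b\<bar> ^ n)\<^sup>2" by (rule sum_squares_bound)
      moreover have "0 \<le> \<bar>a\<bar> ^ n * \<bar>b\<bar> ^ n" by simp
      ultimately have "\<bar>a\<bar> ^ n * \<bar>b\<bar> ^ n \<le> (\<bar>a\<bar> ^ n)\<^sup>2 + (\<bar>b\<bar> ^ n)\<^sup>2" by linarith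
      then show ?thesis by (simp only: abs_mult power_mult_distrib power_mult mult.commute[of 2])
    qed
    then show "AE \<omega> in M. norm (\<bar>f \<omega> * g \<omega>\<bar> ^ n) \<le> norm (\<bar>f \<omega>\<bar> ^ (2 * n) + \<bar>g \<omega>\<bar> ^ (2 * n))"
      by auto
  qed (use mult in auto)
  then show ?case by auto
qed auto

lemma poly_on_measurable: "poly_on S f \<Longrightarrow> f \<in> borel_measurable M"
  using poly_on_moments by blast

lemma poly_on_integrable: "poly_on S f \<Longrightarrow> integrable M f"
  using poly_on_moments[of S f] by (auto dest: spec[of _ 1] simp: integrable_abs_iff)

text \<open>Independence of two subfamilies of entries is a statement about restricted tuples, so a
  polynomial is exhibited as a measurable function of such a tuple.\<close>

lemma poly_on_factor:
  assumes "poly_on S f"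
  shows "\<exists>F \<in> borel_measurable (PiM S (\<lambda>_. borel)). f = F \<circ> (\<lambda>\<omega>. \<lambda>e\<in>S. Z e \<omega>)"
  using assms
proof (induction rule: poly_on.induct)
  case (const c)
  show ?case by (intro bexI[of _ "\<lambda>_. c"]) auto
next
  case (var e)
  then show ?case by (intro bexI[of _ "\<lambda>x. x e"]) auto
next
  case (add f g)
  then obtain F G where "F \<in> borel_measurable (PiM S (\<lambda>_. borel))" "f = F \<circ> (\<lambda>\<omega>. \<lambda>e\<in>S. Z e \<omega>)"
    "G \<in> borel_measurable (PiM S (\<lambda>_. borel))" "g = G \<circ> (\<lambda>\<omega>. \<lambda>e\<in>S. Z e \<omega>)" by blast
  then show ?case
    by (intro bexI[of _ "\<lambda>x. F x + G x"]) (simp_all only: comp_def borel_measurable_add)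
next
  case (mult f g)
  then obtain F G where "F \<in> borel_measurable (PiM S (\<lambda>_. borel))" "f = F \<circ> (\<lambda>\<omega>. \<lambda>e\<in>S. Z e \<omega>)"
    "G \<in> borel_measurable (PiM S (\<lambda>_. borel))" "g = G \<circ> (\<lambda>\<omega>. \<lambda>e\<in>S. Z e \<omega>)" by blast
  then show ?case
    by (intro bexI[of _ "\<lambda>x. F x * G x"]) (simp_all only: comp_def borel_measurable_times)
qed

lemma indep_Z: "indep_vars (\<lambda>_. borel) Z edges"
  using indep by (simp add: edges_def Z_def[abs_def] case_prod_unfold)

lemma expectation_poly_on_mult:
  assumes f: "poly_on S f" and g: "poly_on T g" and "S \<inter> T = {}" "S \<subseteq> edges" "T \<subseteq> edges"
  shows "expectation (\<lambda>\<omega>. f \<omega> * g \<omega>) = expectation f * expectation g"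
proof -
  obtain F G where F: "F \<in> borel_measurable (PiM S (\<lambda>_. borel))" "f = F \<circ> (\<lambda>\<omega>. \<lambda>e\<in>S. Z e \<omega>)"
    and G: "G \<in> borel_measurable (PiM T (\<lambda>_. borel))" "g = G \<circ> (\<lambda>\<omega>. \<lambda>e\<in>T. Z e \<omega>)"
    using poly_on_factor[OF f] poly_on_factor[OF g] by blast
  have "indep_var (PiM S (\<lambda>_. borel)) (\<lambda>\<omega>. \<lambda>e\<in>S. Z e \<omega>) (PiM T (\<lambda>_. borel)) (\<lambda>\<omega>. \<lambda>e\<in>T. Z e \<omega>)"
    by (rule indep_var_restrict[OF indep_Z]) (use assms in auto)
  from indep_var_compose[OF this F(1) G(1)] have "indep_var borel f borel g"
    using F(2) G(2) by simp
  then show ?thesis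
    by (rule indep_var_lebesgue_integral[OF _ poly_on_integrable[OF f] poly_on_integrable[OF g]])
qed

definition walk_weight :: "nat list \<Rightarrow> 'w \<Rightarrow> real" where
  "walk_weight w \<omega> = cycle_weight (\<lambda>u v. X u v \<omega>) w"

definition centered_weight :: "nat list \<Rightarrow> 'w \<Rightarrow> real" where
  "centered_weight w \<omega> = walk_weight w \<omega> - expectation (walk_weight w)"

definition weight_prod :: "nat set \<Rightarrow> (nat \<Rightarrow> nat list) \<Rightarrow> 'w \<Rightarrow> real" where
  "weight_prod R w \<omega> = (\<Prod>r\<in>R. centered_weight (w r) \<omega>)"

lemma X_sym: "\<forall>u v. X u v \<omega> = X v u \<omega>"
  using symmetric by metis

lemma set_path_edges_subset: "set (path_edges xs) \<subseteq> edges"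
  by (auto simp: set_path_edges)

lemma set_cycle_edges_subset: "set (cycle_edges w) \<subseteq> edges"
  by (auto simp: set_cycle_edges)

lemma poly_on_path_weight: "poly_on (set (path_edges xs)) (\<lambda>\<omega>. path_weight (\<lambda>u v. X u v \<omega>) xs)"
proof -
  have "poly_on S (\<lambda>\<omega>. path_weight (\<lambda>u v. X u v \<omega>) xs)" if "set (path_edges xs) \<subseteq> S" for S
    using that
  \<comment> \<open>\<open>path_weight\<close> recurses on the list only. A dummy matrix supplies
    its induction scheme, as the actual matrix depends on the bound variable
    \<open>\<omega>\<close>.\<close>
  proof (induction "\<lambda>(u::nat) (v::nat). 0::real" xs rule: path_weight.induct)
    case (1 u v z r)
    have "poly_on S (X u v)" using poly_on.var[of "edge u v" S] 1 by (simp add: Z_edge)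
    with 1 show ?case by (cases "u = z") (auto intro!: poly_on_diff poly_on.intros)
  next
    case (2 u v)
    have "poly_on S (X u v)" using poly_on.var[of "edge u v" S] 2 by (simp add: Z_edge)
    then show ?case by (simp add: eta_contract_eq)
  qed (auto intro: poly_on.intros)
  then show ?thesis by blast
qed

lemma poly_on_walk_weight: "poly_on (set (cycle_edges w)) (walk_weight w)"
proof -
  have "set (path_edges (tl w)) \<subseteq> set (cycle_edges w)"
  proof (cases w)
    case (Cons a t)
    have "set (path_edges t) \<subseteq> set (path_edges (t @ [a]))"
      by (induction t rule: path_edges.induct) auto
    moreover have "set (path_edges (t @ [a])) \<subseteq> set (path_edges (a # t @ [a]))"
      by (cases t) auto
    ultimately show ?thesis by (auto simp: Cons cycle_edges_def)
  qed simp
  then have "poly_on (set (cycle_edges w)) (\<lambda>\<omega>. path_weight (\<lambda>u v. X u v \<omega>) (tl w))"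
    by (rule poly_on_mono[OF poly_on_path_weight])
  then have "poly_on (set (cycle_edges w)) (\<lambda>\<omega>.
      if length w \<ge> 3 \<and> last w = w ! 1 then path_weight (\<lambda>u v. X u v \<omega>) (tl w) else 0)"
    by (cases "length w \<ge> 3 \<and> last w = w ! 1") (auto intro: poly_on.const)
  then have "poly_on (set (cycle_edges w)) (\<lambda>\<omega>. path_weight (\<lambda>u v. X u v \<omega>) (w @ [hd w]) -
      (if length w \<ge> 3 \<and> last w = w ! 1 then path_weight (\<lambda>u v. X u v \<omega>) (tl w) else 0))"
    using poly_on_path_weight[of "w @ [hd w]"] unfolding cycle_edges_def
    by (intro poly_on_diff)
  then show ?thesis
    unfolding walk_weight_def[abs_def] cycle_weight_def .
qed

lemma poly_on_centered_weight: "poly_on (set (cycle_edges w)) (centered_weight w)"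
  unfolding centered_weight_def[abs_def]
  by (intro poly_on_diff poly_on_walk_weight poly_on.const)

lemma poly_on_weight_prod: "poly_on (\<Union>r\<in>R. set (cycle_edges (w r))) (weight_prod R w)"
  unfolding weight_prod_def[abs_def]
  by (intro poly_on_prod poly_on_mono[OF poly_on_centered_weight]) auto

lemma walk_weight_dihedral: "w' \<in> dihedral_class w \<Longrightarrow> walk_weight w' = walk_weight w"
  using X_sym by (auto simp: walk_weight_def fun_eq_iff intro: cycle_weight_dihedral)

lemma centered_weight_dihedral: "w' \<in> dihedral_class w \<Longrightarrow> centered_weight w' = centered_weight w"
  using walk_weight_dihedral[of w' w] by (simp add: centered_weight_def[abs_def])

lemma expectation_centered_weight: "expectation (centered_weight w) = 0"
  using poly_on_integrable[OF poly_on_walk_weight[of w]]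
  by (simp add: centered_weight_def[abs_def] prob_space)

lemma expectation_Z: "e \<in> edges \<Longrightarrow> expectation (Z e) = 0"
  using offdiag_mean[of "fst e" "snd e"] diag_mean
  by (cases "fst e = snd e") (auto simp: Z_def edges_def)

lemma expectation_Z_square: "edge u v = e \<Longrightarrow> u \<noteq> v \<Longrightarrow> expectation (\<lambda>\<omega>. (Z e \<omega>)\<^sup>2) = 1"
  using offdiag_second[of "fst e" "snd e"] by (auto simp: Z_def edge_def min_def max_def)

text \<open>Since \<open>g\<close> has mean zero and is independent of \<open>h\<close>, the weight
  of walk \<open>r\<close> has mean zero, so centering leaves it unchanged and \<open>g\<close>
  remains a factor of the whole product. Everything else is independent of the entry
  \<open>e\<close>.\<close>

lemma expectation_weight_prod_factor_0:
  assumes "finite R" "r \<in> R" and eq: "\<And>\<omega>. walk_weight (w r) \<omega> = g \<omega> * h \<omega>"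
    and g: "poly_on {e} g" "expectation g = 0" "e \<in> edges"
    and h: "poly_on S h" "e \<notin> S" "S \<subseteq> edges"
    and others: "\<And>s. s \<in> R - {r} \<Longrightarrow> e \<notin> set (cycle_edges (w s))"
  shows "expectation (weight_prod R w) = 0"
proof -
  have "expectation (walk_weight (w r)) = expectation g * expectation h"
    unfolding eq by (rule expectation_poly_on_mult[OF g(1) h(1)]) (use g h in auto)
  then have "weight_prod R w = (\<lambda>\<omega>. g \<omega> * (h \<omega> * weight_prod (R - {r}) w \<omega>))"
    using assms(1,2) g eq by (simp add: weight_prod_def centered_weight_def prod.remove fun_eq_iff)
  moreover have "expectation (\<lambda>\<omega>. g \<omega> * (h \<omega> * weight_prod (R - {r}) w \<omega>)) =
      expectation g * expectation (\<lambda>\<omega>. h \<omega> * weight_prod (R - {r}) w \<omega>)"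
    by (rule expectation_poly_on_mult[OF g(1), of "S \<union> (\<Union>s\<in>R - {r}. set (cycle_edges (w s)))"])
      (use h others g set_cycle_edges_subset in
        \<open>auto intro!: poly_on.mult intro: poly_on_mono[OF h(1)] poly_on_mono[OF poly_on_weight_prod]\<close>)
  ultimately show ?thesis using g by simp
qed

text \<open>The factor is the entry or, only off the diagonal, its square minus one. Both have mean
  zero, and no other walk sees this entry.\<close>

lemma expectation_single_edge_0:
  assumes "finite R" "r \<in> R" "count_list (w r) x = 1" "edge x v \<in> set (cycle_edges (w r))"
    and others: "\<And>s. s \<in> R - {r} \<Longrightarrow> edge x v \<notin> set (cycle_edges (w s))"
  shows "expectation (weight_prod R w) = 0"
proof -
  obtain xs where xs: "edge x v \<notin> set (path_edges xs)"
    and *: "(\<forall>a::nat \<Rightarrow> nat \<Rightarrow> real. (\<forall>u v. a u v = a v u) \<longrightarrow> cycle_weight a (w r) = a x v * path_weight a xs) \<or>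
      x \<noteq> v \<and> (\<forall>a::nat \<Rightarrow> nat \<Rightarrow> real. (\<forall>u v. a u v = a v u) \<longrightarrow>
        cycle_weight a (w r) = ((a x v)\<^sup>2 - 1) * path_weight a xs)"
    using cycle_weight_factor[OF assms(3,4)] by blast
  let ?h = "\<lambda>\<omega>. path_weight (\<lambda>u v. X u v \<omega>) xs" and ?e = "edge x v"
  have Z: "poly_on {?e} (Z ?e)" by (intro poly_on.var) simp
  from * show ?thesis
  proof (elim disjE conjE)
    assume "\<forall>a::nat \<Rightarrow> nat \<Rightarrow> real. (\<forall>u v. a u v = a v u) \<longrightarrow> cycle_weight a (w r) = a x v * path_weight a xs"
    then have "walk_weight (w r) \<omega> = Z ?e \<omega> * ?h \<omega>" for \<omega>
      using X_sym by (simp add: walk_weight_def Z_edge)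
    then show ?thesis
      using others set_path_edges_subset xs expectation_Z[OF edge_in_edges] poly_on_path_weight
      by (intro expectation_weight_prod_factor_0[OF assms(1,2), where g = "Z ?e" and h = ?h and e = ?e
            and S = "set (path_edges xs)"] Z) auto
  next
    assume "x \<noteq> v" and "\<forall>a::nat \<Rightarrow> nat \<Rightarrow> real. (\<forall>u v. a u v = a v u) \<longrightarrow>
        cycle_weight a (w r) = ((a x v)\<^sup>2 - 1) * path_weight a xs"
    then have eq: "walk_weight (w r) \<omega> = ((Z ?e \<omega>)\<^sup>2 - 1) * ?h \<omega>" for \<omega>
      using X_sym by (simp add: walk_weight_def Z_edge)
    have "integrable M (\<lambda>\<omega>. (Z ?e \<omega>)\<^sup>2)" by (rule poly_on_integrable[OF poly_on_power[OF Z]])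
    then have E0: "expectation (\<lambda>\<omega>. (Z ?e \<omega>)\<^sup>2 - 1) = 0"
      using \<open>x \<noteq> v\<close> by (simp add: expectation_Z_square prob_space)
    have p: "poly_on {?e} (\<lambda>\<omega>. (Z ?e \<omega>)\<^sup>2 - 1)"
      by (intro poly_on_diff poly_on_power Z poly_on.const)
    show ?thesis
      using others set_path_edges_subset xs E0 poly_on_path_weight
      by (intro expectation_weight_prod_factor_0[OF assms(1,2), where g = "\<lambda>\<omega>. (Z ?e \<omega>)\<^sup>2 - 1"
            and h = ?h and e = ?e and S = "set (path_edges xs)"] p eq) auto
  qed
qed

lemma expectation_weight_prod_split:
  assumes "finite R" "Q \<subseteq> R"
    and "\<And>r s. r \<in> Q \<Longrightarrow> s \<in> R - Q \<Longrightarrow> set (w r) \<inter> set (w s) = {}"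
  shows "expectation (weight_prod R w) = expectation (weight_prod Q w) * expectation (weight_prod (R - Q) w)"
proof -
  have "weight_prod R w = (\<lambda>\<omega>. weight_prod Q w \<omega> * weight_prod (R - Q) w \<omega>)"
  proof
    fix \<omega>
    show "weight_prod R w \<omega> = weight_prod Q w \<omega> * weight_prod (R - Q) w \<omega>"
      using prod.subset_diff[OF assms(2,1), of "\<lambda>r. centered_weight (w r) \<omega>"]
      by (simp add: weight_prod_def mult.commute)
  qed
  moreover have "(\<Union>r\<in>Q. set (cycle_edges (w r))) \<inter> (\<Union>r\<in>R - Q. set (cycle_edges (w r))) = {}"
  proof (rule ccontr)
    assume "\<not> ?thesis"
    then obtain r s e where *: "r \<in> Q" "s \<in> R - Q" "e \<in> set (cycle_edges (w r))" "e \<in> set (cycle_edges (w s))"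
      by blast
    then obtain u v where "e = edge u v" by (auto simp: set_cycle_edges)
    with * assms(3)[of r s] show False using cycle_edges_vertices by blast
  qed
  ultimately show ?thesis
    using expectation_poly_on_mult[OF poly_on_weight_prod[of w Q] poly_on_weight_prod[of w "R - Q"]]
      set_cycle_edges_subset by (simp add: UN_subset_iff)
qed

end

section \<open>Visit counts and the tuples of walks that survive\<close>

definition visits :: "nat set \<Rightarrow> (nat \<Rightarrow> nat list) \<Rightarrow> nat \<Rightarrow> nat" where
  "visits R w x = (\<Sum>r\<in>R. count_list (w r) x)"

lemma visits_remove: "finite R \<Longrightarrow> r \<in> R \<Longrightarrow> visits R w x = count_list (w r) x + visits (R - {r}) w x"
  by (simp add: visits_def sum.remove)

lemma visits_eq_0_iff: "finite R \<Longrightarrow> visits R w x = 0 \<longleftrightarrow> (\<forall>r\<in>R. x \<notin> set (w r))"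
  by (simp add: visits_def count_list_0_iff)

lemma count_list_pos: "x \<in> set xs \<Longrightarrow> count_list xs x \<ge> 1"
  using count_list_0_iff[of xs x] by (simp add: Suc_le_eq)

lemma distinct_iff_count_list: "distinct xs \<longleftrightarrow> (\<forall>x. count_list xs x \<le> 1)"
proof (induction xs)
  case (Cons a xs)
  show ?case
  proof
    assume "distinct (a # xs)"
    then show "\<forall>x. count_list (a # xs) x \<le> 1"
      using Cons by (auto simp: count_list_0_iff)
  next
    assume *: "\<forall>x. count_list (a # xs) x \<le> 1"
    have "a \<notin> set xs" using *[rule_format, of a] by (simp add: count_list_0_iff)
    moreover have "\<forall>x. count_list xs x \<le> 1"
      using * by (metis count_list.simps(2) le_SucI add.right_neutral add_leD1)
    ultimately show "distinct (a # xs)" using Cons by simp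
  qed
qed simp

lemma count_list_dihedral: "w' \<in> dihedral_class w \<Longrightarrow> count_list w' x = count_list w x"
  for w :: "nat list"
  using dihedral_class_props(1)[of w' w] by (metis count_mset)

context wigner_matrix
begin

lemma vertex_has_edge: "x \<in> set w \<Longrightarrow> \<exists>v. edge x v \<in> set (cycle_edges w)"
  by (auto simp: set_cycle_edges in_set_conv_nth)

text \<open>All edges at \<open>x\<close> belong to the one walk through \<open>x\<close>, so any of
  them is unshared.\<close>

lemma expectation_single_visit_0:
  assumes "finite R" "visits R w x = 1"
  shows "expectation (weight_prod R w) = 0"
proof -
  obtain r where r: "r \<in> R" "x \<in> set (w r)"
    using assms visits_eq_0_iff[of R w x] by auto
  have *: "count_list (w r) x = 1 \<and> visits (R - {r}) w x = 0"
    using visits_remove[OF assms(1) r(1), of w x] assms(2) count_list_pos[OF r(2)] by linarith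
  obtain v where "edge x v \<in> set (cycle_edges (w r))" using vertex_has_edge[OF r(2)] by blast
  then show ?thesis
    using * visits_eq_0_iff[of "R - {r}" w x] assms(1) cycle_edges_vertices[of x v]
    by (intro expectation_single_edge_0[OF assms(1) r(1), where x = x and v = v]) auto
qed

text \<open>With two visits per vertex, a vertex met once by \<open>w r\<close> lies on exactly one
  other walk, and by \<open>edge_shared\<close> that walk contains the edges of \<open>w r\<close>
  there. Following these edges along \<open>w r\<close> never leaves the partner \<open>s\<close>;
  the same argument for \<open>w s\<close> keeps \<open>s\<close> inside \<open>w r\<close>. Two
  simple cycles on the same vertices, one containing the edges of the other, agree up to rotation
  and reflection.\<close>

lemma partner_walk:
  assumes R: "finite R" "r \<in> R" and vis: "\<And>x. visits R w x \<in> {0, 2}" and "w r \<noteq> []"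
    and nz: "expectation (weight_prod R w) \<noteq> 0"
  shows "distinct (w r) \<and> (\<exists>s\<in>R - {r}. w s \<in> dihedral_class (w r))"
proof -
  have edge_shared: "\<exists>s\<in>R - {r'}. edge x v \<in> set (cycle_edges (w s))"
    if "r' \<in> R" "count_list (w r') x = 1" "edge x v \<in> set (cycle_edges (w r'))" for r' x v
    using expectation_single_edge_0[where w = w, OF R(1) that] nz by blast
  have two: "s = s'" if "r' \<in> R" "s \<in> R - {r'}" "s' \<in> R - {r'}" "x \<in> set (w r')" "x \<in> set (w s)" "x \<in> set (w s')"
    for r' s s' x
  proof (rule ccontr)
    assume "s \<noteq> s'"
    then have "visits R w x = count_list (w r') x + (count_list (w s) x +
        (count_list (w s') x + visits (R - {r'} - {s} - {s'}) w x))"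
      using visits_remove[OF R(1) that(1)] visits_remove[of "R - {r'}" s]
        visits_remove[of "R - {r'} - {s}" s'] R(1) that by simp
    then have "visits R w x \<ge> 3" using that(4-6)[THEN count_list_pos] by linarith
    then show False using vis[of x] by auto
  qed
  have count1: "count_list (w r') x = 1" if "r' \<in> R" "s \<in> R" "r' \<noteq> s" "x \<in> set (w r')" "x \<in> set (w s)" for r' s x
  proof -
    have "visits R w x = count_list (w r') x + (count_list (w s) x + visits (R - {r'} - {s}) w x)"
      using visits_remove[OF R(1) that(1)] visits_remove[of "R - {r'}" s] R(1) that by simp
    then show ?thesis using that(4,5)[THEN count_list_pos] vis[of x] by auto
  qed
  \<comment> \<open>A walk that visits some vertices once and some twice has an edge between the two kinds; the
    doubly visited end is not on any other walk, so this edge is not shared.\<close>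
  have dist: "distinct (w r)"
  proof (rule ccontr)
    assume "\<not> distinct (w r)"
    then obtain y where y: "count_list (w r) y \<ge> 2"
      unfolding distinct_iff_count_list by (metis Suc_1 not_less_eq_eq)
    then have yw: "y \<in> set (w r)" by (metis count_list_0_iff not_numeral_le_zero)
    have excl: "x \<notin> set (w s)" if "count_list (w r) x \<noteq> 1" "x \<in> set (w r)" "s \<in> R - {r}" for x s
      using count1[OF R(2), of s x] that by auto
    show False
    proof (cases "\<exists>z\<in>set (w r). count_list (w r) z = 1")
      case True
      then obtain z where z: "z \<in> set (w r)" "count_list (w r) z = 1" by blast
      obtain u v where uv: "edge u v \<in> set (cycle_edges (w r))" "count_list (w r) u = 1" "count_list (w r) v \<noteq> 1"
        using cycle_split_edge[of z "w r" "\<lambda>x. count_list (w r) x = 1" y] z y yw by auto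
      obtain s where "s \<in> R - {r}" "edge u v \<in> set (cycle_edges (w s))"
        using edge_shared[OF R(2) uv(2,1)] by blast
      then show False
        using excl[OF uv(3)] cycle_edges_vertices[of u v "w s"] cycle_edges_vertices[OF uv(1)] by blast
    next
      case False
      \<comment> \<open>Every vertex of \<open>w r\<close> has both of its visits there. The walk is
        disjoint from all others, and its centered weight splits off with mean zero.\<close>
      have "expectation (weight_prod R w) = expectation (weight_prod {r} w) * expectation (weight_prod (R - {r}) w)"
        by (rule expectation_weight_prod_split[OF R(1)]) (use R(2) excl False in auto)
      also have "expectation (weight_prod {r} w) = 0"
        using expectation_centered_weight[of "w r"] by (simp add: weight_prod_def[abs_def])
      finally show False using nz by simp
    qed
  qed
  have c1: "count_list (w r) x = 1" if "x \<in> set (w r)" for x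
    using dist that count_list_pos[OF that] distinct_iff_count_list[of "w r"] le_antisym by blast
  define x0 where "x0 = hd (w r)"
  have x0: "x0 \<in> set (w r)" using \<open>w r \<noteq> []\<close> by (simp add: x0_def)
  obtain v0 where v0: "edge x0 v0 \<in> set (cycle_edges (w r))" using vertex_has_edge[OF x0] by blast
  obtain s where s: "s \<in> R - {r}" "x0 \<in> set (w s)"
    using edge_shared[OF R(2) c1[OF x0] v0] cycle_edges_vertices[of x0 v0] by blast
  have shared_s: "edge x v \<in> set (cycle_edges (w s))"
    if "x \<in> set (w s)" "edge x v \<in> set (cycle_edges (w r))" for x v
  proof -
    have x: "x \<in> set (w r)" using cycle_edges_vertices[OF that(2)] by simp
    from edge_shared[OF R(2) c1[OF x] that(2)]
    obtain t where t: "t \<in> R - {r}" "edge x v \<in> set (cycle_edges (w t))" by blast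
    have "t = s"
      using two[OF R(2) t(1) s(1) x _ that(1)] cycle_edges_vertices[OF t(2)] by blast
    with t show ?thesis by simp
  qed
  have sub1: "set (w r) \<subseteq> set (w s)"
  proof (rule ccontr)
    assume "\<not> ?thesis"
    then obtain b where b: "b \<in> set (w r)" "b \<notin> set (w s)" by blast
    obtain u v where uv: "edge u v \<in> set (cycle_edges (w r))" "u \<in> set (w s)" "v \<notin> set (w s)"
      using cycle_split_edge[of x0 "w r" "\<lambda>x. x \<in> set (w s)" b] x0 s b by blast
    then show False using cycle_edges_vertices[OF shared_s[OF uv(2,1)]] by simp
  qed
  have sub2: "set (w s) \<subseteq> set (w r)"
  proof (rule ccontr)
    assume "\<not> ?thesis"
    then obtain b where b: "b \<in> set (w s)" "b \<notin> set (w r)" by blast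
    obtain u v where uv: "edge u v \<in> set (cycle_edges (w s))" "u \<in> set (w r)" "v \<notin> set (w r)"
      using cycle_split_edge[of x0 "w s" "\<lambda>x. x \<in> set (w r)" b] x0 s b by blast
    have us: "u \<in> set (w s)" using cycle_edges_vertices[OF uv(1)] by simp
    \<comment> \<open>One of the two visits to \<open>u\<close> is made by \<open>w s\<close>, so
      its edge to \<open>v\<close> must be shared. The only walk left to share it is
      \<open>w r\<close>, which misses \<open>v\<close>.\<close>
    have "count_list (w s) u = 1" using count1[of s r u] s R us uv by auto
    then obtain t where t: "t \<in> R - {s}" "edge u v \<in> set (cycle_edges (w t))"
      using edge_shared[of s u v] s uv by blast
    then have "t = r" using two[of s t r u] s R us uv(2) cycle_edges_vertices[OF t(2)] by blast
    then show False using uv(3) cycle_edges_vertices[OF t(2)] by simp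
  qed
  have "distinct (w s)"
    unfolding distinct_iff_count_list
  proof
    fix x
    show "count_list (w s) x \<le> 1"
      using count1[of s r x] s R sub2 count_list_0_iff[of "w s" x] by (cases "x \<in> set (w s)") auto
  qed
  moreover have "set (cycle_edges (w r)) \<subseteq> set (cycle_edges (w s))"
  proof
    fix e assume e: "e \<in> set (cycle_edges (w r))"
    then obtain u v where uv: "e = edge u v" by (auto simp: set_cycle_edges)
    with e have "u \<in> set (w r)" using cycle_edges_vertices[of u v] by simp
    then show "e \<in> set (cycle_edges (w s))" using e uv shared_s[of u v] sub1 by blast
  qed
  ultimately have "w s \<in> dihedral_class (w r)"
    using sub1 sub2 dist by (intro dihedral_class_if_edges) auto
  then show ?thesis using s dist by blast
qed

text \<open>Second moment of the centered weight of a simple cycle: a diagonal entry for k = 1, a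
  centered squared entry for k = 2, and a product of distinct off-diagonal entries beyond.\<close>

definition weight_var :: "nat \<Rightarrow> real" where
  "weight_var k = (if k = 1 then d2 else if k = 2 then m4 - 1 else 1)"

lemma path_weight_distinct_second_moment:
  assumes "distinct xs"
  shows "expectation (\<lambda>\<omega>. (path_weight (\<lambda>u v. X u v \<omega>) xs)\<^sup>2) = 1"
  using assms
proof (induction xs rule: path_edges.induct)
  case (1 u v r)
  have e: "edge u v \<notin> set (path_edges (v # r))" using 1(2) path_edges_vertices by force
  have "(path_weight (\<lambda>u v. X u v \<omega>) (u # v # r))\<^sup>2 =
      (Z (edge u v) \<omega>)\<^sup>2 * (path_weight (\<lambda>u v. X u v \<omega>) (v # r))\<^sup>2" for \<omega>
    using path_weight_distinct_Cons[of u r "\<lambda>u v. X u v \<omega>" v] 1(2) by (simp add: Z_edge power_mult_distrib)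
  moreover have "expectation (\<lambda>\<omega>. (Z (edge u v) \<omega>)\<^sup>2 * (path_weight (\<lambda>u v. X u v \<omega>) (v # r))\<^sup>2) =
      expectation (\<lambda>\<omega>. (Z (edge u v) \<omega>)\<^sup>2) * expectation (\<lambda>\<omega>. (path_weight (\<lambda>u v. X u v \<omega>) (v # r))\<^sup>2)"
    by (rule expectation_poly_on_mult[of "{edge u v}" _ "set (path_edges (v # r))"])
      (use e set_path_edges_subset in \<open>auto intro!: poly_on_power poly_on.var poly_on_path_weight\<close>)
  ultimately show ?case using 1 by (simp add: expectation_Z_square)
qed (auto simp: prob_space)

lemma expectation_centered_weight_square:
  assumes "distinct w" "w \<noteq> []"
  shows "expectation (\<lambda>\<omega>. (centered_weight w \<omega>)\<^sup>2) = weight_var (length w)"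
proof -
  consider a where "w = [a]" | a b where "w = [a, b]" | a b t where "w = a # b # t" "t \<noteq> []"
    using assms(2) by (cases w; cases "tl w"; cases "tl (tl w)") auto
  then show ?thesis
  proof cases
    case (1 a)
    then have "centered_weight w = X a a"
      by (simp add: centered_weight_def[abs_def] walk_weight_def[abs_def] cycle_weight_singleton diag_mean)
    then show ?thesis by (simp add: 1 weight_var_def diag_second)
  next
    case (2 a b)
    define i j where "i = min a b" "j = max a b"
    have ij: "i < j" "X a b = X i j"
      using assms(1) 2 symmetric by (auto simp: i_j_def min_def max_def)
    have int: "integrable M (\<lambda>\<omega>. (X i j \<omega>)\<^sup>2)" "integrable M (\<lambda>\<omega>. (X i j \<omega>) ^ 4)"
      by (auto intro: moments_finite)
    have "walk_weight w = (\<lambda>\<omega>. (X i j \<omega>)\<^sup>2 - 1)"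
      using symmetric[of a b] ij(2)
      by (simp add: 2 walk_weight_def[abs_def] cycle_weight_pair power2_eq_square)
    then have "centered_weight w = (\<lambda>\<omega>. (X i j \<omega>)\<^sup>2 - 1)"
      using int offdiag_second[OF ij(1)] by (simp add: centered_weight_def[abs_def] prob_space)
    then have "(\<lambda>\<omega>. (centered_weight w \<omega>)\<^sup>2) = (\<lambda>\<omega>. X i j \<omega> ^ 4 - 2 * (X i j \<omega>)\<^sup>2 + 1)"
      by (auto simp: power2_eq_square power4_eq_xxxx algebra_simps)
    then have "expectation (\<lambda>\<omega>. (centered_weight w \<omega>)\<^sup>2) = m4 - 1"
      using int offdiag_second[OF ij(1)] offdiag_fourth[OF ij(1)] by (simp add: prob_space)
    then show ?thesis by (simp add: 2 weight_var_def)
  next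
    case (3 a b t)
    let ?p = "\<lambda>\<omega>. path_weight (\<lambda>u v. X u v \<omega>) (b # t @ [a])"
    have d: "distinct (b # t @ [a])" using assms(1) 3 by auto
    have e: "edge a b \<notin> set (path_edges (b # t @ [a]))"
    proof -
      obtain t' c where t: "t = t' @ [c]" using 3 by (cases t rule: rev_cases) auto
      have "edge a b \<notin> set (path_edges (b # t))"
        using path_edges_vertices[of a b "b # t"] assms(1) 3 by auto
      moreover have "edge c a \<noteq> edge a b" using assms(1) 3 t by (auto simp: edge_eq_iff)
      ultimately show ?thesis using path_edges_snoc[of "b # t'" c a] t by auto
    qed
    have eq: "walk_weight w = (\<lambda>\<omega>. Z (edge a b) \<omega> * ?p \<omega>)"
      by (rule ext) (simp only: walk_weight_def 3 Z_edge cycle_weight_once[OF e])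
    have "expectation (\<lambda>\<omega>. Z (edge a b) \<omega> * ?p \<omega>) = expectation (Z (edge a b)) * expectation ?p"
      by (rule expectation_poly_on_mult[OF poly_on.var poly_on_path_weight, of _ "{edge a b}"])
        (use e set_path_edges_subset in auto)
    then have "centered_weight w = walk_weight w"
      by (simp add: centered_weight_def[abs_def] eq expectation_Z)
    then have "(\<lambda>\<omega>. (centered_weight w \<omega>)\<^sup>2) = (\<lambda>\<omega>. (Z (edge a b) \<omega>)\<^sup>2 * (?p \<omega>)\<^sup>2)"
      by (simp add: eq power_mult_distrib)
    moreover have "expectation (\<lambda>\<omega>. (Z (edge a b) \<omega>)\<^sup>2 * (?p \<omega>)\<^sup>2) =
        expectation (\<lambda>\<omega>. (Z (edge a b) \<omega>)\<^sup>2) * expectation (\<lambda>\<omega>. (?p \<omega>)\<^sup>2)"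
      by (rule expectation_poly_on_mult[of "{edge a b}" _ "set (path_edges (b # t @ [a]))"])
        (use e set_path_edges_subset in \<open>auto intro!: poly_on_power poly_on.var poly_on_path_weight\<close>)
    moreover have "a \<noteq> b" using assms(1) 3 by auto
    ultimately have "expectation (\<lambda>\<omega>. (centered_weight w \<omega>)\<^sup>2) = 1"
      using path_weight_distinct_second_moment[OF d] by (simp add: expectation_Z_square)
    then show ?thesis using 3 by (cases t) (auto simp: weight_var_def)
  qed
qed

text \<open>The pair uses up the two visits allowed at each of its vertices, so the other walks are
  disjoint from it and independent of it.\<close>

lemma expectation_partner:
  assumes R: "finite R" "r \<in> R" "s \<in> R - {r}" and vis: "\<And>x. visits R w x \<le> 2"
    and "distinct (w r)" "w r \<noteq> []" "w s \<in> dihedral_class (w r)"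
  shows "expectation (weight_prod R w) = weight_var (length (w r)) * expectation (weight_prod (R - {r, s}) w)"
proof -
  have "expectation (weight_prod R w) = expectation (weight_prod {r, s} w) * expectation (weight_prod (R - {r, s}) w)"
  proof (rule expectation_weight_prod_split[OF R(1)])
    have "x \<notin> set (w t)" if "x \<in> set (w r)" "t \<in> R - {r, s}" for x t
    proof
      assume "x \<in> set (w t)"
      moreover have "x \<in> set (w s)" using that dihedral_class_props(3)[OF assms(7)] by simp
      moreover have "visits R w x = count_list (w r) x + (count_list (w s) x +
        (count_list (w t) x + visits (R - {r} - {s} - {t}) w x))"
        using visits_remove[OF R(1,2)] visits_remove[of "R - {r}" s]
          visits_remove[of "R - {r} - {s}" t] R that by simp
      ultimately have "visits R w x \<ge> 3"
        using that(1) count_list_pos[of x "w r"] count_list_pos[of x "w s"] count_list_pos[of x "w t"] by linarith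
      then show False using vis[of x] by simp
    qed
    then show "set (w i) \<inter> set (w j) = {}" if "i \<in> {r, s}" "j \<in> R - {r, s}" for i j
      using that dihedral_class_props(3)[OF assms(7)] by auto
  qed (use R in auto)
  moreover have "weight_prod {r, s} w = (\<lambda>\<omega>. (centered_weight (w r) \<omega>)\<^sup>2)"
    using R(3) centered_weight_dihedral[OF assms(7)]
    by (auto simp: weight_prod_def[abs_def] power2_eq_square)
  ultimately show ?thesis using expectation_centered_weight_square[OF assms(5,6)] by simp
qed

text \<open>If a vertex is visited once, both sides vanish. Otherwise at most one summand is
  nonzero, since a second partner would cause a third visit. Written as a sum over \<open>s\<close>,
  the pairing can be summed over all tuples of walks.\<close>

lemma expectation_weight_prod_recursion:
  assumes R: "finite R" "r \<in> R" "w r \<noteq> []"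
    and vis: "(\<exists>x. visits R w x = 1) \<or> (\<forall>x. visits R w x \<in> {0, 2})"
  shows "expectation (weight_prod R w) =
    (\<Sum>s\<in>R - {r}. if distinct (w r) \<and> w s \<in> dihedral_class (w r)
      then weight_var (length (w r)) * expectation (weight_prod (R - {r, s}) w) else 0)"
proof (cases "\<exists>x. visits R w x = 1")
  case True
  then obtain x where x: "visits R w x = 1" by blast
  \<comment> \<open>Two equivalent walks visit each vertex equally often, so the single visit to
    \<open>x\<close> is made by one of the remaining walks.\<close>
  have "expectation (weight_prod (R - {r, s}) w) = 0" if "s \<in> R - {r}" "w s \<in> dihedral_class (w r)" for s
  proof (rule expectation_single_visit_0)
    have "visits R w x = count_list (w r) x + (count_list (w s) x + visits (R - {r} - {s}) w x)"
      using visits_remove[OF R(1,2)] visits_remove[of "R - {r}" s] R(1) that by simp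
    moreover have "R - {r} - {s} = R - {r, s}" by auto
    ultimately show "visits (R - {r, s}) w x = 1"
      using x count_list_dihedral[OF that(2), of x] by simp
  qed (use R in simp)
  then show ?thesis
    using expectation_single_visit_0[OF R(1) x] by (simp add: sum.neutral)
next
  case False
  with vis have vis: "visits R w x \<in> {0, 2}" for x by blast
  show ?thesis
  proof (cases "distinct (w r) \<and> (\<exists>s\<in>R - {r}. w s \<in> dihedral_class (w r))")
    case True
    then obtain s where s: "s \<in> R - {r}" "w s \<in> dihedral_class (w r)" and d: "distinct (w r)" by blast
    have uniq: "s' = s" if "s' \<in> R - {r}" "w s' \<in> dihedral_class (w r)" for s'
    proof (rule ccontr)
      assume "s' \<noteq> s"
      define x where "x = hd (w r)"
      have x: "x \<in> set (w r)" using R by (simp add: x_def)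
      have "visits R w x = count_list (w r) x + (count_list (w s) x +
        (count_list (w s') x + visits (R - {r} - {s} - {s'}) w x))"
        using visits_remove[OF R(1,2)] visits_remove[of "R - {r}" s]
          visits_remove[of "R - {r} - {s}" s'] R that s \<open>s' \<noteq> s\<close> by simp
      then show False
        using vis[of x] count_list_pos[OF x] count_list_dihedral[OF s(2), of x]
          count_list_dihedral[OF that(2), of x] by auto
    qed
    have "(\<Sum>s\<in>R - {r}. if distinct (w r) \<and> w s \<in> dihedral_class (w r)
      then weight_var (length (w r)) * expectation (weight_prod (R - {r, s}) w) else 0) =
      (\<Sum>s'\<in>R - {r}. if s' = s
      then weight_var (length (w r)) * expectation (weight_prod (R - {r, s}) w) else 0)"
    proof (rule sum.cong[OF refl])
      fix t assume t: "t \<in> R - {r}"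
      show "(if distinct (w r) \<and> w t \<in> dihedral_class (w r)
          then weight_var (length (w r)) * expectation (weight_prod (R - {r, t}) w) else 0) =
        (if t = s then weight_var (length (w r)) * expectation (weight_prod (R - {r, s}) w) else 0)"
        using uniq[OF t] s(2) d by (cases "t = s") auto
    qed
    also have "\<dots> = weight_var (length (w r)) * expectation (weight_prod (R - {r, s}) w)"
      using s R by simp
    also have "\<dots> = expectation (weight_prod R w)"
    proof (rule expectation_partner[symmetric])
      show "visits R w x \<le> 2" for x using vis[of x] by auto
    qed (use R s d in auto)
    finally show ?thesis by simp
  next
    case nomatch: False
    then have "expectation (weight_prod R w) = 0"
      using partner_walk[OF R(1,2) vis R(3)] by blast
    moreover have "(\<Sum>s\<in>R - {r}. if distinct (w r) \<and> w s \<in> dihedral_class (w r)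
      then weight_var (length (w r)) * expectation (weight_prod (R - {r, s}) w) else 0) = 0"
      using nomatch by (intro sum.neutral) auto
    ultimately show ?thesis by simp
  qed
qed

end

subsection \<open>The moment recursion\<close>

lemma sum_PiE_insert:
  fixes F :: "('a \<Rightarrow> 'b) \<Rightarrow> 'c::comm_monoid_add"
  assumes "r \<notin> A"
  shows "(\<Sum>w\<in>PiE (insert r A) (\<lambda>_. L). F w) = (\<Sum>a\<in>L. \<Sum>w\<in>PiE A (\<lambda>_. L). F (w(r := a)))"
proof -
  have "(\<Sum>w\<in>PiE (insert r A) (\<lambda>_. L). F w) =
      (\<Sum>w\<in>(\<lambda>(y, g). g(r := y)) ` (L \<times> PiE A (\<lambda>_. L)). F w)"
    by (simp add: PiE_insert_eq)
  also have "\<dots> = (\<Sum>(a, w)\<in>L \<times> PiE A (\<lambda>_. L). F (w(r := a)))"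
    by (subst sum.reindex[OF inj_combinator[OF assms]]) (simp add: case_prod_unfold comp_def)
  finally show ?thesis by (simp add: sum.cartesian_product)
qed

text \<open>A crude replacement for the Hoelder inequality: every factor is at most the largest one.
  The 1 covers the empty product.\<close>

lemma prod_le_one_plus_sum_power:
  fixes y :: "'a \<Rightarrow> real"
  assumes "finite R" "\<And>r. r \<in> R \<Longrightarrow> 0 \<le> y r"
  shows "(\<Prod>r\<in>R. y r) \<le> 1 + (\<Sum>r\<in>R. y r ^ card R)"
proof (cases "R = {}")
  case False
  define m where "m = Max (y ` R)"
  have "m \<in> y ` R" unfolding m_def using assms False by (intro Max_in) auto
  then obtain s where s: "s \<in> R" "y s = m" by auto
  have "(\<Prod>r\<in>R. y r) \<le> (\<Prod>r\<in>R. m)"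
    using assms by (intro prod_mono) (auto simp: m_def)
  also have "\<dots> = y s ^ card R" using s by simp
  also have "\<dots> \<le> (\<Sum>r\<in>R. y r ^ card R)"
    using assms s by (intro member_le_sum) auto
  finally show ?thesis by simp
qed simp

section \<open>Bounds for walk weights and for the number of exceptional tuples\<close>

lemma prod_list_one_plus_ge:
  fixes g :: "'a \<Rightarrow> real"
  assumes "\<And>e. 0 \<le> g e"
  shows "1 \<le> (\<Prod>e\<leftarrow>es. 1 + g e)"
proof (induction es)
  case (Cons e es)
  have "1 * 1 \<le> (1 + g e) * (\<Prod>e\<leftarrow>es. 1 + g e)"
    using Cons assms[of e] by (intro mult_mono) auto
  then show ?case by simp
qed simp

text \<open>All factors are at least 1, so shortening the path decreases the product. The summand 1
  in the factor of the first edge therefore absorbs the subtracted term.\<close>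

lemma abs_path_weight_le:
  fixes a :: "nat \<Rightarrow> nat \<Rightarrow> real"
  assumes "\<forall>u v. a u v = a v u"
  shows "\<bar>path_weight a xs\<bar> \<le> (\<Prod>e\<leftarrow>path_edges xs. 1 + \<bar>a (fst e) (snd e)\<bar>)"
  using assms
proof (induction a xs rule: path_weight.induct)
  case (1 a u v z r)
  let ?P = "\<lambda>xs. \<Prod>e\<leftarrow>path_edges xs. 1 + \<bar>a (fst e) (snd e)\<bar>"
  have e: "\<bar>a (fst (edge u v)) (snd (edge u v))\<bar> = \<bar>a u v\<bar>" for u v
    using 1(3) by (auto simp: edge_def min_def max_def)
  have P: "?P (x # y # q) = (1 + \<bar>a x y\<bar>) * ?P (y # q)" for x y q
    using e[of x y] by simp
  have ge: "1 \<le> ?P xs" for xs by (rule prod_list_one_plus_ge) simp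
  have step: "?P q \<le> ?P (y # q)" for y q
  proof (cases q)
    case (Cons c d)
    have "1 * ?P q \<le> (1 + \<bar>a y c\<bar>) * ?P q" using ge[of q] by (intro mult_right_mono) auto
    then show ?thesis unfolding Cons P by (simp only: mult_1_left)
  qed simp
  have "\<bar>path_weight a (u # v # z # r)\<bar> \<le> \<bar>a u v * path_weight a (v # z # r)\<bar> +
      \<bar>if u = z then path_weight a (z # r) else 0\<bar>"
    unfolding path_weight.simps by (rule abs_triangle_ineq4)
  also have "\<dots> \<le> \<bar>a u v\<bar> * ?P (v # z # r) + ?P (v # z # r)"
  proof (intro add_mono)
    show "\<bar>a u v * path_weight a (v # z # r)\<bar> \<le> \<bar>a u v\<bar> * ?P (v # z # r)"
      unfolding abs_mult using 1(1)[OF 1(3)] by (rule mult_left_mono) simp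
    have "0 \<le> ?P (v # z # r)" using ge[of "v # z # r"] by linarith
    then show "\<bar>if u = z then path_weight a (z # r) else 0\<bar> \<le> ?P (v # z # r)"
      using 1(2)[OF _ 1(3)] step[of "z # r" v] by (cases "u = z") auto
  qed
  also have "\<dots> = ?P (u # v # z # r)" unfolding P[of u v] by (simp add: algebra_simps)
  finally show ?case .
next
  case (2 a u v)
  then show ?case by (auto simp: edge_def min_def max_def)
qed auto

lemma abs_cycle_weight_le:
  fixes a :: "nat \<Rightarrow> nat \<Rightarrow> real"
  assumes "\<forall>u v. a u v = a v u"
  shows "\<bar>cycle_weight a w\<bar> \<le> 2 * (\<Prod>e\<leftarrow>cycle_edges w. 1 + \<bar>a (fst e) (snd e)\<bar>)"
proof (cases w)
  case (Cons x t)
  let ?P = "\<lambda>xs. \<Prod>e\<leftarrow>path_edges xs. 1 + \<bar>a (fst e) (snd e)\<bar>"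
  have ge: "1 \<le> (\<Prod>e\<leftarrow>es. 1 + \<bar>a (fst e) (snd e)\<bar>)" for es by (rule prod_list_one_plus_ge) simp
  have mono: "(\<Prod>e\<leftarrow>es. 1 + \<bar>a (fst e) (snd e)\<bar>) \<le> (\<Prod>e\<leftarrow>ds @ es @ fs. 1 + \<bar>a (fst e) (snd e)\<bar>)" for ds es fs
  proof -
    let ?L = "\<lambda>es. \<Prod>e\<leftarrow>es. 1 + \<bar>a (fst e) (snd e)\<bar>"
    have "1 * (?L es * 1) \<le> ?L ds * (?L es * ?L fs)"
      using ge[of ds] ge[of es] ge[of fs] by (intro mult_mono) auto
    then show ?thesis by simp
  qed
  have "\<exists>ds fs. path_edges (x # t @ [x]) = ds @ path_edges t @ fs"
  proof (cases t rule: rev_cases)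
    case (snoc q y)
    have "path_edges (x # t @ [x]) = take 1 (path_edges (x # t @ [x])) @ path_edges t @ [edge y x]"
      using path_edges_snoc[of q y x] snoc by (cases q) auto
    then show ?thesis by blast
  qed auto
  then have "?P t \<le> ?P (w @ [hd w])" using mono Cons by force
  then have "\<bar>path_weight a (tl w)\<bar> \<le> ?P (w @ [hd w])"
    using abs_path_weight_le[OF assms, of t] Cons by simp
  then show ?thesis
    using abs_path_weight_le[OF assms, of "w @ [hd w]"] unfolding cycle_weight_def cycle_edges_def
    by auto
qed (simp add: cycle_weight_def cycle_edges_def)

text \<open>Concatenation turns tuples with prescribed lengths injectively into lists of length K.
  If each of the vertices is visited at least twice and one of them a third time, twice their number
  plus one is at most K. The resulting exponent \<open>(K - 1) div 2\<close> lies at least one half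
  below the balance K / 2.\<close>

lemma card_bad_walks:
  assumes "finite V" "V \<noteq> {}"
  shows "card {w \<in> PiE {..<q} (\<lambda>_. {u. set u \<subseteq> V}). (\<forall>r<q. length (w r) = l r) \<and>
      (\<forall>x. visits {..<q} w x \<noteq> 1) \<and> (\<exists>x. visits {..<q} w x \<notin> {0, 2})}
    \<le> card V ^ ((sum l {..<q} - 1) div 2) * ((sum l {..<q} - 1) div 2) ^ sum l {..<q}"
  (is "card ?B \<le> _")
proof -
  define K where "K = sum l {..<q}"
  define s where "s = (K - 1) div 2"
  let ?f = "\<lambda>w. concat (map w [0..<q])"
  have cnt: "count_list (?f w) x = visits {..<q} w x" for w :: "nat \<Rightarrow> nat list" and x
    unfolding visits_def by (induction q) (auto simp: add.commute)
  have len: "length (?f w) = K" if "\<forall>r<q. length (w r) = l r" for w :: "nat \<Rightarrow> nat list"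
    using that unfolding K_def by (induction q) (auto simp: add.commute)
  have "inj_on ?f ?B"
  proof (rule inj_onI)
    fix w w' assume w: "w \<in> ?B" "w' \<in> ?B" "?f w = ?f w'"
    then have "map w [0..<q] = map w' [0..<q]"
      by (intro concat_injective) (auto simp: set_zip)
    then have "w r = w' r" if "r < q" for r
      using that by simp
    then show "w = w'" using w by (intro PiE_ext[of w "{..<q}" "\<lambda>_. {u. set u \<subseteq> V}"]) auto
  qed
  moreover have "?f ` ?B \<subseteq> {xs. set xs \<subseteq> V \<and> length xs = K \<and> card (set xs) \<le> s}" and "K > 0 \<or> ?B = {}"
  proof -
    have *: "set (?f w) \<subseteq> V \<and> length (?f w) = K \<and> card (set (?f w)) \<le> s \<and> K > 0" if wB: "w \<in> ?B" for w
    proof -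
      obtain x where x: "visits {..<q} w x \<notin> {0, 2}" using wB by blast
      have nx: "visits {..<q} w y \<noteq> 1" for y using wB by auto
      have x3: "visits {..<q} w x \<ge> 3" using x nx[of x] by auto
      have xs: "x \<in> set (?f w)" using x3 cnt[of w x] count_list_0_iff[of "?f w" x] by auto
      have l: "length (?f w) = K" using wB by (intro len) auto
      have "2 * card (set (?f w)) + 1 = (\<Sum>y\<in>set (?f w). 2 + (if y = x then 1 else 0))"
        using xs unfolding sum.distrib by simp
      also have "\<dots> \<le> (\<Sum>y\<in>set (?f w). count_list (?f w) y)"
      proof (rule sum_mono)
        fix y assume "y \<in> set (?f w)"
        then have "visits {..<q} w y \<ge> 1" using count_list_pos[of y "?f w"] cnt[of w y] by simp
        then show "2 + (if y = x then 1 else 0) \<le> count_list (?f w) y"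
          using nx[of y] x3 unfolding cnt by auto
      qed
      also have "\<dots> = K" using sum_count_set[of "?f w" "set (?f w)"] l by simp
      finally have "2 * card (set (?f w)) + 1 \<le> K" .
      moreover have "set (?f w) \<subseteq> V" using wB by (fastforce simp: PiE_iff)
      ultimately show ?thesis using l unfolding s_def by auto
    qed
    then show "?f ` ?B \<subseteq> {xs. set xs \<subseteq> V \<and> length xs = K \<and> card (set xs) \<le> s}" "K > 0 \<or> ?B = {}"
      by blast+
  qed
  moreover have "finite {xs. set xs \<subseteq> V \<and> length xs = K \<and> card (set xs) \<le> s}"
    by (rule finite_subset[OF _ finite_lists_length_eq[OF assms(1), of K]]) auto
  ultimately have le: "card ?B \<le> card {xs. set xs \<subseteq> V \<and> length xs = K \<and> card (set xs) \<le> s}"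
    and ne: "K > 0 \<or> ?B = {}"
    by (blast intro: card_inj_on_le)+
  show ?thesis
  proof (cases "K > 0")
    case True
    then show ?thesis
      using le card_lists_few_values[OF assms(1) True, of s] unfolding K_def[symmetric] s_def[symmetric]
      by linarith
  next
    case False
    with ne have "?B = {}" by blast
    then show ?thesis by (simp only: card.empty)
  qed
qed

context wigner_matrix
begin

text \<open>Only two laws occur, one off and one on the diagonal, so one representative of each
  bounds all entries.\<close>

lemma abs_moment_bound:
  obtains m where "\<And>p. 0 \<le> m p" "\<And>p e. e \<in> edges \<Longrightarrow> expectation (\<lambda>\<omega>. (1 + \<bar>Z e \<omega>\<bar>) ^ p) \<le> m p"
proof
  define f where "f p i j = expectation (\<lambda>\<omega>. (1 + \<bar>X i j \<omega>\<bar>) ^ p)" for p i j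
  have distr_eq: "f p i j = (\<integral>y. (1 + \<bar>y\<bar>) ^ p \<partial>distr M borel (X i j))" for p i j
    unfolding f_def by (subst integral_distr) auto
  have pos: "0 \<le> f p i j" for p i j unfolding f_def by (intro integral_nonneg_AE) auto
  show "0 \<le> f p 0 1 + f p 0 0" for p using pos by (simp add: add_nonneg_nonneg)
  show "expectation (\<lambda>\<omega>. (1 + \<bar>Z e \<omega>\<bar>) ^ p) \<le> f p 0 1 + f p 0 0" if "e \<in> edges" for p e
  proof (cases "fst e = snd e")
    case True
    then have "expectation (\<lambda>\<omega>. (1 + \<bar>Z e \<omega>\<bar>) ^ p) = f p 0 0"
      using diag_ident[of "fst e" 0] distr_eq[of p "fst e" "snd e"] distr_eq[of p 0 0]
      by (simp add: f_def Z_def)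
    then show ?thesis using pos[of p 0 1] by simp
  next
    case False
    then have "fst e < snd e" using that by (auto simp: edges_def)
    then have "expectation (\<lambda>\<omega>. (1 + \<bar>Z e \<omega>\<bar>) ^ p) = f p 0 1"
      using offdiag_ident[of "fst e" "snd e" 0 1] distr_eq[of p "fst e" "snd e"] distr_eq[of p 0 1]
      by (simp add: f_def Z_def)
    then show ?thesis using pos[of p 0 0] by simp
  qed
qed


lemma Z_measurable [measurable]: "Z e \<in> borel_measurable M"
  by (simp add: Z_def)

text \<open>An absolute value is not a polynomial in the entries; \<open>2 + x\<^sup>2\<close> is a
  polynomial majorant of \<open>1 + \<bar>x\<bar>\<close>.\<close>

lemma integrable_one_plus_abs_power: "integrable M (\<lambda>\<omega>. (1 + \<bar>Z e \<omega>\<bar>) ^ p)"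
proof (rule Bochner_Integration.integrable_bound)
  show "integrable M (\<lambda>\<omega>. (2 + (Z e \<omega>)\<^sup>2) ^ p)"
    by (rule poly_on_integrable[of "{e}"]) (intro poly_on_power poly_on.add poly_on.const poly_on.var singletonI)
  have "1 + \<bar>x\<bar> \<le> 2 + x\<^sup>2" for x :: real
    using zero_le_power2[of "\<bar>x\<bar> - 1"] unfolding power2_diff by (simp add: power2_eq_square)
  then show "AE \<omega> in M. norm ((1 + \<bar>Z e \<omega>\<bar>) ^ p) \<le> norm ((2 + (Z e \<omega>)\<^sup>2) ^ p)"
    by (auto intro!: power_mono)
qed simp

lemma cycle_edge_product_moment:
  fixes q p :: nat
  assumes m: "\<And>p. 0 \<le> m p" "\<And>p e. e \<in> edges \<Longrightarrow> expectation (\<lambda>\<omega>. (1 + \<bar>Z e \<omega>\<bar>) ^ p) \<le> m p"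
    and "length w \<le> q"
  defines "f \<equiv> \<lambda>\<omega>. (\<Prod>e\<leftarrow>cycle_edges w. 1 + \<bar>Z e \<omega>\<bar>) ^ p"
  shows "integrable M f" "expectation f \<le> 1 + real q * m (q * p)"
proof -
  define c where "c i = cycle_edges w ! i" for i
  have f: "f \<omega> = (\<Prod>i<length w. (1 + \<bar>Z (c i) \<omega>\<bar>) ^ p)" for \<omega>
    by (simp add: f_def prod.list_conv_set_nth length_cycle_edges lessThan_atLeast0 prod_power_distrib c_def)
  have bound: "f \<omega> \<le> 1 + (\<Sum>i<length w. (1 + \<bar>Z (c i) \<omega>\<bar>) ^ (q * p))" for \<omega>
  proof -
    have "f \<omega> \<le> 1 + (\<Sum>i<length w. ((1 + \<bar>Z (c i) \<omega>\<bar>) ^ p) ^ length w)"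
      unfolding f using prod_le_one_plus_sum_power[of "{..<length w}" "\<lambda>i. (1 + \<bar>Z (c i) \<omega>\<bar>) ^ p"] by simp
    also have "\<dots> \<le> 1 + (\<Sum>i<length w. (1 + \<bar>Z (c i) \<omega>\<bar>) ^ (q * p))"
      unfolding power_mult[symmetric] using assms(3)
      by (intro add_left_mono sum_mono power_increasing) (auto simp: mult.commute)
    finally show ?thesis .
  qed
  have int: "integrable M (\<lambda>\<omega>. 1 + (\<Sum>i<length w. (1 + \<bar>Z (c i) \<omega>\<bar>) ^ (q * p)))"
    by (intro Bochner_Integration.integrable_add Bochner_Integration.integrable_sum integrable_one_plus_abs_power) simp
  show intf: "integrable M f"
  proof (rule Bochner_Integration.integrable_bound[OF int])
    show "f \<in> borel_measurable M" unfolding f[abs_def] by measurable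
    have "0 \<le> f \<omega>" for \<omega> unfolding f by (intro prod_nonneg) auto
    then show "AE \<omega> in M. norm (f \<omega>) \<le> norm (1 + (\<Sum>i<length w. (1 + \<bar>Z (c i) \<omega>\<bar>) ^ (q * p)))"
      using bound by (auto intro!: AE_I2 order.trans[OF _ abs_ge_self])
  qed
  have "expectation f \<le> expectation (\<lambda>\<omega>. 1 + (\<Sum>i<length w. (1 + \<bar>Z (c i) \<omega>\<bar>) ^ (q * p)))"
    by (intro integral_mono intf int bound)
  also have "\<dots> = 1 + (\<Sum>i<length w. expectation (\<lambda>\<omega>. (1 + \<bar>Z (c i) \<omega>\<bar>) ^ (q * p)))"
    by (simp add: integrable_one_plus_abs_power prob_space)
  also have "\<dots> \<le> 1 + (\<Sum>i<length w. m (q * p))"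
  proof (intro add_left_mono sum_mono m(2))
    fix i assume "i \<in> {..<length w}"
    then have "c i \<in> set (cycle_edges w)" by (simp add: c_def length_cycle_edges)
    then show "c i \<in> edges" using set_cycle_edges_subset by blast
  qed
  also have "\<dots> \<le> 1 + real q * m (q * p)"
    using assms(3) m(1)[of "q * p"] by (simp add: mult_right_mono)
  finally show "expectation f \<le> 1 + real q * m (q * p)" .
qed

lemma expectation_weight_prod_bounded:
  obtains C where "0 \<le> C" "\<And>R w. finite R \<Longrightarrow> card R \<le> q \<Longrightarrow> (\<And>r. r \<in> R \<Longrightarrow> length (w r) \<le> q) \<Longrightarrow>
    \<bar>expectation (weight_prod R w)\<bar> \<le> C"
proof -
  obtain m where m: "\<And>p. 0 \<le> m p" "\<And>p e. e \<in> edges \<Longrightarrow> expectation (\<lambda>\<omega>. (1 + \<bar>Z e \<omega>\<bar>) ^ p) \<le> m p"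
    using abs_moment_bound by blast
  define P where "P w \<omega> = (\<Prod>e\<leftarrow>cycle_edges w. 1 + \<bar>Z e \<omega>\<bar>)" for w \<omega>
  \<comment> \<open>\<open>c0\<close> bounds the mean that centering subtracts, and
    \<open>mm\<close> the moments for all powers up to \<open>q\<close>. Neither depends on the
    walks, so the final constant does not depend on the vertex set.\<close>
  define c0 where "c0 = 2 * (1 + real q * m q)"
  define mm where "mm = (\<Sum>p\<le>q. m (q * p))"
  define C where "C = (2 + c0) ^ q * (1 + real q * (1 + real q * mm))"
  have c0: "0 \<le> c0" using m(1) by (simp add: c0_def)
  have mm: "m (q * p) \<le> mm" if "p \<le> q" for p
    unfolding mm_def using m(1) that by (intro member_le_sum) auto
  have mm0: "0 \<le> mm" using m(1) unfolding mm_def by (intro sum_nonneg) auto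
  have P1: "1 \<le> P w \<omega>" for w \<omega> unfolding P_def by (rule prod_list_one_plus_ge) simp
  have ww: "\<bar>walk_weight w \<omega>\<bar> \<le> 2 * P w \<omega>" for w \<omega>
    using abs_cycle_weight_le[OF X_sym, of \<omega> w] by (simp add: walk_weight_def P_def Z_def)
  have Pint: "integrable M (\<lambda>\<omega>. P w \<omega> ^ p)" and Pexp: "expectation (\<lambda>\<omega>. P w \<omega> ^ p) \<le> 1 + real q * m (q * p)"
    if "length w \<le> q" for w p
    using cycle_edge_product_moment[of m, OF m that, of p] by (simp_all add: P_def)
  have Ew: "\<bar>expectation (walk_weight w)\<bar> \<le> c0" if "length w \<le> q" for w
  proof -
    have "\<bar>expectation (walk_weight w)\<bar> \<le> expectation (\<lambda>\<omega>. \<bar>walk_weight w \<omega>\<bar>)"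
      by (rule integral_abs_bound)
    also have "\<dots> \<le> expectation (\<lambda>\<omega>. 2 * P w \<omega>)"
      using Pint[OF that, of 1] ww poly_on_integrable[OF poly_on_walk_weight[of w]]
      by (intro integral_mono) auto
    also have "\<dots> \<le> c0" using Pexp[OF that, of 1] by (simp add: c0_def)
    finally show ?thesis .
  qed
  have "\<bar>expectation (weight_prod R w)\<bar> \<le> C"
    if R: "finite R" "card R \<le> q" "\<And>r. r \<in> R \<Longrightarrow> length (w r) \<le> q" for R w
  proof -
    have cw: "\<bar>centered_weight (w r) \<omega>\<bar> \<le> (2 + c0) * P (w r) \<omega>" if "r \<in> R" for r \<omega>
    proof -
      have "\<bar>centered_weight (w r) \<omega>\<bar> \<le> 2 * P (w r) \<omega> + c0 * 1"
        unfolding centered_weight_def using ww[of "w r" \<omega>] Ew[OF R(3)[OF that]] by linarith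
      also have "\<dots> \<le> 2 * P (w r) \<omega> + c0 * P (w r) \<omega>"
        using c0 P1 by (intro add_left_mono mult_left_mono) auto
      finally show ?thesis by (simp add: algebra_simps)
    qed
    have bound: "\<bar>weight_prod R w \<omega>\<bar> \<le> (2 + c0) ^ q * (1 + (\<Sum>r\<in>R. P (w r) \<omega> ^ card R))" for \<omega>
    proof -
      have Pn: "0 \<le> P u \<omega>" for u using P1[of u \<omega>] by linarith
      have "\<bar>weight_prod R w \<omega>\<bar> \<le> (\<Prod>r\<in>R. (2 + c0) * P (w r) \<omega>)"
        unfolding weight_prod_def abs_prod using cw by (intro prod_mono) auto
      also have "\<dots> = (2 + c0) ^ card R * (\<Prod>r\<in>R. P (w r) \<omega>)" by (simp add: prod.distrib)
      also have "\<dots> \<le> (2 + c0) ^ q * (1 + (\<Sum>r\<in>R. P (w r) \<omega> ^ card R))"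
        using c0 R prod_le_one_plus_sum_power[OF R(1), of "\<lambda>r. P (w r) \<omega>"] Pn
        by (intro mult_mono power_increasing prod_nonneg) auto
      finally show ?thesis .
    qed
    have int: "integrable M (\<lambda>\<omega>. (2 + c0) ^ q * (1 + (\<Sum>r\<in>R. P (w r) \<omega> ^ card R)))"
      using Pint R(3) by auto
    have "\<bar>expectation (weight_prod R w)\<bar> \<le> expectation (\<lambda>\<omega>. \<bar>weight_prod R w \<omega>\<bar>)"
      by (rule integral_abs_bound)
    also have "\<dots> \<le> expectation (\<lambda>\<omega>. (2 + c0) ^ q * (1 + (\<Sum>r\<in>R. P (w r) \<omega> ^ card R)))"
      using int bound poly_on_integrable[OF poly_on_weight_prod[of w R]] by (intro integral_mono) auto
    also have "\<dots> = (2 + c0) ^ q * (1 + (\<Sum>r\<in>R. expectation (\<lambda>\<omega>. P (w r) \<omega> ^ card R)))"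
      using Pint R(3) by (simp add: prob_space)
    also have "\<dots> \<le> (2 + c0) ^ q * (1 + (\<Sum>r\<in>R. 1 + real q * mm))"
    proof -
      have "expectation (\<lambda>\<omega>. P (w r) \<omega> ^ card R) \<le> 1 + real q * mm" if "r \<in> R" for r
      proof -
        have "real q * m (q * card R) \<le> real q * mm" using mm[OF R(2)] by (intro mult_left_mono) auto
        then show ?thesis using Pexp[OF R(3)[OF that], of "card R"] by linarith
      qed
      then show ?thesis using c0 by (intro mult_left_mono add_left_mono sum_mono) auto
    qed
    also have "\<dots> \<le> C"
    proof -
      have "real (card R) * (1 + real q * mm) \<le> real q * (1 + real q * mm)"
        using R(2) mm0 by (intro mult_right_mono) auto
      then show ?thesis unfolding C_def using c0 by (intro mult_left_mono) auto
    qed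
    finally show ?thesis .
  qed
  moreover have "0 \<le> C" unfolding C_def using c0 mm0 by (intro mult_nonneg_nonneg) auto
  ultimately show thesis using that by blast
qed

section \<open>Moments of weighted sums over walks\<close>

definition walk_sum :: "nat list set \<Rightarrow> (nat list \<Rightarrow> real) \<Rightarrow> 'w \<Rightarrow> real" where
  "walk_sum L c \<omega> = (\<Sum>w\<in>L. c w * centered_weight w \<omega>)"

text \<open>The part of the variance that comes from simple cycles paired with themselves. It is the
  variance up to the error of \<open>moment_recursion\<close> for \<open>p = 0\<close>.\<close>

definition walk_sum_var :: "nat list set \<Rightarrow> (nat list \<Rightarrow> real) \<Rightarrow> real" where
  "walk_sum_var L c = (\<Sum>u\<in>L. \<Sum>v\<in>L. c u * c v *
     (if distinct u \<and> v \<in> dihedral_class u then weight_var (length u) else 0))"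

lemma expectation_walk_sum_power:
  assumes "finite L" "finite R"
  shows "expectation (\<lambda>\<omega>. walk_sum L c \<omega> ^ card R) =
    (\<Sum>w\<in>PiE R (\<lambda>_. L). (\<Prod>r\<in>R. c (w r)) * expectation (weight_prod R w))"
proof -
  have "walk_sum L c \<omega> ^ card R = (\<Sum>w\<in>PiE R (\<lambda>_. L). (\<Prod>r\<in>R. c (w r)) * weight_prod R w \<omega>)" for \<omega>
  proof -
    have "walk_sum L c \<omega> ^ card R = (\<Prod>r\<in>R. \<Sum>w\<in>L. c w * centered_weight w \<omega>)"
      by (simp add: walk_sum_def)
    also have "\<dots> = (\<Sum>w\<in>PiE R (\<lambda>_. L). \<Prod>r\<in>R. c (w r) * centered_weight (w r) \<omega>)"
      by (rule prod_sum_PiE) (use assms in auto)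
    finally show ?thesis by (simp add: prod.distrib weight_prod_def)
  qed
  moreover have "integrable M (weight_prod R w)" for w
    by (rule poly_on_integrable[OF poly_on_weight_prod])
  ultimately show ?thesis by simp
qed

text \<open>Once the walks \<open>r\<close> and \<open>s\<close> are split off, the other walks
  enter through a factor independent of them, so the sum over tuples becomes a product.\<close>

lemma walk_sum_pair_contribution:
  assumes L: "finite L" and R: "finite R" "r \<in> R" "s \<in> R - {r}"
  shows "(\<Sum>w\<in>PiE R (\<lambda>_. L). (\<Prod>i\<in>R. c (w i)) *
      (if distinct (w r) \<and> w s \<in> dihedral_class (w r)
       then weight_var (length (w r)) * expectation (weight_prod (R - {r, s}) w) else 0)) =
    walk_sum_var L c * expectation (\<lambda>\<omega>. walk_sum L c \<omega> ^ card (R - {r, s}))"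
proof -
  define Q where "Q = R - {r, s}"
  have RQ: "R = insert r (insert s Q)" "r \<notin> insert s Q" "s \<notin> Q" "finite Q" "r \<noteq> s" "r \<notin> Q"
    using R by (auto simp: Q_def)
  define d where "d u v = (if distinct u \<and> v \<in> dihedral_class u then weight_var (length u) else 0)" for u v :: "nat list"
  have "weight_prod Q (w(s := v, r := u)) = weight_prod Q w" for w u v
    unfolding weight_prod_def[abs_def] using RQ by (intro ext prod.cong) auto
  moreover have "(\<Prod>i\<in>Q. c ((w(s := v, r := u)) i)) = (\<Prod>i\<in>Q. c (w i))" for w u v
    using RQ by (intro prod.cong) auto
  ultimately have "(\<Sum>w\<in>PiE R (\<lambda>_. L). (\<Prod>i\<in>R. c (w i)) *
      (if distinct (w r) \<and> w s \<in> dihedral_class (w r)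
       then weight_var (length (w r)) * expectation (weight_prod Q w) else 0)) =
     (\<Sum>u\<in>L. \<Sum>v\<in>L. \<Sum>w\<in>PiE Q (\<lambda>_. L). (c u * c v * d u v) * ((\<Prod>i\<in>Q. c (w i)) * expectation (weight_prod Q w)))"
    unfolding RQ(1) sum_PiE_insert[OF RQ(2)] sum_PiE_insert[OF RQ(3)]
    using RQ by (intro sum.cong refl) (simp add: d_def)
  also have "\<dots> = (\<Sum>u\<in>L. \<Sum>v\<in>L. c u * c v * d u v) * (\<Sum>w\<in>PiE Q (\<lambda>_. L). (\<Prod>i\<in>Q. c (w i)) * expectation (weight_prod Q w))"
    by (simp only: sum_distrib_left[symmetric] sum_distrib_right[symmetric])
  finally show ?thesis
    unfolding Q_def[symmetric] expectation_walk_sum_power[OF L RQ(4), of c] walk_sum_var_def d_def .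
qed

end

text \<open>The number of vertex choices against the normalization: the odd unit in
  \<open>2 * s + 1\<close> is the surplus that makes exceptional tuples vanish in the limit.\<close>

lemma power_div_sqrt_le:
  assumes "n \<ge> (1::real)" "2 * s + 1 \<le> K"
  shows "n ^ s * (1 / sqrt n) ^ K \<le> 1 / sqrt n"
proof -
  have n: "sqrt n \<ge> 1" using assms by simp
  have "n ^ s = sqrt n ^ (2 * s)" using assms(1) by (simp add: power_mult)
  then have "n ^ s * (1 / sqrt n) ^ K = sqrt n ^ (2 * s) / sqrt n ^ K"
    by (simp add: power_divide)
  also have "\<dots> \<le> 1 / sqrt n"
  proof -
    have "sqrt n ^ (2 * s + 1) \<le> sqrt n ^ K" using n assms(2) by (intro power_increasing) auto
    moreover have "sqrt n ^ K > 0" "sqrt n > 0" using n by auto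
    ultimately show ?thesis by (simp add: divide_le_eq pos_le_divide_eq mult.commute)
  qed
  finally show ?thesis .
qed

context wigner_matrix
begin

lemma sum_bad_walks_le:
  fixes V :: "nat set" and c :: "nat list \<Rightarrow> real"
  assumes V: "finite V" "V \<noteq> {}" and L: "L \<subseteq> {w. set w \<subseteq> V \<and> 1 \<le> length w \<and> length w \<le> k}"
    and c: "\<And>w. w \<in> L \<Longrightarrow> \<bar>c w\<bar> \<le> B * (1 / sqrt (card V)) ^ length w"
    and B: "0 \<le> B" and q: "q > 0"
  shows "(\<Sum>w | w \<in> PiE {..<q} (\<lambda>_. L) \<and> (\<forall>x. visits {..<q} w x \<noteq> 1) \<and> (\<exists>x. visits {..<q} w x \<notin> {0, 2}).
      \<Prod>r<q. \<bar>c (w r)\<bar>) \<le> real k ^ q * B ^ q * real (q * k) ^ (q * k) * (1 / sqrt (card V))"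
proof -
  define n where "n = real (card V)"
  have n: "1 \<le> n" using V by (simp add: n_def Suc_le_eq card_gt_0_iff)
  define bad where "bad = {w. w \<in> PiE {..<q} (\<lambda>_. L) \<and> (\<forall>x. visits {..<q} w x \<noteq> 1) \<and> (\<exists>x. visits {..<q} w x \<notin> {0, 2})}"
  define T where "T = PiE {..<q} (\<lambda>_. {1..k})"
  define g where "g w = restrict (\<lambda>r. length (w r)) {..<q}" for w :: "nat \<Rightarrow> nat list"
  have "finite {w. set w \<subseteq> V \<and> length w \<le> k}" by (rule finite_lists_length_le[OF V(1)])
  then have finL: "finite L" using L by (auto intro: finite_subset[OF L] finite_subset[of _ "{w. set w \<subseteq> V \<and> length w \<le> k}"])
  have fin: "finite bad" unfolding bad_def using finite_PiE[of "{..<q}" "\<lambda>_. L"] finL by simp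
  have finT: "finite T" unfolding T_def by (intro finite_PiE) auto
  have gT: "g ` bad \<subseteq> T"
  proof
    fix l assume "l \<in> g ` bad"
    then obtain w where w: "w \<in> bad" "l = g w" by blast
    then have "w r \<in> L" if "r < q" for r using that by (auto simp: bad_def)
    then show "l \<in> T" using L w unfolding T_def g_def by (auto simp: PiE_iff)
  qed
  \<comment> \<open>Grouped by lengths, because the bounds on the coefficients and on the number of
    tuples depend on nothing else.\<close>
  have "(\<Sum>w\<in>bad. \<Prod>r<q. \<bar>c (w r)\<bar>) = (\<Sum>l\<in>T. \<Sum>w\<in>{w \<in> bad. g w = l}. \<Prod>r<q. \<bar>c (w r)\<bar>)"
    by (rule sum.group[OF fin finT gT, symmetric])
  also have "\<dots> \<le> (\<Sum>l\<in>T. B ^ q * real (q * k) ^ (q * k) * (1 / sqrt n))"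
  proof (rule sum_mono)
    fix l assume l: "l \<in> T"
    define K where "K = sum l {..<q}"
    define s where "s = (K - 1) div 2"
    have lr: "1 \<le> l r \<and> l r \<le> k" if "r < q" for r using l that by (auto simp: T_def PiE_iff)
    have K1: "1 \<le> K"
    proof -
      have "l 0 \<le> K" unfolding K_def using q by (intro member_le_sum) auto
      then show ?thesis using lr[OF q] by linarith
    qed
    have Kqk: "K \<le> q * k" unfolding K_def using sum_mono[of "{..<q}" l "\<lambda>_. k"] lr by auto
    have s: "2 * s + 1 \<le> K" using K1 unfolding s_def by linarith
    have "{w \<in> bad. g w = l} \<subseteq> {w \<in> PiE {..<q} (\<lambda>_. {u. set u \<subseteq> V}). (\<forall>r<q. length (w r) = l r) \<and>
      (\<forall>x. visits {..<q} w x \<noteq> 1) \<and> (\<exists>x. visits {..<q} w x \<notin> {0, 2})}" (is "?A \<subseteq> ?B")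
    proof
      fix w assume w: "w \<in> ?A"
      have "length (w r) = l r" if "r < q" for r
      proof -
        have "l r = g w r" using w by simp
        then show ?thesis using that by (simp add: g_def)
      qed
      then show "w \<in> ?B" using w L unfolding bad_def by (auto simp: PiE_iff)
    qed
    moreover have "finite ?B"
    proof (rule finite_subset)
      show "?B \<subseteq> PiE {..<q} (\<lambda>r. {u. set u \<subseteq> V \<and> length u = l r})"
      proof
        fix w assume "w \<in> ?B"
        then show "w \<in> PiE {..<q} (\<lambda>r. {u. set u \<subseteq> V \<and> length u = l r})"
          unfolding PiE_iff by simp
      qed
    qed (intro finite_PiE finite_lists_length_eq V finite_lessThan)
    ultimately have cA: "card ?A \<le> card V ^ s * s ^ K"
      using card_mono[of ?B ?A] card_bad_walks[OF V, of q l] unfolding K_def[symmetric] s_def[symmetric]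
      by linarith
    have "(\<Sum>w\<in>?A. \<Prod>r<q. \<bar>c (w r)\<bar>) \<le> (\<Sum>w\<in>?A. B ^ q * (1 / sqrt n) ^ K)"
    proof (rule sum_mono)
      fix w assume w: "w \<in> ?A"
      have "(\<Prod>r<q. \<bar>c (w r)\<bar>) \<le> (\<Prod>r<q. B * (1 / sqrt n) ^ l r)"
      proof (rule prod_mono)
        fix r assume r: "r \<in> {..<q}"
        have "l r = g w r" using w by simp
        then have "length (w r) = l r" using r by (simp add: g_def)
        moreover have "w r \<in> L" using w r by (auto simp: bad_def)
        ultimately show "0 \<le> \<bar>c (w r)\<bar> \<and> \<bar>c (w r)\<bar> \<le> B * (1 / sqrt n) ^ l r"
          using c[of "w r"] by (simp add: n_def)
      qed
      also have "\<dots> = B ^ q * (1 / sqrt n) ^ K"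
        by (simp add: prod.distrib K_def power_sum)
      finally show "(\<Prod>r<q. \<bar>c (w r)\<bar>) \<le> B ^ q * (1 / sqrt n) ^ K" .
    qed
    also have "\<dots> = real (card ?A) * (B ^ q * (1 / sqrt n) ^ K)" by simp
    also have "\<dots> \<le> (n ^ s * real (q * k) ^ (q * k)) * (B ^ q * (1 / sqrt n) ^ K)"
    proof (rule mult_right_mono)
      have "s ^ K \<le> (q * k) ^ K" using s Kqk by (intro power_mono) auto
      also have "\<dots> \<le> (q * k) ^ (q * k)"
        by (rule power_increasing[OF Kqk]) (use Kqk K1 in linarith)
      finally have "card V ^ s * s ^ K \<le> card V ^ s * (q * k) ^ (q * k)" by (rule mult_left_mono) simp
      with cA have "card ?A \<le> card V ^ s * (q * k) ^ (q * k)" by linarith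
      then have "real (card ?A) \<le> real (card V ^ s * (q * k) ^ (q * k))" by (rule of_nat_mono)
      then show "real (card ?A) \<le> n ^ s * real (q * k) ^ (q * k)" by (simp add: n_def)
      show "0 \<le> B ^ q * (1 / sqrt n) ^ K" using B n by simp
    qed
    also have "\<dots> = (B ^ q * real (q * k) ^ (q * k)) * (n ^ s * (1 / sqrt n) ^ K)" by simp
    also have "\<dots> \<le> (B ^ q * real (q * k) ^ (q * k)) * (1 / sqrt n)"
      using power_div_sqrt_le[OF n s] B by (intro mult_left_mono) auto
    finally show "(\<Sum>w\<in>?A. \<Prod>r<q. \<bar>c (w r)\<bar>) \<le> B ^ q * real (q * k) ^ (q * k) * (1 / sqrt n)" .
  qed
  also have "\<dots> = real (card T) * (B ^ q * real (q * k) ^ (q * k) * (1 / sqrt n))" by simp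
  also have "card T = k ^ q" unfolding T_def by (simp add: card_PiE)
  finally show ?thesis unfolding bad_def n_def by (simp add: mult.assoc)
qed

lemma moment_recursion:
  assumes "0 \<le> B"
  obtains C where "0 \<le> C"
    "\<And>V L c. finite V \<Longrightarrow> V \<noteq> {} \<Longrightarrow> L \<subseteq> {w. set w \<subseteq> V \<and> 1 \<le> length w \<and> length w \<le> k} \<Longrightarrow>
      (\<And>w. w \<in> L \<Longrightarrow> \<bar>c w\<bar> \<le> B * (1 / sqrt (card V)) ^ length w) \<Longrightarrow>
      \<bar>expectation (\<lambda>\<omega>. walk_sum L c \<omega> ^ (p + 2)) -
        real (p + 1) * walk_sum_var L c * expectation (\<lambda>\<omega>. walk_sum L c \<omega> ^ p)\<bar> \<le> C / sqrt (card V)"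
proof -
  define q where "q = p + 2"
  define R where "R = {..<q}"
  \<comment> \<open>The bound has a single parameter for the number of walks and for their lengths,
    hence the maximum.\<close>
  obtain C1 where C1: "0 \<le> C1" "\<And>R w. finite R \<Longrightarrow> card R \<le> max q k \<Longrightarrow> (\<And>r. r \<in> R \<Longrightarrow> length (w r) \<le> max q k) \<Longrightarrow>
    \<bar>expectation (weight_prod R w)\<bar> \<le> C1"
    using expectation_weight_prod_bounded[of "max q k"] by blast
  define vm where "vm = \<bar>d2\<bar> + \<bar>m4 - 1\<bar> + 1"
  have vm: "\<bar>weight_var l\<bar> \<le> vm" for l by (auto simp: weight_var_def vm_def)
  \<comment> \<open>Bounds the error \<open>e\<close> below: one expectation and at most
    \<open>q\<close> partner terms.\<close>
  define C2 where "C2 = C1 + real q * (vm * C1)"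
  have vm0: "0 \<le> vm" by (simp add: vm_def)
  have C2: "0 \<le> C2" using C1(1) vm0 by (simp add: C2_def)
  define C where "C = C2 * (real k ^ q * B ^ q * real (q * k) ^ (q * k))"
  have "\<bar>expectation (\<lambda>\<omega>. walk_sum L c \<omega> ^ (p + 2)) -
        real (p + 1) * walk_sum_var L c * expectation (\<lambda>\<omega>. walk_sum L c \<omega> ^ p)\<bar> \<le> C / sqrt (card V)"
    if V: "finite V" "V \<noteq> {}" and L: "L \<subseteq> {w. set w \<subseteq> V \<and> 1 \<le> length w \<and> length w \<le> k}"
      and c: "\<And>w. w \<in> L \<Longrightarrow> \<bar>c w\<bar> \<le> B * (1 / sqrt (card V)) ^ length w" for V L c
  proof -
    have finL: "finite L"
      by (rule finite_subset[OF _ finite_lists_length_le[OF V(1), of k]]) (use L in auto)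
    have finR: "finite R" and cR: "card R = q" and R0: "0 \<in> R" by (auto simp: R_def q_def)
    have finP: "finite (PiE R (\<lambda>_. L))" using finL finR by (intro finite_PiE) auto
    define d where "d s w = (if distinct (w 0) \<and> w s \<in> dihedral_class (w 0)
       then weight_var (length (w 0)) * expectation (weight_prod (R - {0, s}) w) else 0)" for s and w :: "nat \<Rightarrow> nat list"
    \<comment> \<open>The defect of the pairing identity. It vanishes outside \<open>bad\<close> by
      \<open>expectation_weight_prod_recursion\<close>.\<close>
    define e where "e w = expectation (weight_prod R w) - (\<Sum>s\<in>R - {0}. d s w)" for w
    define bad where "bad = {w. w \<in> PiE R (\<lambda>_. L) \<and> (\<forall>x. visits R w x \<noteq> 1) \<and> (\<exists>x. visits R w x \<notin> {0, 2})}"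
    have "(\<Sum>s\<in>R - {0}. \<Sum>w\<in>PiE R (\<lambda>_. L). (\<Prod>i\<in>R. c (w i)) * d s w) =
        (\<Sum>s\<in>R - {0}. walk_sum_var L c * expectation (\<lambda>\<omega>. walk_sum L c \<omega> ^ p))"
    proof (rule sum.cong[OF refl])
      fix s assume s: "s \<in> R - {0}"
      \<comment> \<open>Walk 0 has \<open>p + 1\<close> possible partners, and each choice leaves
        \<open>p\<close> walks; this is the origin of the factor \<open>p + 1\<close>.\<close>
      have "card (R - {0, s}) = p" using s R0 finR cR by (simp add: q_def card_Diff_subset)
      then show "(\<Sum>w\<in>PiE R (\<lambda>_. L). (\<Prod>i\<in>R. c (w i)) * d s w) =
          walk_sum_var L c * expectation (\<lambda>\<omega>. walk_sum L c \<omega> ^ p)"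
        using walk_sum_pair_contribution[OF finL finR R0 s, of c] unfolding d_def by simp
    qed
    also have "\<dots> = real (p + 1) * walk_sum_var L c * expectation (\<lambda>\<omega>. walk_sum L c \<omega> ^ p)"
      using R0 finR cR by (simp add: q_def)
    finally have "expectation (\<lambda>\<omega>. walk_sum L c \<omega> ^ (p + 2)) -
        real (p + 1) * walk_sum_var L c * expectation (\<lambda>\<omega>. walk_sum L c \<omega> ^ p) =
        (\<Sum>w\<in>PiE R (\<lambda>_. L). (\<Prod>r\<in>R. c (w r)) * expectation (weight_prod R w)) -
        (\<Sum>s\<in>R - {0}. \<Sum>w\<in>PiE R (\<lambda>_. L). (\<Prod>i\<in>R. c (w i)) * d s w)"
      using expectation_walk_sum_power[OF finL finR, of c] unfolding cR by (simp add: q_def)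
    also have "\<dots> = (\<Sum>w\<in>PiE R (\<lambda>_. L). (\<Prod>r\<in>R. c (w r)) * e w)"
      by (subst sum.swap) (simp add: e_def sum_subtractf right_diff_distrib sum_distrib_left)
    also have "\<dots> = (\<Sum>w\<in>bad. (\<Prod>r\<in>R. c (w r)) * e w)"
    proof (rule sum.mono_neutral_right[OF finP])
      show "bad \<subseteq> PiE R (\<lambda>_. L)" by (auto simp: bad_def)
      show "\<forall>w\<in>PiE R (\<lambda>_. L) - bad. (\<Prod>r\<in>R. c (w r)) * e w = 0"
      proof
        fix w assume w: "w \<in> PiE R (\<lambda>_. L) - bad"
        have "w 0 \<noteq> []" using w R0 L by (auto simp: PiE_iff)
        moreover have "(\<exists>x. visits R w x = 1) \<or> (\<forall>x. visits R w x \<in> {0, 2})"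
          using w unfolding bad_def by blast
        ultimately have "e w = 0"
          using expectation_weight_prod_recursion[OF finR R0] unfolding e_def d_def by simp
        then show "(\<Prod>r\<in>R. c (w r)) * e w = 0" by simp
      qed
    qed
    also have "\<bar>\<dots>\<bar> \<le> (\<Sum>w\<in>bad. (\<Prod>r<q. \<bar>c (w r)\<bar>) * C2)"
    proof (rule order.trans[OF sum_abs sum_mono])
      fix w assume w: "w \<in> bad"
      have wl: "length (w r) \<le> max q k" if "r \<in> R" for r
      proof -
        have "w r \<in> L" using w that by (auto simp: bad_def)
        then show ?thesis using L by auto
      qed
      have "\<bar>d s w\<bar> \<le> vm * C1" if "s \<in> R - {0}" for s
      proof -
        have "card (R - {0, s}) \<le> max q k" using cR card_mono[OF finR, of "R - {0, s}"] by auto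
        then have "\<bar>expectation (weight_prod (R - {0, s}) w)\<bar> \<le> C1"
          using C1(2)[of "R - {0, s}" w] wl finR by auto
        then have "\<bar>weight_var (length (w 0)) * expectation (weight_prod (R - {0, s}) w)\<bar> \<le> vm * C1"
          unfolding abs_mult using vm vm0 by (intro mult_mono) auto
        then show ?thesis using vm0 C1(1) by (auto simp: d_def)
      qed
      then have "\<bar>\<Sum>s\<in>R - {0}. d s w\<bar> \<le> (\<Sum>s\<in>R - {0}. vm * C1)"
        by (intro order.trans[OF sum_abs sum_mono])
      also have "\<dots> \<le> real q * (vm * C1)"
        using R0 finR cR vm0 C1(1) by (simp add: mult_right_mono)
      finally have "\<bar>\<Sum>s\<in>R - {0}. d s w\<bar> \<le> real q * (vm * C1)" .
      moreover have "\<bar>expectation (weight_prod R w)\<bar> \<le> C1"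
        using C1(2)[OF finR, of w] wl cR by auto
      ultimately have "\<bar>e w\<bar> \<le> C2" unfolding e_def C2_def by linarith
      then show "\<bar>(\<Prod>r\<in>R. c (w r)) * e w\<bar> \<le> (\<Prod>r<q. \<bar>c (w r)\<bar>) * C2"
        unfolding abs_mult abs_prod R_def by (intro mult_left_mono prod_nonneg) auto
    qed
    also have "\<dots> = C2 * (\<Sum>w\<in>bad. \<Prod>r<q. \<bar>c (w r)\<bar>)"
      by (simp add: sum_distrib_left mult.commute)
    also have "\<dots> \<le> C2 * (real k ^ q * B ^ q * real (q * k) ^ (q * k) * (1 / sqrt (card V)))"
      using sum_bad_walks_le[OF V L c assms, of q] C2
      by (intro mult_left_mono) (auto simp: bad_def R_def q_def)
    finally show ?thesis by (simp add: C_def)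
  qed
  moreover have "0 \<le> C" using C2 assms by (simp add: C_def)
  ultimately show thesis using that by blast
qed

lemma expectation_walk_sum: "expectation (walk_sum L c) = 0"
proof -
  have "expectation (walk_sum L c) = (\<Sum>w\<in>L. expectation (\<lambda>\<omega>. c w * centered_weight w \<omega>))"
    unfolding walk_sum_def[abs_def]
    by (rule Bochner_Integration.integral_sum)
      (auto intro!: poly_on_integrable[OF poly_on_centered_weight])
  then show ?thesis by (simp add: expectation_centered_weight)
qed

end

subsection \<open>From moments to weak convergence in the plane\<close>

fun gaussian_moment :: "real \<Rightarrow> nat \<Rightarrow> real" where
  "gaussian_moment v 0 = 1"
| "gaussian_moment v (Suc 0) = 0"
| "gaussian_moment v (Suc (Suc p)) = real (Suc p) * v * gaussian_moment v p"

lemma gaussian_moment_even: "gaussian_moment v (2 * j) = fact (2 * j) * (v / 2) ^ j / fact j"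
proof (induction j)
  case (Suc j)
  have "gaussian_moment v (2 * Suc j) = real (2 * j + 1) * v * gaussian_moment v (2 * j)" by simp
  also have "\<dots> = fact (2 * Suc j) * (v / 2) ^ Suc j / fact (Suc j)"
  proof -
    have e1: "fact (2 * Suc j) = 2 * (real j + 1) * ((2 * real j + 1) * fact (2 * j))"
      by (simp add: algebra_simps)
    have e2: "fact (Suc j) = (real j + 1) * fact j" by simp
    have *: "(2 * x + 1) * v * (F * P / f) = 2 * (x + 1) * ((2 * x + 1) * F) * (v / 2 * P) / ((x + 1) * f)"
      if "x + 1 \<noteq> 0" "f \<noteq> 0" for x F P f :: real
      using that by (simp add: divide_simps) (simp add: algebra_simps)?
    have "real (2 * j + 1) = 2 * real j + 1" by simp
    then show ?thesis unfolding Suc e1 e2 power_Suc by (simp only:) (rule *; simp)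
  qed
  finally show ?case .
qed simp

lemma gaussian_moment_odd: "gaussian_moment v (Suc (2 * j)) = 0"
  by (induction j) auto

lemma tendsto_gaussian_moment:
  fixes m :: "nat \<Rightarrow> nat \<Rightarrow> real"
  assumes "\<And>N. m N 0 = 1" "\<And>N. m N 1 = 0"
    and rec: "\<And>p. (\<lambda>N. m N (p + 2) - real (p + 1) * s N * m N p) \<longlonglongrightarrow> 0"
    and s: "s \<longlonglongrightarrow> v"
  shows "(\<lambda>N. m N p) \<longlonglongrightarrow> gaussian_moment v p"
proof (induction p rule: induct_nat_012)
  case (ge2 p)
  have "(\<lambda>N. (m N (p + 2) - real (p + 1) * s N * m N p) + real (p + 1) * s N * m N p)
      \<longlonglongrightarrow> 0 + real (p + 1) * v * gaussian_moment v p"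
    by (intro tendsto_intros rec s) (rule ge2)
  then show ?case by simp
qed (use assms in auto)

text \<open>Truncating at an even order makes the Taylor remainder an ordinary moment, which the
  moment recursion controls.\<close>

lemma iexp_expectation_approx:
  fixes W :: "'a \<Rightarrow> real"
  assumes "prob_space M" and [measurable]: "W \<in> borel_measurable M"
    and int: "\<And>p. integrable M (\<lambda>x. W x ^ p)"
  shows "cmod ((\<integral>x. iexp (W x) \<partial>M) - (\<Sum>k\<le>2 * q. \<i> ^ k / fact k * of_real (\<integral>x. W x ^ k \<partial>M)))
    \<le> 2 * (\<integral>x. W x ^ (2 * q) \<partial>M) / fact (2 * q)"
proof -
  interpret prob_space M by fact
  have intk: "integrable M (\<lambda>x. \<i> ^ k / fact k * of_real (W x ^ k) :: complex)" for k
    using int[of k] by (intro integrable_mult_right integrable_of_real)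
  have inte: "integrable M (\<lambda>x. iexp (W x))"
    by (rule integrable_const_bound[of _ 1]) auto
  have "(\<integral>x. iexp (W x) \<partial>M) - (\<Sum>k\<le>2 * q. \<i> ^ k / fact k * of_real (\<integral>x. W x ^ k \<partial>M)) =
      (\<integral>x. iexp (W x) - (\<Sum>k\<le>2 * q. \<i> ^ k / fact k * of_real (W x ^ k)) \<partial>M)"
    using intk inte by (simp add: Bochner_Integration.integral_diff Bochner_Integration.integral_sum
        flip: integral_complex_of_real)
  also have "cmod \<dots> \<le> (\<integral>x. 2 * W x ^ (2 * q) / fact (2 * q) \<partial>M)"
  proof (rule order.trans[OF integral_norm_bound integral_mono])
    show "integrable M (\<lambda>x. 2 * W x ^ (2 * q) / fact (2 * q))" using int by simp
    show "integrable M (\<lambda>x. cmod (iexp (W x) - (\<Sum>k\<le>2 * q. \<i> ^ k / fact k * of_real (W x ^ k))))"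
      using intk inte by (intro integrable_norm Bochner_Integration.integrable_diff Bochner_Integration.integrable_sum)
    fix x
    have "(\<Sum>k\<le>2 * q. (\<i> * of_real (W x)) ^ k / fact k) = (\<Sum>k\<le>2 * q. \<i> ^ k / fact k * of_real (W x ^ k))"
      by (intro sum.cong) (auto simp: power_mult_distrib)
    then show "cmod (iexp (W x) - (\<Sum>k\<le>2 * q. \<i> ^ k / fact k * of_real (W x ^ k)))
        \<le> 2 * W x ^ (2 * q) / fact (2 * q)"
      using iexp_approx2[of "W x" "2 * q"] by (simp add: power_even_abs)
  qed
  finally show ?thesis using int by simp
qed

lemma gaussian_moment_series:
  "(\<Sum>k\<le>2 * q. \<i> ^ k / fact k * of_real (gaussian_moment v k)) = of_real (\<Sum>j\<le>q. (- v / 2) ^ j / fact j)"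
proof (induction q)
  case (Suc q)
  have eq: "2 * Suc q = Suc (Suc (2 * q))" by simp
  have "(\<Sum>k\<le>2 * Suc q. \<i> ^ k / fact k * of_real (gaussian_moment v k)) =
      \<i> ^ (2 * Suc q) / fact (2 * Suc q) * of_real (gaussian_moment v (2 * Suc q)) +
      of_real (\<Sum>j\<le>q. (- v / 2) ^ j / fact j)"
    unfolding eq sum.atMost_Suc Suc gaussian_moment_odd by simp
  also have "\<i> ^ (2 * Suc q) / fact (2 * Suc q) * of_real (gaussian_moment v (2 * Suc q)) =
      (of_real ((- v / 2) ^ Suc q / fact (Suc q)) :: complex)"
  proof -
    have 1: "\<i> ^ (2 * Suc q) = (of_real ((- 1) ^ Suc q) :: complex)" unfolding power_mult by simp
    have 2: "(- v / 2) ^ Suc q = (- 1) ^ Suc q * (v / 2) ^ Suc q"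
      using power_minus[of "v / 2" "Suc q"] by (simp only: minus_divide_left)
    have aux: "A / F * (F * P / f) = A * P / f" if "F \<noteq> 0" for A F P f :: complex
      using that by simp
    show ?thesis unfolding gaussian_moment_even 1 2 of_real_mult of_real_divide of_real_fact
      by (rule aux) (rule fact_nonzero)
  qed
  finally show ?case by (simp add: add.commute)
qed simp

text \<open>The even Gaussian moments divided by their factorials tend to 0, so one fixed Taylor
  order is accurate for all large \<open>N\<close>. The argument 1 is enough, since a scaling can be
  put into the variable.\<close>

lemma iexp_expectation_tendsto:
  fixes W :: "nat \<Rightarrow> 'a \<Rightarrow> real"
  assumes M: "prob_space M" and W: "\<And>N. W N \<in> borel_measurable M"
    and int: "\<And>N p. integrable M (\<lambda>x. W N x ^ p)"
    and mom: "\<And>p. (\<lambda>N. \<integral>x. W N x ^ p \<partial>M) \<longlonglongrightarrow> gaussian_moment v p"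
  shows "(\<lambda>N. \<integral>x. iexp (W N x) \<partial>M) \<longlonglongrightarrow> of_real (exp (- v / 2))"
proof (rule tendstoI)
  fix e :: real assume e: "0 < e"
  \<comment> \<open>\<open>a q\<close> is the limit of the remainder bound at order
    \<open>2 * q\<close>, and \<open>S q\<close> that of the Taylor sum.\<close>
  define a where "a q = 2 * gaussian_moment v (2 * q) / fact (2 * q)" for q
  define S where "S q = (\<Sum>j\<le>q. (- v / 2) ^ j / fact j)" for q
  have a_eq: "a q = 2 * (inverse (fact q) * (v / 2) ^ q)" for q
  proof -
    have *: "2 * (F * P / f) / F = 2 * (inverse f * P)" if "F \<noteq> 0" for F P f :: real
      using that by (simp add: divide_inverse)
    show ?thesis unfolding a_def gaussian_moment_even by (rule *) simp
  qed
  have "(\<lambda>q. 2 * (inverse (fact q) * (v / 2) ^ q)) \<longlonglongrightarrow> 2 * 0"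
    by (intro tendsto_mult tendsto_const summable_LIMSEQ_zero summable_exp)
  then have a0: "a \<longlonglongrightarrow> 0" unfolding a_eq[abs_def] by simp
  have "(\<lambda>n. x ^ n / fact n) sums exp x" for x :: real
    using exp_converges[of x] by (simp add: divide_inverse mult.commute)
  then have S0: "S \<longlonglongrightarrow> exp (- v / 2)" unfolding sums_def_le S_def[abs_def] .
  have "\<forall>\<^sub>F q in sequentially. a q < e / 4 \<and> dist (S q) (exp (- v / 2)) < e / 4"
    using order_tendstoD(2)[OF a0, of "e / 4"] tendstoD[OF S0, of "e / 4"] e by (intro eventually_conj) auto
  \<comment> \<open>The order is fixed before \<open>N\<close>, so that only finitely many moments
    have to be close to their limits.\<close>
  then obtain q where q: "a q < e / 4" "dist (S q) (exp (- v / 2)) < e / 4"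
    unfolding eventually_sequentially by blast
  define A where "A N = (\<Sum>k\<le>2 * q. \<i> ^ k / fact k * of_real (\<integral>x. W N x ^ k \<partial>M))" for N
  define B where "B N = 2 * (\<integral>x. W N x ^ (2 * q) \<partial>M) / fact (2 * q)" for N
  have "A \<longlonglongrightarrow> of_real (S q)"
    unfolding A_def[abs_def] S_def gaussian_moment_series[symmetric]
    by (intro tendsto_intros mom)
  moreover have "B \<longlonglongrightarrow> a q"
    unfolding B_def[abs_def] a_def by (intro tendsto_intros mom) auto
  ultimately have "\<forall>\<^sub>F N in sequentially. dist (A N) (of_real (S q)) < e / 4 \<and> B N < e / 4"
    using e q by (intro eventually_conj tendstoD order_tendstoD(2)) auto
  then show "\<forall>\<^sub>F N in sequentially. dist (\<integral>x. iexp (W N x) \<partial>M) (of_real (exp (- v / 2))) < e"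
  proof eventually_elim
    case (elim N)
    have "dist (\<integral>x. iexp (W N x) \<partial>M) (A N) \<le> B N"
      using iexp_expectation_approx[OF M W int, of N q] by (simp add: dist_norm A_def B_def)
    moreover have "dist (of_real (S q)) (of_real (exp (- v / 2)) :: complex) < e / 4"
      using q(2) by (simp add: dist_of_real)
    ultimately show ?case
      using elim dist_triangle[of "\<integral>x. iexp (W N x) \<partial>M" "of_real (exp (- v / 2))" "A N"]
        dist_triangle[of "A N" "of_real (exp (- v / 2))" "of_real (S q)"] e by linarith
  qed
qed

section \<open>Trigonometric polynomials and characteristic functions in the plane\<close>

inductive trig_poly :: "(real \<times> real \<Rightarrow> complex) \<Rightarrow> bool" where
  base: "trig_poly (\<lambda>z. c * iexp (u * fst z + v * snd z))"
| add: "trig_poly f \<Longrightarrow> trig_poly g \<Longrightarrow> trig_poly (\<lambda>z. f z + g z)"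

text \<open>Closure under products brings in all polynomials in the sines of the coordinates, as
  produced by the Stone-Weierstrass theorem.\<close>

lemma trig_poly_mult: "trig_poly f \<Longrightarrow> trig_poly g \<Longrightarrow> trig_poly (\<lambda>z. f z * g z)"
proof (induction arbitrary: g rule: trig_poly.induct)
  case (base c u v)
  from base show ?case
  proof (induction rule: trig_poly.induct)
    case (base c' u' v')
    have "c * iexp (u * fst z + v * snd z) * (c' * iexp (u' * fst z + v' * snd z)) =
        c * c' * iexp ((u + u') * fst z + (v + v') * snd z)" for z :: "real \<times> real"
      by (simp add: exp_add[symmetric] algebra_simps)
    then show ?case using trig_poly.base[of "c * c'" "u + u'" "v + v'"] by (simp only:)
  next
    case (add f g)
    then show ?case using trig_poly.add by (fastforce simp: distrib_left)
  qed
next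
  case (add f1 f2)
  then show ?case using trig_poly.add[of "\<lambda>z. f1 z * g z" "\<lambda>z. f2 z * g z"] by (simp add: distrib_right)
qed

lemma trig_poly_const: "trig_poly (\<lambda>z. c)"
  using trig_poly.base[of c 0 0] by simp

lemma trig_poly_continuous_bounded:
  "trig_poly f \<Longrightarrow> continuous_on UNIV f \<and> (\<exists>B. \<forall>z. cmod (f z) \<le> B)"
proof (induction rule: trig_poly.induct)
  case (base c u v)
  have "cmod (c * iexp (u * fst z + v * snd z)) \<le> cmod c" for z :: "real \<times> real"
    by (simp only: norm_mult norm_exp_i_times mult_1_right)
  then show ?case by (auto intro!: continuous_intros exI[of _ "cmod c"])
next
  case (add f g)
  then obtain A B where "\<And>z. cmod (f z) \<le> A" "\<And>z. cmod (g z) \<le> B" by blast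
  then have "cmod (f z + g z) \<le> A + B" for z
    by (meson add_mono norm_triangle_le)
  with add show ?case by (auto intro!: continuous_intros)
qed

lemma integrable_continuous_bounded:
  fixes f :: "'a::topological_space \<Rightarrow> 'b::{banach, second_countable_topology}"
  assumes "prob_space \<mu>" "sets \<mu> = sets borel" "continuous_on UNIV f" "\<And>z. norm (f z) \<le> B"
  shows "integrable \<mu> f"
proof -
  interpret prob_space \<mu> by fact
  have "f \<in> borel_measurable \<mu>"
    using borel_measurable_continuous_onI[OF assms(3)] assms(2) by (simp cong: measurable_cong_sets)
  then show ?thesis by (intro integrable_const_bound[of _ B]) (use assms in auto)
qed

lemma trig_poly_sin:
  "trig_poly (\<lambda>z. of_real (sin (fst z / L)))" "trig_poly (\<lambda>z. of_real (sin (snd z / L)))"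
proof -
  have sin: "of_real (sin t) = - \<i> / 2 * iexp t + \<i> / 2 * iexp (- t)" for t :: real
    unfolding sin_of_real[symmetric] sin_exp_eq by (simp add: field_simps)
  show "trig_poly (\<lambda>z. of_real (sin (fst z / L)))"
    using trig_poly.add[OF trig_poly.base[of "- \<i> / 2" "1 / L" 0] trig_poly.base[of "\<i> / 2" "- 1 / L" 0]]
    unfolding sin by simp
  show "trig_poly (\<lambda>z. of_real (sin (snd z / L)))"
    using trig_poly.add[OF trig_poly.base[of "- \<i> / 2" 0 "1 / L"] trig_poly.base[of "\<i> / 2" 0 "- 1 / L"]]
    unfolding sin by simp
qed

lemma trig_poly_real_polynomial_function:
  assumes "real_polynomial_function p"
  shows "trig_poly (\<lambda>z. of_real (p (sin (fst z / L), sin (snd z / L))))"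
  using assms
proof (induction rule: real_polynomial_function.induct)
  case (linear f)
  interpret bounded_linear f by fact
  have "f (a, b) = f (1, 0) * a + f (0, 1) * b" for a b
  proof -
    have "(a, b) = a *\<^sub>R (1, 0) + b *\<^sub>R (0, 1)" by simp
    then have "f (a, b) = a *\<^sub>R f (1, 0) + b *\<^sub>R f (0, 1)" by (simp only: add scaleR)
    then show ?thesis by simp
  qed
  then have eq: "of_real (f (sin (fst z / L), sin (snd z / L))) =
      of_real (f (1, 0)) * of_real (sin (fst z / L)) + of_real (f (0, 1)) * of_real (sin (snd z / L))"
    for z :: "real \<times> real" by (metis of_real_add of_real_mult)
  show ?case unfolding eq
    by (intro trig_poly.add trig_poly_mult trig_poly_const trig_poly_sin)
qed (auto intro: trig_poly_const trig_poly.add trig_poly_mult)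

text \<open>A bounded continuous function is approximated by a trigonometric polynomial on a large square:
  the periodic function \<open>L arcsin (sin (x / L))\<close> agrees with \<open>x\<close> there and is a continuous function
  of \<open>sin (x / L)\<close>. Outside of the square the bounded second moments take over.\<close>

lemma trig_poly_approx:
  fixes g :: "real \<times> real \<Rightarrow> real"
  assumes g: "continuous_on UNIV g" "\<And>z. \<bar>g z\<bar> \<le> B" and "0 < L" "0 < d" "d \<le> 1"
  obtains f where "trig_poly (\<lambda>z. of_real (f z))" "continuous_on UNIV f" "\<And>z. \<bar>f z\<bar> \<le> B + 1"
    "\<And>z. \<bar>g z - f z\<bar> \<le> d + (2 * B + 1) / L\<^sup>2 * ((fst z)\<^sup>2 + (snd z)\<^sup>2)"
proof -
  define S where "S = {-1..1::real} \<times> {-1..1::real}"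
  define h where "h w = g (L * arcsin (fst w), L * arcsin (snd w))" for w
  have "continuous_on S h"
    unfolding h_def S_def
    by (intro continuous_on_compose2[OF g(1)] continuous_intros) auto
  moreover have "compact S" unfolding S_def by (intro compact_Times) auto
  ultimately obtain p where p: "real_polynomial_function p" "\<And>w. w \<in> S \<Longrightarrow> \<bar>h w - p w\<bar> < d"
    using Stone_Weierstrass_real_polynomial_function[of S h d] assms by blast
  define s where "s z = (sin (fst z / L), sin (snd z / L))" for z :: "real \<times> real"
  have sS: "s z \<in> S" for z by (simp add: s_def S_def)
  have B0: "0 \<le> B" using g(2)[of 0] by linarith
  show thesis
  proof
    show "trig_poly (\<lambda>z. of_real (p (s z)))"
      unfolding s_def by (rule trig_poly_real_polynomial_function[OF p(1)])
    show "continuous_on UNIV (\<lambda>z. p (s z))"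
    proof (rule continuous_on_compose2[of UNIV p])
      show "continuous_on UNIV p"
        using p(1) by (simp add: continuous_on_polymonial_function real_polynomial_function_eq)
      show "continuous_on UNIV s"
        unfolding s_def by (intro continuous_intros) (use assms(3) in auto)
    qed simp
    show ps: "\<bar>p (s z)\<bar> \<le> B + 1" for z
      using p(2)[OF sS, of z] g(2)[of "(L * arcsin (fst (s z)), L * arcsin (snd (s z)))"] assms(5)
      by (simp add: h_def)
    fix z
    show "\<bar>g z - p (s z)\<bar> \<le> d + (2 * B + 1) / L\<^sup>2 * ((fst z)\<^sup>2 + (snd z)\<^sup>2)"
    proof (cases "\<bar>fst z\<bar> \<le> L \<and> \<bar>snd z\<bar> \<le> L")
      case True
      have pi2: "1 \<le> pi / 2" using pi_ge_two by simp
      have "arcsin (sin (x / L)) = x / L" if "\<bar>x\<bar> \<le> L" for x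
      proof (rule arcsin_sin)
        have "\<bar>x / L\<bar> \<le> 1" using that assms(3) by (simp add: divide_le_eq)
        then show "- (pi / 2) \<le> x / L" "x / L \<le> pi / 2" using pi2 by linarith+
      qed
      then have "h (s z) = g z" using True assms(3) by (simp add: h_def s_def)
      then have "\<bar>g z - p (s z)\<bar> \<le> d" using p(2)[OF sS, of z] by simp
      moreover have "0 \<le> (2 * B + 1) / L\<^sup>2 * ((fst z)\<^sup>2 + (snd z)\<^sup>2)" using B0 by simp
      ultimately show ?thesis by linarith
    next
      \<comment> \<open>Here the quadratic term is at least \<open>2 * B + 1\<close>, the trivial
        bound on the difference.\<close>
      case False
      have "L\<^sup>2 \<le> (fst z)\<^sup>2 + (snd z)\<^sup>2"
      proof -
        have "L\<^sup>2 \<le> (fst z)\<^sup>2 \<or> L\<^sup>2 \<le> (snd z)\<^sup>2"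
          using False assms(3) by (metis abs_le_square_iff abs_of_pos linear)
        then show ?thesis using zero_le_power2[of "fst z"] zero_le_power2[of "snd z"] by linarith
      qed
      then have "(2 * B + 1) * 1 \<le> (2 * B + 1) * (((fst z)\<^sup>2 + (snd z)\<^sup>2) / L\<^sup>2)"
        using B0 assms(3) by (intro mult_left_mono) (auto simp: le_divide_eq)
      moreover have "\<bar>g z - p (s z)\<bar> \<le> 2 * B + 1" using ps[of z] g(2)[of z] by linarith
      ultimately show ?thesis using assms(4) by simp
    qed
  qed
qed

text \<open>The second moment bound takes the role of tightness: it makes the error of the
  trigonometric approximation small under all laws at once, \<open>G\<close> included. For the
  approximating function itself, convergence is the assumption on characteristic functions.\<close>

lemma weakly_converges_if_char_tendsto:
  fixes \<mu> :: "nat \<Rightarrow> (real \<times> real) measure"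
  assumes \<mu>: "\<And>N. prob_space (\<mu> N)" "\<And>N. sets (\<mu> N) = sets borel"
    and G: "prob_space G" "sets G = sets borel"
    and mom: "\<And>N. integrable (\<mu> N) (\<lambda>z. (fst z)\<^sup>2 + (snd z)\<^sup>2)" "integrable G (\<lambda>z. (fst z)\<^sup>2 + (snd z)\<^sup>2)"
    and bound: "\<And>N. (\<integral>z. (fst z)\<^sup>2 + (snd z)\<^sup>2 \<partial>\<mu> N) \<le> K"
    and char: "\<And>u v. (\<lambda>N. \<integral>z. iexp (u * fst z + v * snd z) \<partial>\<mu> N) \<longlonglongrightarrow> (\<integral>z. iexp (u * fst z + v * snd z) \<partial>G)"
  shows "weakly_converges \<mu> G"
  unfolding weakly_converges_def
proof (intro allI impI)
  fix g :: "real \<times> real \<Rightarrow> real"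
  assume g: "continuous_on UNIV g" "bounded (range g)"
  obtain B where B: "\<And>z. \<bar>g z\<bar> \<le> B" using g(2) by (auto simp: bounded_iff)
  have B0: "0 \<le> B" using B[of 0] by linarith
  have trig: "(\<lambda>N. \<integral>z. f z \<partial>\<mu> N) \<longlonglongrightarrow> (\<integral>z. f z \<partial>G)" if "trig_poly f" for f
    using that
  proof (induction rule: trig_poly.induct)
    case (base c u v)
    then show ?case using tendsto_mult_left[OF char, of c u v] by simp
  next
    case (add f1 f2)
    have int: "integrable \<nu> f" if "trig_poly f" "prob_space \<nu>" "sets \<nu> = sets borel" for f and \<nu> :: "(real \<times> real) measure"
      using trig_poly_continuous_bounded[OF that(1)] integrable_continuous_bounded[OF that(2,3)] by blast
    show ?case
      using tendsto_add[OF add.IH] int[OF add.hyps(1)] int[OF add.hyps(2)] \<mu> G by simp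
  qed
  \<comment> \<open>Covers the limit law as well; being at least 1, it keeps \<open>L\<close>
    positive.\<close>
  define K' where "K' = max 1 (max K (\<integral>z. (fst z)\<^sup>2 + (snd z)\<^sup>2 \<partial>G))"
  show "(\<lambda>N. \<integral>z. g z \<partial>\<mu> N) \<longlonglongrightarrow> (\<integral>z. g z \<partial>G)"
  proof (rule tendstoI)
    fix e :: real assume e: "0 < e"
    define d where "d = min 1 (e / 6)"
    have d: "0 < d" "d \<le> 1" "d \<le> e / 6" using e by (auto simp: d_def)
    \<comment> \<open>Solves \<open>(2 * B + 1) / L\<^sup>2 * K' = e / 6\<close>, so that together
      with \<open>d\<close> the approximation error is at most \<open>e / 3\<close>.\<close>
    define L where "L = sqrt ((2 * B + 1) * K' * 6 / e)"
    have K': "1 \<le> K'" by (simp add: K'_def)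
    have pos: "0 < (2 * B + 1) * K' * 6 / e" using B0 K' e by simp
    have L: "0 < L" "L\<^sup>2 = (2 * B + 1) * K' * 6 / e" using pos by (auto simp: L_def)
    have LK: "(2 * B + 1) / L\<^sup>2 * K' = e / 6" 
    proof -
      have *: "c / (c * K' * 6 / e) * K' = e / 6" if "c > 0" for c
        using that K' e by (simp add: field_simps)
      show ?thesis unfolding L(2) by (rule *) (use B0 in simp)
    qed
    obtain f where f: "trig_poly (\<lambda>z. of_real (f z))" "continuous_on UNIV f" "\<And>z. \<bar>f z\<bar> \<le> B + 1"
      "\<And>z. \<bar>g z - f z\<bar> \<le> d + (2 * B + 1) / L\<^sup>2 * ((fst z)\<^sup>2 + (snd z)\<^sup>2)"
      using trig_poly_approx[OF g(1) B L(1) d(1,2)] by blast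
    have close: "\<bar>(\<integral>z. g z \<partial>\<nu>) - (\<integral>z. f z \<partial>\<nu>)\<bar> \<le> e / 3"
      if \<nu>: "prob_space \<nu>" "sets \<nu> = sets borel" "integrable \<nu> (\<lambda>z. (fst z)\<^sup>2 + (snd z)\<^sup>2)"
        "(\<integral>z. (fst z)\<^sup>2 + (snd z)\<^sup>2 \<partial>\<nu>) \<le> K'" for \<nu>
    proof -
      interpret \<nu>: prob_space \<nu> by fact
      have ig: "integrable \<nu> g" using integrable_continuous_bounded[OF \<nu>(1,2) g(1), of B] B by simp
      have if': "integrable \<nu> f" using integrable_continuous_bounded[OF \<nu>(1,2) f(2), of "B + 1"] f(3) by simp
      have "\<bar>(\<integral>z. g z \<partial>\<nu>) - (\<integral>z. f z \<partial>\<nu>)\<bar> = \<bar>\<integral>z. g z - f z \<partial>\<nu>\<bar>" using ig if' by simp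
      also have "\<dots> \<le> (\<integral>z. \<bar>g z - f z\<bar> \<partial>\<nu>)" by (rule integral_abs_bound)
      also have "\<dots> \<le> (\<integral>z. d + (2 * B + 1) / L\<^sup>2 * ((fst z)\<^sup>2 + (snd z)\<^sup>2) \<partial>\<nu>)"
        using ig if' \<nu>(3) f(4) by (intro integral_mono) auto
      also have "\<dots> = d + (2 * B + 1) / L\<^sup>2 * (\<integral>z. (fst z)\<^sup>2 + (snd z)\<^sup>2 \<partial>\<nu>)"
        by (subst Bochner_Integration.integral_add)
          (use \<nu>(3) in \<open>simp_all add: \<nu>.prob_space del: Bochner_Integration.integral_add\<close>)
      also have "\<dots> \<le> d + (2 * B + 1) / L\<^sup>2 * K'"
        using \<nu>(4) B0 by (intro add_left_mono mult_left_mono) auto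
      also have "\<dots> \<le> e / 3" unfolding LK using d(3) by simp
      finally show ?thesis .
    qed
    have "(\<lambda>N. \<integral>z. complex_of_real (f z) \<partial>\<mu> N) \<longlonglongrightarrow> (\<integral>z. complex_of_real (f z) \<partial>G)"
      by (rule trig[OF f(1)])
    then have "(\<lambda>N. \<integral>z. f z \<partial>\<mu> N) \<longlonglongrightarrow> (\<integral>z. f z \<partial>G)"
      unfolding integral_complex_of_real tendsto_of_real_iff .
    then have "\<forall>\<^sub>F N in sequentially. dist (\<integral>z. f z \<partial>\<mu> N) (\<integral>z. f z \<partial>G) < e / 3"
      using e by (intro tendstoD) auto
    then show "\<forall>\<^sub>F N in sequentially. dist (\<integral>z. g z \<partial>\<mu> N) (\<integral>z. g z \<partial>G) < e"
    proof eventually_elim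
      case (elim N)
      have "\<bar>(\<integral>z. g z \<partial>\<mu> N) - (\<integral>z. f z \<partial>\<mu> N)\<bar> \<le> e / 3"
        using \<mu> mom(1) bound[of N] by (intro close) (auto simp: K'_def)
      moreover have "\<bar>(\<integral>z. g z \<partial>G) - (\<integral>z. f z \<partial>G)\<bar> \<le> e / 3"
        using G mom(2) by (intro close) (auto simp: K'_def)
      ultimately show ?case using elim unfolding dist_real_def by linarith
    qed
  qed
qed

subsection \<open>Gaussian laws in the plane\<close>

lemma integral_pair_mult:
  fixes f :: "'a \<Rightarrow> 'c::{real_normed_field, banach, second_countable_topology}" and g :: "'b \<Rightarrow> 'c"
  assumes "sigma_finite_measure M1" "sigma_finite_measure M2" and f: "integrable M1 f" and g: "integrable M2 g"
  shows "integrable (M1 \<Otimes>\<^sub>M M2) (\<lambda>z. f (fst z) * g (snd z))"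
    "(\<integral>z. f (fst z) * g (snd z) \<partial>(M1 \<Otimes>\<^sub>M M2)) = (\<integral>x. f x \<partial>M1) * (\<integral>y. g y \<partial>M2)"
proof -
  interpret pair_sigma_finite M1 M2 using assms by (intro pair_sigma_finite.intro)
  note [measurable] = borel_measurable_integrable[OF f] borel_measurable_integrable[OF g]
  show int: "integrable (M1 \<Otimes>\<^sub>M M2) (\<lambda>z. f (fst z) * g (snd z))"
  proof (rule Fubini_integrable)
    show "integrable M1 (\<lambda>x. \<integral>y. norm (f (fst (x, y)) * g (snd (x, y))) \<partial>M2)"
      using f by (simp add: norm_mult)
    show "AE x in M1. integrable M2 (\<lambda>y. f (fst (x, y)) * g (snd (x, y)))" using g by simp
  qed measurable
  show "(\<integral>z. f (fst z) * g (snd z) \<partial>(M1 \<Otimes>\<^sub>M M2)) = (\<integral>x. f x \<partial>M1) * (\<integral>y. g y \<partial>M2)"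
    unfolding integral_fst'[OF int, symmetric] by simp
qed

text \<open>The coefficients form a triangular square root of the covariance matrix: variances
  \<open>\<alpha>\<^sup>2\<close> and \<open>\<beta>\<^sup>2 + \<gamma>\<^sup>2\<close>, covariance
  \<open>\<alpha> * \<beta>\<close>. Zero coefficients give the degenerate laws.\<close>

definition gaussian_pair :: "real \<Rightarrow> real \<Rightarrow> real \<Rightarrow> (real \<times> real) measure" where
  "gaussian_pair \<alpha> \<beta> \<gamma> = distr (std_normal_distribution \<Otimes>\<^sub>M std_normal_distribution) borel
     (\<lambda>z. (\<alpha> * fst z, \<beta> * fst z + \<gamma> * snd z))"

context
begin

interpretation std: prob_space std_normal_distribution
  by (rule real_distribution.axioms(1)[OF real_dist_normal_dist])

lemma sigma_finite_std: "sigma_finite_measure std_normal_distribution"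
  by unfold_locales

lemma std_moments:
  "integrable std_normal_distribution (\<lambda>x. x)" "(\<integral>x. x \<partial>std_normal_distribution) = 0"
  "integrable std_normal_distribution (\<lambda>x. x\<^sup>2)" "(\<integral>x. x\<^sup>2 \<partial>std_normal_distribution) = 1"
  using integrable_std_normal_distribution_moment[of 1] integral_std_normal_distribution_moment_odd[of 1]
    std_normal_distribution_even_moments[of 1]
  by simp_all

lemma gaussian_pair_measurable [measurable]:
  "(\<lambda>z. (\<alpha> * fst z, \<beta> * fst z + \<gamma> * snd z)) \<in> std_normal_distribution \<Otimes>\<^sub>M std_normal_distribution \<rightarrow>\<^sub>M borel"
proof -
  have "(\<lambda>z. (\<alpha> * fst z, \<beta> * fst z + \<gamma> * snd z)) \<in> std_normal_distribution \<Otimes>\<^sub>M std_normal_distribution \<rightarrow>\<^sub>M borel \<Otimes>\<^sub>M (borel :: real measure)"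
    by measurable
  then show ?thesis by (simp add: borel_prod)
qed

lemma prob_space_gaussian_pair: "prob_space (gaussian_pair \<alpha> \<beta> \<gamma>)"
proof -
  interpret pair_prob_space std_normal_distribution std_normal_distribution ..
  show ?thesis unfolding gaussian_pair_def by (rule prob_space_distr) measurable
qed

lemma sets_gaussian_pair: "sets (gaussian_pair \<alpha> \<beta> \<gamma>) = sets borel"
  by (simp add: gaussian_pair_def)

lemma char_gaussian_pair:
  "(\<integral>z. iexp (u * fst z + v * snd z) \<partial>gaussian_pair \<alpha> \<beta> \<gamma>) =
    of_real (exp (- ((u * \<alpha> + v * \<beta>)\<^sup>2 + (v * \<gamma>)\<^sup>2) / 2))"
proof -
  have "(\<integral>z. iexp (u * fst z + v * snd z) \<partial>gaussian_pair \<alpha> \<beta> \<gamma>) =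
     (\<integral>z. iexp ((u * \<alpha> + v * \<beta>) * fst z) * iexp (v * \<gamma> * snd z) \<partial>(std_normal_distribution \<Otimes>\<^sub>M std_normal_distribution))"
    unfolding gaussian_pair_def
  proof (subst integral_distr)
    show "(\<lambda>z. iexp (u * fst z + v * snd z)) \<in> borel_measurable borel"
      by (intro borel_measurable_continuous_onI continuous_intros)
  qed (auto simp: exp_add[symmetric] algebra_simps)
  also have "\<dots> = char std_normal_distribution (u * \<alpha> + v * \<beta>) * char std_normal_distribution (v * \<gamma>)"
    unfolding char_def
    by (rule integral_pair_mult[OF sigma_finite_std sigma_finite_std])
      (auto intro!: std.integrable_const_bound[of _ 1])
  also have "\<dots> = of_real (exp (- ((u * \<alpha> + v * \<beta>)\<^sup>2 + (v * \<gamma>)\<^sup>2) / 2))"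
    unfolding char_std_normal_distribution of_real_mult[symmetric] exp_add[symmetric]
    by (simp add: add_divide_distrib)
  finally show ?thesis .
qed

lemma gaussian_pair_moments:
  "integrable (gaussian_pair \<alpha> \<beta> \<gamma>) (\<lambda>z. (fst z)\<^sup>2 + (snd z)\<^sup>2)"
  "coord_covariance (gaussian_pair \<alpha> \<beta> \<gamma>) = \<alpha> * \<beta>"
proof -
  let ?S = "std_normal_distribution" and ?P = "std_normal_distribution \<Otimes>\<^sub>M std_normal_distribution"
  interpret P: pair_prob_space ?S ?S ..
  note pm = integral_pair_mult[where ?'c = real, OF sigma_finite_std sigma_finite_std]
  have i1: "integrable ?P (\<lambda>z. fst z)" and e1: "(\<integral>z. fst z \<partial>?P) = 0"
    using pm[of "\<lambda>x. x" "\<lambda>_. 1"] std_moments by simp_all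
  have i2: "integrable ?P (\<lambda>z. snd z)" and e2: "(\<integral>z. snd z \<partial>?P) = 0"
    using pm[of "\<lambda>_. 1" "\<lambda>x. x"] std_moments by simp_all
  have i11: "integrable ?P (\<lambda>z. (fst z)\<^sup>2)" and e11: "(\<integral>z. (fst z)\<^sup>2 \<partial>?P) = 1"
    using pm[of "\<lambda>x. x\<^sup>2" "\<lambda>_. 1"] std_moments std.prob_space by simp_all
  have i22: "integrable ?P (\<lambda>z. (snd z)\<^sup>2)"
    using pm[of "\<lambda>_. 1" "\<lambda>x. x\<^sup>2"] std_moments by simp_all
  have i12: "integrable ?P (\<lambda>z. fst z * snd z)" and e12: "(\<integral>z. fst z * snd z \<partial>?P) = 0"
    using pm[of "\<lambda>x. x" "\<lambda>x. x"] std_moments by simp_all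
  have meas: "f \<in> borel_measurable borel" if "continuous_on UNIV f" for f :: "real \<times> real \<Rightarrow> real"
    using that by (rule borel_measurable_continuous_onI)
  have m1: "(\<integral>z. fst z \<partial>gaussian_pair \<alpha> \<beta> \<gamma>) = 0"
    unfolding gaussian_pair_def
    by (subst integral_distr) (auto intro!: meas continuous_intros simp: e1)
  have m2: "(\<integral>z. snd z \<partial>gaussian_pair \<alpha> \<beta> \<gamma>) = 0"
    unfolding gaussian_pair_def
    by (subst integral_distr) (auto intro!: meas continuous_intros simp: e1 e2 i1 i2)
  have "(\<integral>z. fst z * snd z \<partial>gaussian_pair \<alpha> \<beta> \<gamma>) =
      (\<integral>z. \<alpha> * \<beta> * (fst z)\<^sup>2 + \<alpha> * \<gamma> * (fst z * snd z) \<partial>?P)"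
    unfolding gaussian_pair_def
    by (subst integral_distr) (auto intro!: meas continuous_intros simp: algebra_simps power2_eq_square)
  also have "\<dots> = \<alpha> * \<beta>" using i11 i12 e11 e12 by simp
  finally show "coord_covariance (gaussian_pair \<alpha> \<beta> \<gamma>) = \<alpha> * \<beta>"
    by (simp add: coord_covariance_def m1 m2)
  have "integrable ?P (\<lambda>z. (\<alpha>\<^sup>2 + \<beta>\<^sup>2) * (fst z)\<^sup>2 + 2 * \<beta> * \<gamma> * (fst z * snd z) + \<gamma>\<^sup>2 * (snd z)\<^sup>2)"
    using i11 i22 i12 by simp
  moreover have "(\<alpha>\<^sup>2 + \<beta>\<^sup>2) * x\<^sup>2 + 2 * \<beta> * \<gamma> * (x * y) + \<gamma>\<^sup>2 * y\<^sup>2 = (\<alpha> * x)\<^sup>2 + (\<beta> * x + \<gamma> * y)\<^sup>2" for x y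
    by (simp add: power2_eq_square algebra_simps)
  ultimately have "integrable ?P (\<lambda>z. (\<alpha> * fst z)\<^sup>2 + (\<beta> * fst z + \<gamma> * snd z)\<^sup>2)" by simp
  then show "integrable (gaussian_pair \<alpha> \<beta> \<gamma>) (\<lambda>z. (fst z)\<^sup>2 + (snd z)\<^sup>2)"
    unfolding gaussian_pair_def
    by (subst integrable_distr_eq) (auto intro!: meas continuous_intros)
qed

text \<open>A normal density exists only for \<open>s > 0\<close>. For \<open>s = 0\<close> the
  characteristic function is constant, as for the point mass at 0.\<close>

lemma gaussian_1d_if_char:
  assumes "real_distribution \<mu>" "\<And>t. char \<mu> t = of_real (exp (- s * t\<^sup>2 / 2))" "s \<ge> 0"
  shows "gaussian_1d \<mu>"
proof (cases "s = 0")
  case True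
  have "real_distribution (return borel (0::real))"
    by (auto simp: real_distribution_def real_distribution_axioms_def intro: prob_space_return)
  moreover have "char (return borel 0) = char \<mu>"
    using assms(2) True by (auto simp: char_def integral_return)
  ultimately have "\<mu> = return borel 0" using Levy_uniqueness[OF assms(1)] by simp
  then show ?thesis unfolding gaussian_1d_def by blast
next
  case False
  define r where "r = sqrt s"
  have r: "r > 0" "r\<^sup>2 = s" using False assms(3) by (auto simp: r_def)
  have "distributed std_normal_distribution lborel (\<lambda>x. x) std_normal_density"
    by (auto simp: distributed_def distr_id2)
  then have "distributed std_normal_distribution lborel (\<lambda>x. 0 + r * x) (normal_density (0 + r * 0) (\<bar>r\<bar> * 1))"
    by (rule std.normal_density_affine) (use r in auto)
  then have d: "distr std_normal_distribution lborel (\<lambda>x. r * x) = density lborel (normal_density 0 r)"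
    using r by (simp add: distributed_def)
  have "distr std_normal_distribution borel (\<lambda>x. r * x) = density lborel (normal_density 0 r)"
    unfolding d[symmetric] by (rule distr_cong) auto
  moreover have "real_distribution (distr std_normal_distribution borel (\<lambda>x. r * x))"
    by (rule std.real_distribution_distr) simp
  moreover have "char (distr std_normal_distribution borel (\<lambda>x. r * x)) t = char \<mu> t" for t
  proof -
    have "char (distr std_normal_distribution borel (\<lambda>x. r * x)) t = char std_normal_distribution (t * r)"
      unfolding char_def by (subst integral_distr) (auto simp: mult.assoc)
    also have "\<dots> = char \<mu> t"
      unfolding assms(2) char_std_normal_distribution by (simp add: power_mult_distrib r(2) mult.commute)
    finally show ?thesis .
  qed
  ultimately have "\<mu> = density lborel (normal_density 0 r)"
    using Levy_uniqueness[OF assms(1)] by (metis ext)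
  then show ?thesis unfolding gaussian_1d_def using r(1) by blast
qed

lemma gaussian_2d_gaussian_pair: "gaussian_2d (gaussian_pair \<alpha> \<beta> \<gamma>)"
  unfolding gaussian_2d_def
proof (intro conjI allI)
  fix u v :: real
  interpret G: prob_space "gaussian_pair \<alpha> \<beta> \<gamma>" by (rule prob_space_gaussian_pair)
  have meas: "(\<lambda>(x, y). u * x + v * y) \<in> borel_measurable (gaussian_pair \<alpha> \<beta> \<gamma>)"
    unfolding measurable_cong_sets[OF sets_gaussian_pair refl]
    by (intro borel_measurable_continuous_onI) (auto intro!: continuous_intros simp: case_prod_unfold)
  show "gaussian_1d (distr (gaussian_pair \<alpha> \<beta> \<gamma>) borel (\<lambda>(x, y). u * x + v * y))"
  proof (rule gaussian_1d_if_char)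
    show "real_distribution (distr (gaussian_pair \<alpha> \<beta> \<gamma>) borel (\<lambda>(x, y). u * x + v * y))"
      by (rule G.real_distribution_distr[OF meas])
    fix t
    have "char (distr (gaussian_pair \<alpha> \<beta> \<gamma>) borel (\<lambda>(x, y). u * x + v * y)) t =
        (\<integral>z. iexp ((t * u) * fst z + (t * v) * snd z) \<partial>gaussian_pair \<alpha> \<beta> \<gamma>)"
      unfolding char_def using meas
      by (subst integral_distr) (auto simp: case_prod_unfold algebra_simps)
    also have "\<dots> = of_real (exp (- ((u * \<alpha> + v * \<beta>)\<^sup>2 + (v * \<gamma>)\<^sup>2) * t\<^sup>2 / 2))"
      unfolding char_gaussian_pair by (simp add: power2_eq_square algebra_simps)
    finally show "char (distr (gaussian_pair \<alpha> \<beta> \<gamma>) borel (\<lambda>(x, y). u * x + v * y)) t =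
        of_real (exp (- ((u * \<alpha> + v * \<beta>)\<^sup>2 + (v * \<gamma>)\<^sup>2) * t\<^sup>2 / 2))" .
  qed simp
qed (simp_all add: prob_space_gaussian_pair sets_gaussian_pair)

end

subsection \<open>Chebyshev statistics as sums over closed walks\<close>

text \<open>The polynomial splits over the complex numbers. Self-adjointness gives
  \<open>a * q = cnj a * q\<close> for an eigenvector of squared norm \<open>q \<noteq> 0\<close>,
  so all roots are real. The splitting over the reals is what a real Schur form requires.\<close>

lemma real_symmetric_char_poly_splits:
  fixes A :: "real mat"
  assumes A: "A \<in> carrier_mat n n" and sym: "\<And>i j. i < n \<Longrightarrow> j < n \<Longrightarrow> A $$ (i, j) = A $$ (j, i)"
  obtains es where "char_poly A = (\<Prod>e\<leftarrow>es. [:- e, 1:])"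
proof -
  interpret h: inj_idom_hom "complex_of_real" by unfold_locales auto
  interpret hp: map_poly_inj_idom_hom complex_of_real ..
  define C where "C = map_mat complex_of_real A"
  have C: "C \<in> carrier_mat n n" using A by (simp add: C_def)
  obtain as where as: "char_poly C = (\<Prod>a\<leftarrow>as. [:- a, 1:])" using char_poly_factorized[OF C] by blast
  have real: "a \<in> \<real>" if "a \<in> set as" for a
  proof -
    have "poly (char_poly C) a = 0"
      unfolding as using that by (auto simp: poly_prod_list prod_list_zero_iff)
    then have "eigenvalue C a" using eigenvalue_root_char_poly[OF C] by simp
    then obtain v where v: "v \<in> carrier_vec n" "v \<noteq> 0\<^sub>v n" "C *\<^sub>v v = a \<cdot>\<^sub>v v"
      using C unfolding eigenvalue_def eigenvector_def by auto
    define q where "q = v \<bullet>c v"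
    have q: "q \<noteq> 0" using conjugate_square_eq_0_vec[OF v(1)] v(2) by (simp add: q_def)
    have "(C *\<^sub>v v) \<bullet>c v = v \<bullet>c (C *\<^sub>v v)"
    proof -
      have entry: "(C *\<^sub>v v) $ i = (\<Sum>j<n. of_real (A $$ (i, j)) * v $ j)" if "i < n" for i
        using that A v(1) by (simp add: C_def scalar_prod_def lessThan_atLeast0)
      have "(C *\<^sub>v v) \<bullet>c v = (\<Sum>i<n. \<Sum>j<n. of_real (A $$ (i, j)) * v $ j * cnj (v $ i))"
        using v(1) C by (simp add: scalar_prod_def entry sum_distrib_right lessThan_atLeast0[symmetric] conjugate_complex_def
            del: index_mult_mat_vec)
      also have "\<dots> = (\<Sum>j<n. \<Sum>i<n. of_real (A $$ (j, i)) * v $ j * cnj (v $ i))"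
        using sym by (subst sum.swap) (intro sum.cong refl, simp)
      also have "\<dots> = v \<bullet>c (C *\<^sub>v v)"
        using v(1) C by (simp add: scalar_prod_def entry sum_distrib_left lessThan_atLeast0[symmetric] conjugate_complex_def ac_simps
            del: index_mult_mat_vec)
      finally show ?thesis .
    qed
    moreover have "(a \<cdot>\<^sub>v v) \<bullet>c v = a * q" using v(1) by (simp add: q_def)
    moreover have "v \<bullet>c (a \<cdot>\<^sub>v v) = cnj a * q"
      using v(1) by (simp add: q_def conjugate_smult_vec conjugate_complex_def)
    ultimately have "a = cnj a" using v(3) q by simp
    then show ?thesis by (metis Reals_cnj_iff)
  qed
  have "map complex_of_real (map Re as) = as"
    using real by (auto intro!: map_idI simp: o_def)
  moreover have "map_poly complex_of_real (\<Prod>e\<leftarrow>es. [:- e, 1:]) = (\<Prod>a\<leftarrow>map complex_of_real es. [:- a, 1:])" for es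
  proof (induction es)
    case (Cons a es)
    have "map_poly complex_of_real [:- a, 1:] = [:- of_real a, 1:]" by simp
    with Cons show ?case by (simp only: list.map prod_list.Cons hp.hom_mult)
  qed simp
  ultimately have "map_poly complex_of_real (\<Prod>e\<leftarrow>map Re as. [:- e, 1:]) = (\<Prod>a\<leftarrow>as. [:- a, 1:])"
    by (simp only:)
  also have "\<dots> = map_poly complex_of_real (char_poly A)"
    unfolding as[symmetric] C_def by (rule of_real_hom.char_poly_hom[OF A])
  finally have "char_poly A = (\<Prod>e\<leftarrow>map Re as. [:- e, 1:])" by simp
  then show thesis by (rule that)
qed

lemma proots_prod_linear_factors: "proots (\<Prod>a\<leftarrow>xs. [:- a, 1:]) = mset xs"
  for xs :: "'a::idom list"
proof (induction xs)
  case (Cons a xs)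
  have "(\<Prod>a\<leftarrow>xs. [:- a, 1:]) \<noteq> 0" by (auto simp: prod_list_zero_iff)
  then have "proots ([:- a, 1:] * (\<Prod>a\<leftarrow>xs. [:- a, 1:])) = {#a#} + mset xs"
    using Cons by (subst proots_mult) auto
  then show ?case by simp
qed simp

lemma sum_diag_mult_commute:
  fixes A B :: "'a::comm_semiring_0 mat"
  assumes "A \<in> carrier_mat n n" "B \<in> carrier_mat n n"
  shows "(\<Sum>i<n. (A * B) $$ (i, i)) = (\<Sum>i<n. (B * A) $$ (i, i))"
proof -
  have "(\<Sum>i<n. (A * B) $$ (i, i)) = (\<Sum>i<n. \<Sum>j<n. A $$ (i, j) * B $$ (j, i))"
    using assms by (simp add: scalar_prod_def lessThan_atLeast0)
  also have "\<dots> = (\<Sum>j<n. \<Sum>i<n. B $$ (j, i) * A $$ (i, j))"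
    by (subst sum.swap) (simp add: mult.commute)
  also have "\<dots> = (\<Sum>i<n. (B * A) $$ (i, i))"
    using assms by (simp add: scalar_prod_def lessThan_atLeast0)
  finally show ?thesis .
qed

text \<open>Pass to a similar triangular matrix: its diagonal lists the eigenvalues, the diagonal of
  its power lists their powers, and the trace is invariant under similarity.\<close>

lemma eigenvalue_sum_power:
  fixes A :: "real mat"
  assumes A: "A \<in> carrier_mat n n" and sym: "\<And>i j. i < n \<Longrightarrow> j < n \<Longrightarrow> A $$ (i, j) = A $$ (j, i)"
  shows "(\<Sum>x\<in>#proots (char_poly A). x ^ m) = (\<Sum>i<n. (A ^\<^sub>m m) $$ (i, i))"
proof -
  obtain es where es: "char_poly A = (\<Prod>e\<leftarrow>es. [:- e, 1:])"
    using real_symmetric_char_poly_splits[OF A sym] by blast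
  obtain B where B: "B \<in> carrier_mat n n" "upper_triangular B" "similar_mat A B"
    using schur_decomposition_exists[OF A es] by blast
  have "char_poly A = (\<Prod>a\<leftarrow>diag_mat B. [:- a, 1:])"
    using char_poly_similar[OF B(3)] char_poly_upper_triangular[OF B(1,2)] by simp
  then have "proots (char_poly A) = mset (diag_mat B)"
    by (simp only: proots_prod_linear_factors)
  then have "(\<Sum>x\<in>#proots (char_poly A). x ^ m) = (\<Sum>i<n. B $$ (i, i) ^ m)"
    using B(1) by (simp add: diag_mat_def sum_mset_sum_list o_def interv_sum_list_conv_sum_set_nat lessThan_atLeast0
        flip: mset_map)
  also have "\<dots> = (\<Sum>i<n. (B ^\<^sub>m m) $$ (i, i))"
  proof -
    \<comment> \<open>The zeros below the diagonal are part of the induction, as they reduce each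
      diagonal entry of the product to one term.\<close>
    have "(\<forall>i<n. (B ^\<^sub>m m) $$ (i, i) = B $$ (i, i) ^ m) \<and> (\<forall>i<n. \<forall>j<i. (B ^\<^sub>m m) $$ (i, j) = 0)"
    proof (induction m)
      case 0
      then show ?case using B(1) by auto
    next
      case (Suc m)
      have Bm: "B ^\<^sub>m m \<in> carrier_mat n n" using B(1) by simp
      have mult: "(B ^\<^sub>m Suc m) $$ (i, j) = (\<Sum>k<n. (B ^\<^sub>m m) $$ (i, k) * B $$ (k, j))" if "i < n" "j < n" for i j
        using that B(1) Bm by (simp add: scalar_prod_def lessThan_atLeast0)
      have up: "B $$ (i, j) = 0" if "i < n" "j < i" for i j
        using B(1,2) that by auto
      have "(B ^\<^sub>m Suc m) $$ (i, j) = (if i = j then B $$ (i, i) ^ Suc m else 0)" if "i < n" "j \<le> i" for i j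
      proof -
        have "(\<Sum>k<n. (B ^\<^sub>m m) $$ (i, k) * B $$ (k, j)) =
            (\<Sum>k<n. if k = i then (B ^\<^sub>m m) $$ (i, i) * B $$ (i, j) else 0)"
        proof (rule sum.cong[OF refl])
          fix k assume "k \<in> {..<n}"
          then show "(B ^\<^sub>m m) $$ (i, k) * B $$ (k, j) =
              (if k = i then (B ^\<^sub>m m) $$ (i, i) * B $$ (i, j) else 0)"
            using Suc that up[of k j] by (cases k i rule: linorder_cases) auto
        qed
        then show ?thesis using mult[of i j] that Suc up[of i j] by (auto simp: mult.commute)
      qed
      then show ?case by auto
    qed
    then show ?thesis by simp
  qed
  also have "\<dots> = (\<Sum>i<n. (A ^\<^sub>m m) $$ (i, i))"
  proof -
    obtain P Q where PQ: "similar_mat_wit (A ^\<^sub>m m) (B ^\<^sub>m m) P Q"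
      using B(3) similar_mat_wit_pow unfolding similar_mat_def by blast
    have dim: "n = dim_row (A ^\<^sub>m m)" using A by simp
    note D = similar_mat_witD[OF dim PQ]
    define b where "b = B ^\<^sub>m m"
    have "(\<Sum>i<n. (P * b * Q) $$ (i, i)) = (\<Sum>l<n. (Q * (P * b)) $$ (l, l))"
      by (rule sum_diag_mult_commute[of _ n]) (use D b_def in auto)
    also have "Q * (P * b) = b"
      using D b_def by (metis assoc_mult_mat left_mult_one_mat)
    finally show ?thesis using D(3) by (simp add: b_def)
  qed
  finally show ?thesis .
qed

section \<open>The Chebyshev recursion for sums over walks\<close>

fun walk_power :: "(nat \<Rightarrow> nat \<Rightarrow> real) \<Rightarrow> nat set \<Rightarrow> nat \<Rightarrow> nat \<Rightarrow> nat \<Rightarrow> real" where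
  "walk_power x I 0 u v = (if u = v then 1 else 0)"
| "walk_power x I (Suc m) u v = (\<Sum>z\<in>I. x u z * walk_power x I m z v)"

text \<open>The linear functional that sends the monomial of degree i to \<open>F i\<close>. With
  \<open>F i\<close> an entry of the i-th power of a matrix, it is an entry of the polynomial
  evaluated at that matrix, and polynomial recursions transfer to it.\<close>

definition coeff_sum :: "(nat \<Rightarrow> real) \<Rightarrow> real poly \<Rightarrow> real" where
  "coeff_sum F p = (\<Sum>i\<le>degree p. coeff p i * F i)"

lemma sum_mset_poly: "(\<Sum>y\<in>#A. poly p y) = coeff_sum (\<lambda>i. \<Sum>y\<in>#A. y ^ i) p"
  unfolding coeff_sum_def by (induction A) (simp_all add: poly_altdef sum.distrib distrib_left)

lemma coeff_sum_eq: "degree p \<le> n \<Longrightarrow> coeff_sum F p = (\<Sum>i\<le>n. coeff p i * F i)"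
  unfolding coeff_sum_def
  by (rule sum.mono_neutral_left) (auto simp: coeff_eq_0)

lemma coeff_sum_diff: "coeff_sum F (p - q) = coeff_sum F p - coeff_sum F q"
proof -
  let ?n = "max (degree p) (degree q)"
  have "degree (p - q) \<le> ?n" by (rule degree_diff_le) auto
  then show ?thesis
    using coeff_sum_eq[of p ?n F] coeff_sum_eq[of q ?n F] coeff_sum_eq[of "p - q" ?n F]
    by (simp add: left_diff_distrib sum_subtractf)
qed

lemma coeff_sum_times_X: "coeff_sum F ([:0, a:] * p) = a * coeff_sum (\<lambda>i. F (Suc i)) p"
proof -
  have "degree ([:0, a:] * p) \<le> Suc (degree p)"
    by (simp add: degree_pCons_le order.trans[OF degree_smult_le])
  then have "coeff_sum F ([:0, a:] * p) = (\<Sum>i\<le>Suc (degree p). coeff ([:0, a:] * p) i * F i)"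
    by (rule coeff_sum_eq)
  also have "\<dots> = (\<Sum>i\<le>degree p. a * (coeff p i * F (Suc i)))"
    by (subst sum.atMost_Suc_shift) (simp add: mult.assoc)
  finally show ?thesis by (simp add: coeff_sum_def sum_distrib_left)
qed

lemma coeff_sum_sum: "coeff_sum (\<lambda>i. \<Sum>z\<in>A. a z * F z i) p = (\<Sum>z\<in>A. a z * coeff_sum (F z) p)"
  unfolding coeff_sum_def by (simp add: sum_distrib_left mult.left_commute) (rule sum.swap)

definition lists_of :: "nat \<Rightarrow> 'a set \<Rightarrow> 'a list set" where
  "lists_of k V = {w. set w \<subseteq> V \<and> length w = k}"

lemma lists_of_0: "lists_of 0 V = {[]}"
  by (auto simp: lists_of_def)

lemma sum_lists_of_Suc:
  "(\<Sum>w\<in>lists_of (Suc k) V. F w) = (\<Sum>u\<in>V. \<Sum>w\<in>lists_of k V. F (u # w))"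
proof -
  have "lists_of (Suc k) V = (\<lambda>(u, w). u # w) ` (V \<times> lists_of k V)"
    by (auto simp: lists_of_def length_Suc_conv image_iff)
  moreover have "inj_on (\<lambda>(u, w). u # w) (V \<times> lists_of k V)" by (auto simp: inj_on_def)
  ultimately show ?thesis by (simp add: sum.reindex sum.cartesian_product case_prod_unfold comp_def)
qed

text \<open>A walk of \<open>m\<close> steps has \<open>m - 1\<close> inner vertices; for
  \<open>m = 0\<close> the value is the entry of the identity matrix. Scaled by
  \<open>(1 / sqrt n) ^ m\<close>, this is an entry of the Chebyshev polynomial of the second kind
  at the normalized matrix.\<close>

definition path_sum :: "(nat \<Rightarrow> nat \<Rightarrow> real) \<Rightarrow> nat set \<Rightarrow> nat \<Rightarrow> nat \<Rightarrow> nat \<Rightarrow> real" where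
  "path_sum x I m u v = (if m = 0 then if u = v then 1 else 0
     else \<Sum>w\<in>lists_of (m - 1) I. path_weight x (u # w @ [v]))"

lemma path_sum_1: "path_sum x I 1 u v = x u v"
  by (simp add: path_sum_def lists_of_0)

lemma path_sum_rec:
  assumes "finite I" "u \<in> I"
  shows "path_sum x I (Suc (Suc m)) u v =
    (\<Sum>z\<in>I. x u z * path_sum x I (Suc m) z v) - real (card I) * path_sum x I m u v"
proof (cases m)
  case 0
  then show ?thesis
    by (auto simp: path_sum_def sum_lists_of_Suc lists_of_0 sum_subtractf)
next
  case (Suc k)
  have "path_sum x I (Suc (Suc m)) u v =
      (\<Sum>z\<in>I. \<Sum>y\<in>I. \<Sum>w\<in>lists_of k I. path_weight x (u # z # y # w @ [v]))"
    by (simp add: path_sum_def Suc sum_lists_of_Suc)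
  also have "\<dots> = (\<Sum>z\<in>I. x u z * (\<Sum>y\<in>I. \<Sum>w\<in>lists_of k I. path_weight x (z # y # w @ [v]))) -
      (\<Sum>z\<in>I. \<Sum>y\<in>I. if u = y then \<Sum>w\<in>lists_of k I. path_weight x (y # w @ [v]) else 0)"
    unfolding sum_distrib_left sum_subtractf[symmetric]
    by (intro sum.cong refl) (auto simp: sum_subtractf)
  also have "(\<Sum>z\<in>I. \<Sum>y\<in>I. if u = y then \<Sum>w\<in>lists_of k I. path_weight x (y # w @ [v]) else 0) =
      real (card I) * path_sum x I m u v"
    using assms by (simp add: path_sum_def Suc)
  also have "(\<Sum>z\<in>I. x u z * (\<Sum>y\<in>I. \<Sum>w\<in>lists_of k I. path_weight x (z # y # w @ [v]))) =
      (\<Sum>z\<in>I. x u z * path_sum x I (Suc m) z v)"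
    by (simp add: path_sum_def Suc sum_lists_of_Suc)
  finally show ?thesis .
qed

text \<open>In the base point correction the base vertex itself is free, which gives the factor
  \<open>card I\<close>. The remaining \<open>k - 1\<close> vertices start and end at the same point
  and form a closed walk of \<open>k - 2\<close> steps.\<close>

lemma sum_cycle_weight:
  assumes "finite I" "k \<ge> 1"
  shows "(\<Sum>w\<in>lists_of k I. cycle_weight x w) =
    (\<Sum>u\<in>I. path_sum x I k u u) - (if k \<ge> 3 then real (card I) * (\<Sum>u\<in>I. path_sum x I (k - 2) u u) else 0)"
proof -
  obtain j where k: "k = Suc j" using assms(2) by (cases k) auto
  have 1: "(\<Sum>w\<in>lists_of k I. path_weight x (w @ [hd w])) = (\<Sum>u\<in>I. path_sum x I k u u)"
    by (simp add: k sum_lists_of_Suc path_sum_def)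
  have 2: "(\<Sum>w\<in>lists_of k I. if length w \<ge> 3 \<and> last w = w ! 1 then path_weight x (tl w) else 0) =
      (if k \<ge> 3 then real (card I) * (\<Sum>u\<in>I. path_sum x I (k - 2) u u) else 0)"
  proof (cases "k \<ge> 3")
    case False
    then show ?thesis by (auto intro!: sum.neutral simp: lists_of_def)
  next
    case True
    then obtain i where j: "j = Suc (Suc i)" unfolding k by (metis Suc_le_D Suc_le_mono numeral_3_eq_3)
    have snoc: "(\<Sum>w\<in>lists_of (Suc m) I. F w) = (\<Sum>w\<in>lists_of m I. \<Sum>z\<in>I. F (w @ [z]))" for m and F :: "nat list \<Rightarrow> real"
    proof (induction m arbitrary: F)
      case 0
      then show ?case by (simp add: sum_lists_of_Suc lists_of_0)
    next
      case (Suc m)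
      have "(\<Sum>w\<in>lists_of (Suc (Suc m)) I. F w) = (\<Sum>u\<in>I. \<Sum>w\<in>lists_of m I. \<Sum>z\<in>I. F (u # w @ [z]))"
        by (simp only: sum_lists_of_Suc[where k = "Suc m"] Suc)
      also have "\<dots> = (\<Sum>w\<in>lists_of (Suc m) I. \<Sum>z\<in>I. F (w @ [z]))"
        by (simp only: sum_lists_of_Suc[where k = m] append_Cons)
      finally show ?case .
    qed
    have "(\<Sum>w\<in>lists_of k I. if length w \<ge> 3 \<and> last w = w ! 1 then path_weight x (tl w) else 0) =
        (\<Sum>u\<in>I. \<Sum>a\<in>I. \<Sum>w\<in>lists_of (Suc i) I. if last w = a then path_weight x (a # w) else 0)"
      unfolding k j sum_lists_of_Suc[where k = "Suc (Suc i)"] sum_lists_of_Suc[where k = "Suc i"]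
      by (intro sum.cong refl) (auto simp: lists_of_def)
    also have "\<dots> = real (card I) * (\<Sum>a\<in>I. \<Sum>w\<in>lists_of i I. \<Sum>z\<in>I. if z = a then path_weight x (a # w @ [z]) else 0)"
      unfolding snoc by simp
    also have "\<dots> = real (card I) * (\<Sum>u\<in>I. path_sum x I (k - 2) u u)"
      using assms(1) by (simp add: path_sum_def k j)
    finally show ?thesis using True by simp
  qed
  show ?thesis unfolding cycle_weight_def sum_subtractf 1 2 ..
qed

text \<open>Both kinds of Chebyshev polynomials obey the same three term recursion, and so does the
  difference of two polynomials of the second kind. Comparing the initial terms is enough.\<close>

lemma cheb_T_coeff_sum:
  fixes x :: "nat \<Rightarrow> nat \<Rightarrow> real"
  assumes I: "finite I" "u \<in> I" and n: "card I = n" and c: "c = 1 / (2 * sqrt (real n))"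
  defines "T \<equiv> \<lambda>k u v. coeff_sum (\<lambda>i. c ^ i * walk_power x I i u v) (cheb_T k)"
  defines "U \<equiv> \<lambda>k u v. (1 / sqrt (real n)) ^ k * path_sum x I k u v"
  shows "2 * T (Suc 0) u u = U (Suc 0) u u" "2 * T (Suc (Suc k)) u u = U (Suc (Suc k)) u u - U k u u"
proof -
  have n0: "real n > 0" using I n by (auto simp: card_gt_0_iff)
  \<comment> \<open>The second identity turns the factor \<open>card I\<close> in
    \<open>path_sum_rec\<close> into the coefficient 1 of the Chebyshev recursion.\<close>
  then have c2: "2 * c = 1 / sqrt (real n)" "(2 * c)\<^sup>2 * real n = 1" by (auto simp: c power_divide)
  have T0: "T 0 u v = (if u = v then 1 else 0)" for u v by (simp add: T_def coeff_sum_def)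
  have T1: "T (Suc 0) u v = c * x u v" if "v \<in> I" for u v
    using I(1) that by (simp add: T_def coeff_sum_def if_distrib[of "(*) (x _ _)"] cong: if_cong)
  have TSS: "T (Suc (Suc k)) u v = 2 * c * (\<Sum>z\<in>I. x u z * T (Suc k) z v) - T k u v" for k u v
  proof -
    have "coeff_sum (\<lambda>i. c ^ Suc i * walk_power x I (Suc i) u v) p =
        (\<Sum>z\<in>I. (c * x u z) * coeff_sum (\<lambda>i. c ^ i * walk_power x I i z v) p)" for p
      by (subst coeff_sum_sum[symmetric]) (simp add: sum_distrib_left algebra_simps)
    then show ?thesis
      by (simp only: T_def cheb_T.simps coeff_sum_diff coeff_sum_times_X) (simp add: sum_distrib_left algebra_simps)
  qed
  have U0: "U 0 u v = (if u = v then 1 else 0)" for u v by (simp add: U_def path_sum_def)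
  have U1: "U (Suc 0) u v = 2 * c * x u v" for u v
    using path_sum_1[of x I u v] by (simp add: U_def c2)
  have USS: "U (Suc (Suc k)) u v = 2 * c * (\<Sum>z\<in>I. x u z * U (Suc k) z v) - U k u v" if "u \<in> I" for k u v
  proof -
    have "(2 * c) ^ Suc (Suc k) * (S - real n * p) = 2 * c * ((2 * c) ^ Suc k * S) - (2 * c) ^ k * p" for S p
      using c2(2) by (simp add: power2_eq_square right_diff_distrib)
    then show ?thesis
      unfolding U_def path_sum_rec[OF I(1) that] n c2(1)[symmetric]
      by (simp add: sum_distrib_left mult.left_commute)
  qed
  have T1': "2 * T (Suc 0) u v = U (Suc 0) u v" if "v \<in> I" for u v
    using T1[OF that] U1 by simp
  have rec: "2 * T (Suc (Suc k)) u v = 2 * c * (\<Sum>z\<in>I. x u z * (2 * T (Suc k) z v)) - 2 * T k u v" for k u v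
    unfolding TSS by (simp add: sum_distrib_left algebra_simps)
  have sumU: "2 * c * (\<Sum>z\<in>I. x u z * (U (Suc (Suc k)) z v - U k z v)) =
      U (Suc (Suc (Suc k))) u v + U (Suc k) u v - 2 * c * (\<Sum>z\<in>I. x u z * U k z v)" if "u \<in> I" for k u v
    unfolding USS[OF that, of "Suc k"] by (simp add: sum_subtractf right_diff_distrib)
  \<comment> \<open>All entries are needed, since the recursion multiplies by the whole matrix and
    does not stay on the diagonal.\<close>
  have main: "2 * T (Suc (Suc k)) u v = U (Suc (Suc k)) u v - U k u v" if "u \<in> I" "v \<in> I" for u v k
    using that
  proof (induction k arbitrary: u rule: induct_nat_012)
    case 0
    then show ?case
      unfolding rec[of 0] using T1'[OF 0(2)] USS[OF 0(1), of 0 v] T0 U0 by simp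
  next
    case 1
    have "2 * c * (\<Sum>z\<in>I. x u z * U 0 z v) = U (Suc 0) u v"
      using I(1) 1 by (simp add: U0 U1 if_distrib[of "(*) (x _ _)"] cong: if_cong)
    moreover have "(\<Sum>z\<in>I. x u z * (2 * T (Suc (Suc 0)) z v)) = (\<Sum>z\<in>I. x u z * (U (Suc (Suc 0)) z v - U 0 z v))"
    proof (intro sum.cong refl)
      fix z assume z: "z \<in> I"
      have "2 * T (Suc (Suc 0)) z v = U (Suc (Suc 0)) z v - U 0 z v"
        unfolding rec[of 0] using T1'[OF 1(2)] USS[OF z, of 0 v] T0 U0 by simp
      then show "x u z * (2 * T (Suc (Suc 0)) z v) = x u z * (U (Suc (Suc 0)) z v - U 0 z v)" by simp
    qed
    ultimately show ?case
      unfolding rec[of "Suc 0"] using sumU[OF 1(1), of 0 v] T1'[OF 1(2), of u] by simp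
  next
    case (ge2 k)
    have "(\<Sum>z\<in>I. x u z * (2 * T (Suc (Suc (Suc k))) z v)) =
        (\<Sum>z\<in>I. x u z * (U (Suc (Suc (Suc k))) z v - U (Suc k) z v))"
      using ge2(2,4) by (intro sum.cong refl) simp
    then show ?case
      unfolding rec[of "Suc (Suc k)"] ge2(1)[OF ge2(3,4)]
      using sumU[OF ge2(3), of "Suc k" v] USS[OF ge2(3), of k v] by simp
  qed
  show "2 * T (Suc 0) u u = U (Suc 0) u u" by (rule T1'[OF I(2)])
  show "2 * T (Suc (Suc k)) u u = U (Suc (Suc k)) u u - U k u u" by (rule main[OF I(2) I(2)])
qed

lemma bij_betw_pick: "finite I \<Longrightarrow> bij_betw (pick I) {..<card I} I"
proof -
  assume I: "finite I"
  have inj: "inj_on (pick I) {..<card I}"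
  proof (rule inj_onI)
    fix r s assume "r \<in> {..<card I}" "s \<in> {..<card I}" "pick I r = pick I s"
    then show "r = s"
      using pick_mono_le[of r I s] pick_mono_le[of s I r] by (cases r s rule: linorder_cases) auto
  qed
  have "pick I ` {..<card I} = I"
    by (rule card_subset_eq[OF I]) (use inj pick_in_set_le in \<open>auto simp: card_image\<close>)
  with inj show ?thesis by (simp add: bij_betw_def)
qed

lemma pow_mat_walk_power:
  assumes I: "finite I" and A: "A = Matrix.mat (card I) (card I) (\<lambda>(r, s). c * x (pick I r) (pick I s))"
    and "r < card I" "s < card I"
  shows "(A ^\<^sub>m m) $$ (r, s) = c ^ m * walk_power x I m (pick I r) (pick I s)"
  using assms(3)
proof (induction m arbitrary: r)
  case 0
  have "pick I r = pick I s \<longleftrightarrow> r = s"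
    using bij_betw_pick[OF I] 0 assms(4) by (auto simp: bij_betw_def inj_on_def)
  then show ?case using 0 assms(4) by (simp add: A)
next
  case (Suc m)
  have cA: "A \<in> carrier_mat (card I) (card I)" by (simp add: A)
  \<comment> \<open>The matrix power multiplies on the right, while \<open>walk_power\<close> splits
    off the first step on the left.\<close>
  have comm: "A ^\<^sub>m Suc m = A * A ^\<^sub>m m"
  proof (induction m)
    case 0
    then show ?case using cA by simp
  next
    case (Suc m)
    have cm: "A ^\<^sub>m m \<in> carrier_mat (card I) (card I)" using cA by simp
    have "A ^\<^sub>m Suc (Suc m) = (A * A ^\<^sub>m m) * A" using Suc by simp
    also have "\<dots> = A * (A ^\<^sub>m m * A)" by (rule assoc_mult_mat[OF cA cm cA])
    finally show ?case by simp
  qed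
  have "(A ^\<^sub>m Suc m) $$ (r, s) = (\<Sum>l<card I. A $$ (r, l) * (A ^\<^sub>m m) $$ (l, s))"
    unfolding comm using Suc.prems assms(4) cA by (simp add: scalar_prod_def lessThan_atLeast0)
  also have "\<dots> = (\<Sum>l<card I. c ^ Suc m * (x (pick I r) (pick I l) * walk_power x I m (pick I l) (pick I s)))"
    using Suc by (intro sum.cong refl) (simp add: A)
  also have "\<dots> = c ^ Suc m * (\<Sum>z\<in>I. x (pick I r) z * walk_power x I m z (pick I s))"
    unfolding sum_distrib_left[symmetric]
    by (simp add: sum.reindex_bij_betw[OF bij_betw_pick[OF I], of "\<lambda>z. x (pick I r) z * walk_power x I m z (pick I s)"])
  finally show ?case by simp
qed

text \<open>For k \<ge> 3 the trace of the lower polynomial of the second kind is exactly the base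
  point correction, because \<open>n\<close> cancels two of the factors \<open>1 / sqrt n\<close>.
  For k = 2 that polynomial is constant with trace \<open>n\<close>, which leaves the deterministic
  term; for k = 1 there is none.\<close>

lemma linear_stat_cycle_weight:
  fixes X :: "nat \<Rightarrow> nat \<Rightarrow> 'w \<Rightarrow> real"
  assumes I: "finite I" and sym: "\<And>i j. X i j = X j i" and k: "k \<ge> 1"
  shows "linear_stat X (poly (cheb_T k)) I \<omega> =
    (1 / 2) * (1 / sqrt (real (card I))) ^ k * (\<Sum>w\<in>lists_of k I. cycle_weight (\<lambda>u v. X u v \<omega>) w) -
    (if k = 2 then real (card I) / 2 else 0)"
proof -
  define n where "n = card I"
  define x where "x u v = X u v \<omega>" for u v
  define c where "c = 1 / (2 * sqrt (real n))"
  define A where "A = Matrix.mat n n (\<lambda>(r, s). c * x (pick I r) (pick I s))"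
  have A: "normalized_submatrix X I \<omega> = A"
    by (auto simp: normalized_submatrix_def principal_submatrix_def A_def c_def n_def x_def)
  have cA: "A \<in> carrier_mat n n" by (simp add: A_def)
  have symA: "A $$ (i, j) = A $$ (j, i)" if "i < n" "j < n" for i j
    using that sym by (simp add: A_def x_def)
  define T where "T k u = coeff_sum (\<lambda>i. c ^ i * walk_power x I i u u) (cheb_T k)" for k u
  define U where "U k u = (1 / sqrt (real n)) ^ k * path_sum x I k u u" for k u
  have "linear_stat X (poly (cheb_T k)) I \<omega> = (\<Sum>y\<in>#proots (char_poly A). poly (cheb_T k) y)"
    by (simp add: linear_stat_def eigenvalue_sum_def A)
  also have "\<dots> = coeff_sum (\<lambda>i. \<Sum>y\<in>#proots (char_poly A). y ^ i) (cheb_T k)"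
    by (rule sum_mset_poly)
  also have "\<dots> = coeff_sum (\<lambda>i. \<Sum>u\<in>I. 1 * (c ^ i * walk_power x I i u u)) (cheb_T k)"
  proof -
    have "(\<Sum>y\<in>#proots (char_poly A). y ^ i) = (\<Sum>u\<in>I. 1 * (c ^ i * walk_power x I i u u))" for i
    proof -
      have "(\<Sum>y\<in>#proots (char_poly A). y ^ i) = (\<Sum>r<n. (A ^\<^sub>m i) $$ (r, r))"
        by (rule eigenvalue_sum_power[OF cA symA])
      also have "\<dots> = (\<Sum>r<card I. c ^ i * walk_power x I i (pick I r) (pick I r))"
        unfolding n_def by (intro sum.cong refl pow_mat_walk_power[OF I]) (auto simp: A_def n_def)
      also have "\<dots> = (\<Sum>u\<in>I. c ^ i * walk_power x I i u u)"
        by (rule sum.reindex_bij_betw[OF bij_betw_pick[OF I]])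
      finally show ?thesis by simp
    qed
    then show ?thesis by simp
  qed
  also have "\<dots> = (\<Sum>u\<in>I. T k u)" unfolding coeff_sum_sum by (simp add: T_def)
  finally have stat: "linear_stat X (poly (cheb_T k)) I \<omega> = (\<Sum>u\<in>I. T k u)" .
  have cyc: "(\<Sum>w\<in>lists_of k I. cycle_weight x w) =
    (\<Sum>u\<in>I. path_sum x I k u u) - (if k \<ge> 3 then real n * (\<Sum>u\<in>I. path_sum x I (k - 2) u u) else 0)"
    unfolding n_def by (rule sum_cycle_weight[OF I k])
  have "(\<Sum>u\<in>I. T k u) = (1 / 2) * (1 / sqrt (real n)) ^ k * (\<Sum>w\<in>lists_of k I. cycle_weight x w) -
      (if k = 2 then real n / 2 else 0)"
  proof (cases "I = {}")
    case True
    then have "lists_of k I = {}" using k by (auto simp: lists_of_def)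
    then show ?thesis using True by (simp add: n_def)
  next
    case False
    then have n0: "real n > 0" using I by (simp add: n_def card_gt_0_iff)
    note cheb = cheb_T_coeff_sum[OF I _ n_def[symmetric] c_def, of _ x, folded T_def U_def]
    consider "k = 1" | "k = 2" | j where "k = Suc (Suc j)" "j \<ge> 1"
      using k by (metis One_nat_def Suc_1 Suc_leI less_Suc_eq_0_disj not_less_eq_eq old.nat.exhaust le_SucE)
    then show ?thesis
    proof cases
      case 1
      have "(\<Sum>u\<in>I. T (Suc 0) u) = (\<Sum>u\<in>I. U (Suc 0) u / 2)"
        using cheb(1) by (intro sum.cong refl) fastforce
      then show ?thesis unfolding cyc by (simp add: 1 U_def sum_distrib_left sum_divide_distrib mult.commute)
    next
      case 2
      have "(\<Sum>u\<in>I. T (Suc (Suc 0)) u) = (\<Sum>u\<in>I. U (Suc (Suc 0)) u / 2 - 1 / 2)"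
      proof (intro sum.cong refl)
        fix u assume "u \<in> I"
        then show "T (Suc (Suc 0)) u = U (Suc (Suc 0)) u / 2 - 1 / 2"
          using cheb(2)[of u 0] by (simp add: U_def[of 0] path_sum_def[of _ _ 0])
      qed
      then show ?thesis unfolding cyc
        by (simp add: 2 U_def sum_distrib_left sum_subtractf sum_divide_distrib numeral_2_eq_2 n_def mult.commute)
    next
      case (3 j)
      have sq: "(1 / sqrt (real n)) ^ k * real n = (1 / sqrt (real n)) ^ j"
        using n0 by (simp add: 3 field_simps)
      have "(\<Sum>u\<in>I. T k u) = (\<Sum>u\<in>I. U k u / 2 - U j u / 2)"
      proof (intro sum.cong refl)
        fix u assume "u \<in> I"
        then show "T k u = U k u / 2 - U j u / 2" using cheb(2)[of u j] by (simp add: 3)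
      qed
      also have "\<dots> = (1 / 2) * ((1 / sqrt (real n)) ^ k * (\<Sum>u\<in>I. path_sum x I k u u) -
          ((1 / sqrt (real n)) ^ k * real n) * (\<Sum>u\<in>I. path_sum x I j u u))"
        unfolding sq by (simp add: U_def sum_subtractf sum_distrib_left right_diff_distrib sum_divide_distrib)
      finally show ?thesis unfolding cyc using 3 by (simp add: right_diff_distrib mult.assoc)
    qed
  qed
  then show ?thesis unfolding stat by (simp add: n_def x_def[abs_def])
qed

subsection \<open>The limit theorem\<close>

lemma finite_lists_of: "finite V \<Longrightarrow> finite (lists_of k V)"
  unfolding lists_of_def by (rule finite_lists_length_eq)

definition dihedral_order :: "nat \<Rightarrow> nat" where
  "dihedral_order k = (if k = 1 then 1 else if k = 2 then 2 else 2 * k)"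

lemma card_distinct_lists_of:
  assumes "finite V"
  shows "card {w \<in> lists_of k V. distinct w} = (\<Prod>i<k. card V - i)"
proof (cases "k \<le> card V")
  case True
  have "{w \<in> lists_of k V. distinct w} = {w. length w = k \<and> distinct w \<and> set w \<subseteq> V}"
    by (auto simp: lists_of_def)
  then have "card {w \<in> lists_of k V. distinct w} = \<Prod>{card V - k + 1..card V}"
    using card_lists_distinct_length_eq[OF assms True] by simp
  also have "\<dots> = (\<Prod>i<k. card V - i)"
    by (rule prod.reindex_bij_witness[of _ "\<lambda>i. card V - i" "\<lambda>i. card V - i"]) (use True in auto)
  finally show ?thesis .
next
  case False
  have "{w \<in> lists_of k V. distinct w} = {}"
    using False by (auto simp: lists_of_def) (metis assms card_mono distinct_card)
  moreover have "(\<Prod>i<k. card V - i) = 0"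
    using False by (intro prod_zero) (auto intro!: bexI[of _ "card V"])
  ultimately show ?thesis by (simp only: card.empty)
qed

text \<open>With \<open>A = I \<inter> J\<close>, the number of based simple cycles visible to both
  matrices, under the normalization of both.\<close>

definition cycle_density :: "nat \<Rightarrow> 'a set \<Rightarrow> 'b set \<Rightarrow> 'c set \<Rightarrow> real" where
  "cycle_density k I J A =
    (1 / sqrt (card I)) ^ k * (1 / sqrt (card J)) ^ k * real (card {w \<in> lists_of k A. distinct w})"

lemma tendsto_cycle_density:
  fixes t :: "nat \<Rightarrow> real"
  assumes fin: "\<And>N. finite (A N)" and t: "filterlim t at_top sequentially"
    and a: "(\<lambda>N. real (card (I N)) / t N) \<longlonglongrightarrow> a" and b: "(\<lambda>N. real (card (J N)) / t N) \<longlonglongrightarrow> b"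
    and d: "(\<lambda>N. real (card (A N)) / t N) \<longlonglongrightarrow> d" and pos: "a > 0" "b > 0" "d > 0"
  shows "(\<lambda>N. cycle_density k (I N) (J N) (A N)) \<longlonglongrightarrow> (d / sqrt (a * b)) ^ k"
proof -
  \<comment> \<open>One factor of the falling factorial with its share of the two normalizations,
    everything divided by \<open>t N\<close>.\<close>
  let ?f = "\<lambda>i N. (real (card (A N)) / t N - real i / t N) /
    (sqrt (real (card (I N)) / t N) * sqrt (real (card (J N)) / t N))"
  have tpos: "\<forall>\<^sub>F N in sequentially. t N > 0"
    using t by (simp add: filterlim_at_top_dense)
  have "(\<lambda>N. (real (card (A N)) / t N - real i / t N)) \<longlonglongrightarrow> d - 0" for i
    by (intro tendsto_diff d tendsto_divide_0[OF tendsto_const filterlim_at_top_imp_at_infinity[OF t]])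
  then have fac: "?f i \<longlonglongrightarrow> d / (sqrt a * sqrt b)" for i
    using a b pos by (intro tendsto_intros) auto
  have lim: "(\<lambda>N. \<Prod>i<k. ?f i N) \<longlonglongrightarrow> (\<Prod>i<k. d / (sqrt a * sqrt b))"
    by (intro tendsto_prod fac)
  \<comment> \<open>From here on the truncated subtraction in the falling factorial is a true
    one.\<close>
  have big: "\<forall>\<^sub>F N in sequentially. k \<le> card (A N)"
  proof -
    have "filterlim (\<lambda>N. real (card (A N)) / t N * t N) at_top sequentially"
      by (rule filterlim_tendsto_pos_mult_at_top[OF d pos(3) t])
    then have "\<forall>\<^sub>F N in sequentially. real (card (A N)) / t N * t N > real k"
      by (simp add: filterlim_at_top_dense)
    then show ?thesis using tpos by eventually_elim simp
  qed
  have "\<forall>\<^sub>F N in sequentially. (\<Prod>i<k. ?f i N) = cycle_density k (I N) (J N) (A N)"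
    using tpos big
  proof eventually_elim
    case (elim N)
    have sq: "sqrt (x / t N) * sqrt (y / t N) = sqrt x * sqrt y / t N" for x y
      using elim(1) by (simp add: real_sqrt_divide)
    have quot: "(x / t N - z / t N) / (p / t N) = (x - z) / p" for x z p
      using elim(1) by (simp add: diff_divide_distrib[symmetric])
    have "(\<Prod>i<k. ?f i N) =
        (\<Prod>i<k. (real (card (A N)) - real i) / (sqrt (card (I N)) * sqrt (card (J N))))"
      unfolding sq quot ..
    also have "\<dots> = (\<Prod>i<k. real (card (A N) - i)) / (sqrt (card (I N)) * sqrt (card (J N))) ^ k"
      unfolding prod_dividef using elim(2) by (simp add: of_nat_diff)
    finally show ?case
      by (simp add: cycle_density_def card_distinct_lists_of[OF fin] power_mult_distrib power_divide)
  qed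
  from Lim_transform_eventually[OF lim this] show ?thesis
    by (simp add: real_sqrt_mult)
qed

section \<open>The variance of the walk sum and its limit\<close>

context wigner_matrix
begin

text \<open>As the second moment of a concrete simple cycle it cannot be negative; this yields
  \<open>d2 \<ge> 0\<close> and \<open>m4 \<ge> 1\<close>.\<close>

lemma weight_var_nonneg: "k \<ge> 1 \<Longrightarrow> 0 \<le> weight_var k"
proof -
  assume k: "k \<ge> 1"
  have "0 \<le> expectation (\<lambda>\<omega>. (centered_weight [0..<k] \<omega>)\<^sup>2)" by (intro integral_nonneg_AE) simp
  also have "\<dots> = weight_var (length [0..<k])"
    by (rule expectation_centered_weight_square) (use k in auto)
  finally show ?thesis by simp
qed

text \<open>Extended by zero, so that both statistics become sums over the same set of
  walks.\<close>

definition norm_coeff :: "nat \<Rightarrow> nat set \<Rightarrow> nat list \<Rightarrow> real" where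
  "norm_coeff k I w = (if w \<in> lists_of k I then (1 / 2) * (1 / sqrt (card I)) ^ k else 0)"

lemma centered_linear_stat_eq:
  assumes "finite I" "k \<ge> 1"
  shows "centered_linear_stat M X (poly (cheb_T k)) I \<omega> =
    (\<Sum>w\<in>lists_of k I. (1 / 2) * (1 / sqrt (card I)) ^ k * centered_weight w \<omega>)"
proof -
  define \<alpha> where "\<alpha> = (1 / 2) * (1 / sqrt (card I)) ^ k"
  define \<kappa> where "\<kappa> = (if k = 2 then real (card I) / 2 else 0)"
  have ls: "linear_stat X (poly (cheb_T k)) I = (\<lambda>\<omega>. \<alpha> * (\<Sum>w\<in>lists_of k I. walk_weight w \<omega>) - \<kappa>)"
    using linear_stat_cycle_weight[OF assms(1) symmetric assms(2)]
    by (auto simp: \<alpha>_def \<kappa>_def walk_weight_def)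
  have int: "integrable M (walk_weight w)" for w by (rule poly_on_integrable[OF poly_on_walk_weight])
  have "expectation (linear_stat X (poly (cheb_T k)) I) = \<alpha> * (\<Sum>w\<in>lists_of k I. expectation (walk_weight w)) - \<kappa>"
    unfolding ls using int by (simp add: prob_space)
  then show ?thesis
    unfolding centered_linear_stat_def \<alpha>_def[symmetric] sum_distrib_left[symmetric]
    by (simp add: ls centered_weight_def sum_subtractf right_diff_distrib)
qed

lemma poly_on_centered_linear_stat:
  assumes "finite I" "k \<ge> 1"
  shows "poly_on edges (centered_linear_stat M X (poly (cheb_T k)) I)"
proof -
  have "centered_linear_stat M X (poly (cheb_T k)) I =
      (\<lambda>\<omega>. \<Sum>w\<in>lists_of k I. (1 / 2) * (1 / sqrt (card I)) ^ k * centered_weight w \<omega>)"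
    using centered_linear_stat_eq[OF assms] by (intro ext)
  then show ?thesis
    by (simp only:) (intro poly_on_sum poly_on.mult poly_on.const
      poly_on_mono[OF poly_on_centered_weight set_cycle_edges_subset])
qed

lemma centered_linear_stats_walk_sum:
  fixes k l :: nat and u v :: real
  assumes "finite I" "finite J" "k \<ge> 1" "l \<ge> 1"
  defines "L \<equiv> lists_of k (I \<union> J) \<union> lists_of l (I \<union> J)"
  shows "u * centered_linear_stat M X (poly (cheb_T k)) I \<omega> + v * centered_linear_stat M X (poly (cheb_T l)) J \<omega> =
    walk_sum L (\<lambda>w. u * norm_coeff k I w + v * norm_coeff l J w) \<omega>"
proof -
  have fin: "finite L" unfolding L_def using finite_lists_of assms(1,2) by blast
  have 1: "centered_linear_stat M X (poly (cheb_T j)) I \<omega> = (\<Sum>w\<in>L. norm_coeff j I w * centered_weight w \<omega>)"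
    if "lists_of j I \<subseteq> L" "finite I" "j \<ge> 1" for j I
  proof -
    have "(\<Sum>w\<in>L. norm_coeff j I w * centered_weight w \<omega>) = (\<Sum>w\<in>lists_of j I. norm_coeff j I w * centered_weight w \<omega>)"
      by (rule sum.mono_neutral_right[OF fin that(1)]) (simp add: norm_coeff_def)
    then show ?thesis unfolding centered_linear_stat_eq[OF that(2,3)] by (simp add: norm_coeff_def)
  qed
  have "lists_of k I \<subseteq> L" "lists_of l J \<subseteq> L" by (auto simp: L_def lists_of_def)
  then show ?thesis
    using 1[of k I] 1[of l J] assms(1-4)
    by (simp add: walk_sum_def sum.distrib sum_distrib_left distrib_right mult.assoc)
qed

text \<open>The walks in \<open>L\<close> are all lists of the given lengths, so \<open>L\<close>
  contains whole dihedral classes. The coefficients are constant on a class, and the sum over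
  partners reduces to its size.\<close>

lemma walk_sum_var_eq:
  assumes "finite V" "L = lists_of k V \<union> lists_of l V" "k \<ge> 1" "l \<ge> 1"
    and c: "\<And>w w'. w' \<in> dihedral_class w \<Longrightarrow> c w' = c w"
  shows "walk_sum_var L c = (\<Sum>w | w \<in> L \<and> distinct w. weight_var (length w) * real (dihedral_order (length w)) * (c w)\<^sup>2)"
proof -
  have fin: "finite L" unfolding assms(2) using finite_lists_of[OF assms(1)] by simp
  have "walk_sum_var L c = (\<Sum>w\<in>L. if distinct w then weight_var (length w) * real (dihedral_order (length w)) * (c w)\<^sup>2 else 0)"
    unfolding walk_sum_var_def
  proof (rule sum.cong[OF refl])
    fix w assume w: "w \<in> L"
    show "(\<Sum>v\<in>L. c w * c v * (if distinct w \<and> v \<in> dihedral_class w then weight_var (length w) else 0)) =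
      (if distinct w then weight_var (length w) * real (dihedral_order (length w)) * (c w)\<^sup>2 else 0)"
    proof (cases "distinct w")
      case True
      have sub: "dihedral_class w \<subseteq> L"
        using w dihedral_class_props unfolding assms(2) lists_of_def by auto
      have "w \<noteq> []" using w assms by (auto simp: lists_of_def)
      have "(\<Sum>v\<in>L. c w * c v * (if distinct w \<and> v \<in> dihedral_class w then weight_var (length w) else 0)) =
          (\<Sum>v\<in>dihedral_class w. c w * c v * (if distinct w \<and> v \<in> dihedral_class w then weight_var (length w) else 0))"
        by (rule sum.mono_neutral_right[OF fin sub]) auto
      also have "\<dots> = (\<Sum>v\<in>dihedral_class w. weight_var (length w) * (c w)\<^sup>2)"
        using True c by (intro sum.cong refl) (simp add: power2_eq_square)
      also have "\<dots> = real (dihedral_order (length w)) * (weight_var (length w) * (c w)\<^sup>2)"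
        using card_dihedral_class[OF True \<open>w \<noteq> []\<close>] by (simp add: dihedral_order_def)
      finally show ?thesis using True by simp
    qed simp
  qed
  also have "\<dots> = (\<Sum>w | w \<in> L \<and> distinct w. weight_var (length w) * real (dihedral_order (length w)) * (c w)\<^sup>2)"
    using fin by (simp add: sum.inter_filter[symmetric])
  finally show ?thesis .
qed

text \<open>The divisor 4 is the square of the factor 1/2 in \<open>norm_coeff\<close>;
  \<open>dihedral_order\<close> counts the partners of a simple cycle.\<close>

definition limit_var :: "nat \<Rightarrow> real" where
  "limit_var k = weight_var k * real (dihedral_order k) / 4"

lemma limit_var_nonneg: "k \<ge> 1 \<Longrightarrow> 0 \<le> limit_var k"
  using weight_var_nonneg by (simp add: limit_var_def)

text \<open>Expand the square of the coefficients. A walk counts in the cross term only if both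
  lengths agree and all its vertices lie in both index sets.\<close>

lemma walk_sum_var_linear_stats:
  fixes k l :: nat and u v :: real
  assumes "finite I" "finite J" "k \<ge> 1" "l \<ge> 1"
  defines "L \<equiv> lists_of k (I \<union> J) \<union> lists_of l (I \<union> J)"
  shows "walk_sum_var L (\<lambda>w. u * norm_coeff k I w + v * norm_coeff l J w) =
    u\<^sup>2 * limit_var k * cycle_density k I I I + v\<^sup>2 * limit_var l * cycle_density l J J J +
    (if k = l then 2 * u * v * limit_var k else 0) * cycle_density k I J (I \<inter> J)"
proof -
  have fin: "finite L" unfolding L_def using finite_lists_of assms(1,2) by blast
  define h where "h w = weight_var (length w) * real (dihedral_order (length w))" for w :: "nat list"
  let ?S = "\<lambda>c. \<Sum>w | w \<in> L \<and> distinct w. h w * c w"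
  have inv: "norm_coeff j A w' = norm_coeff j A w" if "w' \<in> dihedral_class w" for j A w w'
    using dihedral_class_props[OF that] by (simp add: norm_coeff_def lists_of_def)
  have same: "?S (\<lambda>w. norm_coeff j A w * norm_coeff j B w) = limit_var j * cycle_density j A B (A \<inter> B)"
    if "lists_of j (A \<inter> B) \<subseteq> L" for j A B
  proof -
    have "?S (\<lambda>w. norm_coeff j A w * norm_coeff j B w) =
        (\<Sum>w\<in>{w \<in> lists_of j (A \<inter> B). distinct w}. limit_var j * ((1 / sqrt (card A)) ^ j * (1 / sqrt (card B)) ^ j))"
      by (rule sum.mono_neutral_cong_right)
        (use fin that in \<open>auto simp: norm_coeff_def h_def limit_var_def lists_of_def\<close>)
    then show ?thesis by (simp add: cycle_density_def)
  qed
  have cross: "?S (\<lambda>w. norm_coeff k I w * norm_coeff l J w) =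
      (if k = l then limit_var k else 0) * cycle_density k I J (I \<inter> J)"
  proof (cases "k = l")
    case True
    then show ?thesis using same[of k I J] by (auto simp: L_def lists_of_def)
  next
    case False
    then show ?thesis by (auto intro!: sum.neutral simp: norm_coeff_def lists_of_def)
  qed
  have "walk_sum_var L (\<lambda>w. u * norm_coeff k I w + v * norm_coeff l J w) =
      ?S (\<lambda>w. (u * norm_coeff k I w + v * norm_coeff l J w)\<^sup>2)"
    unfolding h_def using assms(1-4) inv by (intro walk_sum_var_eq[of "I \<union> J" L k l]) (auto simp: L_def)
  also have "\<dots> = u\<^sup>2 * ?S (\<lambda>w. norm_coeff k I w * norm_coeff k I w) +
      v\<^sup>2 * ?S (\<lambda>w. norm_coeff l J w * norm_coeff l J w) + 2 * u * v * ?S (\<lambda>w. norm_coeff k I w * norm_coeff l J w)"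
    unfolding sum_distrib_left sum.distrib[symmetric]
    by (intro sum.cong refl) (simp add: power2_eq_square algebra_simps)
  also have "?S (\<lambda>w. norm_coeff k I w * norm_coeff k I w) = limit_var k * cycle_density k I I I"
    using same[of k I I] by (auto simp: L_def lists_of_def)
  also have "?S (\<lambda>w. norm_coeff l J w * norm_coeff l J w) = limit_var l * cycle_density l J J J"
    using same[of l J J] by (auto simp: L_def lists_of_def)
  finally show ?thesis unfolding cross by simp
qed

end

text \<open>The coefficients are normalized by one index set, the walks are counted in the union.
  Comparable sizes cost only a constant factor.\<close>

lemma norm_bound:
  fixes n a R :: real
  assumes "0 < a" "0 < n" "n \<le> R * a"
  shows "(1 / sqrt a) ^ k \<le> sqrt R ^ k * (1 / sqrt n) ^ k"
proof -
  have "0 < R" using assms by (meson less_le_trans zero_less_mult_pos2)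
  have "sqrt n \<le> sqrt R * sqrt a" using assms(3) by (metis real_sqrt_le_mono real_sqrt_mult)
  then have "1 / sqrt a \<le> sqrt R * (1 / sqrt n)"
    using assms(1,2) by (simp add: field_simps)
  then have "(1 / sqrt a) ^ k \<le> (sqrt R * (1 / sqrt n)) ^ k" using assms(1) by (intro power_mono) auto
  then show ?thesis by (simp only: power_mult_distrib)
qed

section \<open>Convergence for a sequence of overlapping submatrices\<close>

locale overlapping_submatrices = wigner_matrix M X d2 m4
  for M :: "'w measure" and X :: "nat \<Rightarrow> nat \<Rightarrow> 'w \<Rightarrow> real" and d2 m4 :: real +
  fixes I J :: "nat \<Rightarrow> nat set" and t :: "nat \<Rightarrow> real" and a b \<Delta> :: real and k l :: nat
  assumes I: "finite (I N)" and J: "finite (J N)" and t: "filterlim t at_top sequentially"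
    and a: "(\<lambda>N. real (card (I N)) / t N) \<longlonglongrightarrow> a" and b: "(\<lambda>N. real (card (J N)) / t N) \<longlonglongrightarrow> b"
    and d: "(\<lambda>N. real (card (I N \<inter> J N)) / t N) \<longlonglongrightarrow> \<Delta>"
    and pos: "a > 0" "b > 0" "\<Delta> > 0" and k: "k \<ge> 1" and l: "l \<ge> 1"
begin

definition S :: "nat \<Rightarrow> 'w \<Rightarrow> real" where "S N = centered_linear_stat M X (poly (cheb_T k)) (I N)"
definition T :: "nat \<Rightarrow> 'w \<Rightarrow> real" where "T N = centered_linear_stat M X (poly (cheb_T l)) (J N)"

text \<open>The quadratic form of the limiting covariance matrix.\<close>

definition combined_var :: "real \<Rightarrow> real \<Rightarrow> real" where
  "combined_var u v = u\<^sup>2 * limit_var k + v\<^sup>2 * limit_var l +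
    (if k = l then 2 * u * v * limit_var k else 0) * (\<Delta> / sqrt (a * b)) ^ k"

lemma t_pos: "\<forall>\<^sub>F N in sequentially. t N > 0"
  using t by (simp add: filterlim_at_top_dense)

lemma moments_tendsto: "(\<lambda>N. expectation (\<lambda>\<omega>. (u * S N \<omega> + v * T N \<omega>) ^ p)) \<longlonglongrightarrow> gaussian_moment (combined_var u v) p"
proof -
  define L where "L N = lists_of k (I N \<union> J N) \<union> lists_of l (I N \<union> J N)" for N
  define c where "c N w = u * norm_coeff k (I N) w + v * norm_coeff l (J N) w" for N w
  define n where "n N = real (card (I N \<union> J N))" for N
  define m where "m N p = expectation (\<lambda>\<omega>. (u * S N \<omega> + v * T N \<omega>) ^ p)" for N p
  have W: "u * S N \<omega> + v * T N \<omega> = walk_sum (L N) (c N) \<omega>" for N \<omega>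
    unfolding S_def T_def L_def c_def[abs_def] by (rule centered_linear_stats_walk_sum[OF I J k l])
  have var: "(\<lambda>N. walk_sum_var (L N) (c N)) \<longlonglongrightarrow> combined_var u v"
  proof -
    \<comment> \<open>The first two ratios equal 1; this is the form in which
      \<open>tendsto_cycle_density\<close> yields them.\<close>
    have "(\<lambda>N. walk_sum_var (L N) (c N)) \<longlonglongrightarrow> u\<^sup>2 * limit_var k * (a / sqrt (a * a)) ^ k +
        v\<^sup>2 * limit_var l * (b / sqrt (b * b)) ^ l + (if k = l then 2 * u * v * limit_var k else 0) * (\<Delta> / sqrt (a * b)) ^ k"
      unfolding L_def c_def[abs_def] walk_sum_var_linear_stats[OF I J k l] using I J pos
      by (intro tendsto_add tendsto_mult_left tendsto_cycle_density[OF _ t a a a]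
          tendsto_cycle_density[OF _ t b b b] tendsto_cycle_density[OF _ t a b d]) auto
    then show ?thesis using pos by (simp add: combined_var_def)
  qed
  \<comment> \<open>Eventually the union is at most \<open>R\<close> times as large as either index
    set. The added 1 makes the limits strictly ordered, so that the inequality passes to all large
    \<open>N\<close>.\<close>
  define R where "R = max ((a + b) / a) ((a + b) / b) + 1"
  have R: "a + b < R * a" "a + b < R * b" "0 < R"
  proof -
    have "(a + b) / a < R" "(a + b) / b < R" by (simp_all add: R_def)
    moreover have "0 < (a + b) / a" using pos by simp
    ultimately show "a + b < R * a" "a + b < R * b" "0 < R"
      using pos by (simp_all only: pos_divide_less_eq[symmetric])
  qed
  have big: "\<forall>\<^sub>F N in sequentially. real (card (A N)) > 0 \<and> n N \<le> R * real (card (A N))"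
    if A: "(\<lambda>N. real (card (A N)) / t N) \<longlonglongrightarrow> e" and e: "e > 0" "a + b < R * e" for A :: "nat \<Rightarrow> nat set" and e
  proof -
    have "(\<lambda>N. R * (real (card (A N)) / t N) - (real (card (I N)) / t N + real (card (J N)) / t N)) \<longlonglongrightarrow> R * e - (a + b)"
      by (intro tendsto_intros A a b)
    from order_tendstoD(1)[OF this, of 0]
    have "\<forall>\<^sub>F N in sequentially. R * (real (card (A N)) / t N) - (real (card (I N)) / t N + real (card (J N)) / t N) > 0"
      using e by simp
    moreover have "\<forall>\<^sub>F N in sequentially. real (card (A N)) / t N > 0"
      using order_tendstoD(1)[OF A e(1)] .
    ultimately show ?thesis using t_pos
    proof eventually_elim
      case (elim N)
      have "0 < (R * real (card (A N)) - (real (card (I N)) + real (card (J N)))) / t N"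
        using elim(1) by (simp add: diff_divide_distrib add_divide_distrib)
      then have "real (card (I N)) + real (card (J N)) \<le> R * real (card (A N))"
        using elim(3) by (simp add: zero_less_divide_iff)
      moreover have "n N \<le> real (card (I N)) + real (card (J N))"
        unfolding n_def using card_Un_le[of "I N" "J N"] by linarith
      ultimately show ?case using elim(2,3) by (auto simp: zero_less_divide_iff)
    qed
  qed
  define B where "B = \<bar>u\<bar> * sqrt R ^ k + \<bar>v\<bar> * sqrt R ^ l"
  have B: "0 \<le> B" using R by (simp add: B_def)
  have cbound: "\<forall>\<^sub>F N in sequentially. n N > 0 \<and> (\<forall>w. \<bar>c N w\<bar> \<le> B * (1 / sqrt (n N)) ^ length w)"
    using big[OF a pos(1) R(1)] big[OF b pos(2) R(2)]
  proof eventually_elim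
    case (elim N)
    have fin: "finite (I N \<union> J N)" using I J by simp
    have n: "n N > 0"
    proof -
      have "card (I N) \<le> card (I N \<union> J N)" using fin by (intro card_mono) auto
      then show ?thesis using elim(1) by (simp add: n_def)
    qed
    have nc: "\<bar>norm_coeff j A w\<bar> \<le> sqrt R ^ j * (1 / sqrt (n N)) ^ length w"
      if "real (card A) > 0" "n N \<le> R * real (card A)" for j A w
    proof -
      have "(1 / sqrt (real (card A))) ^ j \<le> sqrt R ^ j * (1 / sqrt (n N)) ^ j"
        by (rule norm_bound) (use that n in auto)
      moreover have "0 \<le> (1 / sqrt (real (card A))) ^ j" by simp
      ultimately have "(1 / 2) * (1 / sqrt (real (card A))) ^ j \<le> sqrt R ^ j * (1 / sqrt (n N)) ^ j" by linarith
      then show ?thesis using R n by (auto simp: norm_coeff_def lists_of_def abs_mult)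
    qed
    have "\<bar>c N w\<bar> \<le> B * (1 / sqrt (n N)) ^ length w" for w
    proof -
      have "\<bar>c N w\<bar> \<le> \<bar>u\<bar> * \<bar>norm_coeff k (I N) w\<bar> + \<bar>v\<bar> * \<bar>norm_coeff l (J N) w\<bar>"
        unfolding c_def by (metis abs_mult abs_triangle_ineq)
      also have "\<dots> \<le> \<bar>u\<bar> * (sqrt R ^ k * (1 / sqrt (n N)) ^ length w) + \<bar>v\<bar> * (sqrt R ^ l * (1 / sqrt (n N)) ^ length w)"
        using elim nc by (intro add_mono mult_left_mono) auto
      finally show ?thesis by (simp add: B_def algebra_simps)
    qed
    with n show ?case by simp
  qed
  have n_inf: "filterlim n at_top sequentially"
  proof (rule filterlim_at_top_mono)
    show "filterlim (\<lambda>N. real (card (I N)) / t N * t N) at_top sequentially"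
      by (rule filterlim_tendsto_pos_mult_at_top[OF a pos(1) t])
    show "\<forall>\<^sub>F N in sequentially. real (card (I N)) / t N * t N \<le> n N"
      using t_pos
    proof eventually_elim
      case (elim N)
      have "card (I N) \<le> card (I N \<union> J N)" using I J by (intro card_mono) auto
      then show ?case using elim by (simp add: n_def)
    qed
  qed
  have rec: "(\<lambda>N. m N (p + 2) - real (p + 1) * walk_sum_var (L N) (c N) * m N p) \<longlonglongrightarrow> 0" for p
  proof -
    obtain C where C: "0 \<le> C"
      "\<And>V L c. finite V \<Longrightarrow> V \<noteq> {} \<Longrightarrow> L \<subseteq> {w. set w \<subseteq> V \<and> 1 \<le> length w \<and> length w \<le> max k l} \<Longrightarrow>
        (\<And>w. w \<in> L \<Longrightarrow> \<bar>c w\<bar> \<le> B * (1 / sqrt (card V)) ^ length w) \<Longrightarrow>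
        \<bar>expectation (\<lambda>\<omega>. walk_sum L c \<omega> ^ (p + 2)) -
          real (p + 1) * walk_sum_var L c * expectation (\<lambda>\<omega>. walk_sum L c \<omega> ^ p)\<bar> \<le> C / sqrt (card V)"
      using moment_recursion[OF B, of "max k l" p] by blast
    have "\<forall>\<^sub>F N in sequentially. norm (m N (p + 2) - real (p + 1) * walk_sum_var (L N) (c N) * m N p) \<le> C / sqrt (n N)"
      using cbound
    proof eventually_elim
      case (elim N)
      have "I N \<union> J N \<noteq> {}" using elim by (auto simp: n_def)
      moreover have "L N \<subseteq> {w. set w \<subseteq> I N \<union> J N \<and> 1 \<le> length w \<and> length w \<le> max k l}"
        using k l by (auto simp: L_def lists_of_def)
      ultimately show ?case
        using C(2)[of "I N \<union> J N" "L N" "c N"] I J elim by (simp add: m_def W n_def)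
    qed
    moreover have "(\<lambda>N. C / sqrt (n N)) \<longlonglongrightarrow> 0"
      by (intro tendsto_divide_0[OF tendsto_const] filterlim_at_top_imp_at_infinity
          filterlim_compose[OF sqrt_at_top n_inf])
    ultimately show ?thesis by (rule Lim_null_comparison)
  qed
  have "m N 0 = 1" "m N 1 = 0" for N
    by (simp_all add: m_def prob_space W expectation_walk_sum)
  then show ?thesis
    using tendsto_gaussian_moment[of m "\<lambda>N. walk_sum_var (L N) (c N)", OF _ _ rec var] unfolding m_def by blast
qed

text \<open>Here \<open>r\<close> plays the role of the limiting correlation, and the three
  parameters are the triangular square root of the limiting covariance matrix.\<close>

lemma linear_stats_converge:
  defines "r \<equiv> if k = l then (\<Delta> / sqrt (a * b)) ^ k else 0"
  shows "weakly_converges (\<lambda>N. distr M borel (\<lambda>\<omega>. (S N \<omega>, T N \<omega>)))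
    (gaussian_pair (sqrt (limit_var k)) (r * sqrt (limit_var l)) (sqrt (1 - r\<^sup>2) * sqrt (limit_var l)))"
proof -
  have poly: "poly_on edges (S N)" "poly_on edges (T N)" for N
    unfolding S_def T_def by (intro poly_on_centered_linear_stat I J k l)+
  have [measurable]: "S N \<in> borel_measurable M" "T N \<in> borel_measurable M" for N
    using poly poly_on_measurable by blast+
  have ST [measurable]: "(\<lambda>\<omega>. (S N \<omega>, T N \<omega>)) \<in> M \<rightarrow>\<^sub>M borel" for N
    unfolding borel_prod[symmetric] by measurable
  \<comment> \<open>The intersection is no larger than either index set, so \<Delta> \<le> a and
    \<Delta> \<le> b in the limit. This makes \<open>1 - r\<^sup>2\<close> nonnegative under the
    root.\<close>
  have "0 \<le> r" "r \<le> 1"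
  proof -
    have le: "\<Delta> \<le> e" if "(\<lambda>N. real (card (A N)) / t N) \<longlonglongrightarrow> e" "\<And>N. card (I N \<inter> J N) \<le> card (A N)" for A :: "nat \<Rightarrow> nat set" and e
    proof (rule tendsto_le[OF _ that(1) d])
      show "\<forall>\<^sub>F N in sequentially. real (card (I N \<inter> J N)) / t N \<le> real (card (A N)) / t N"
        using t_pos by eventually_elim (use that(2) in \<open>simp add: divide_right_mono\<close>)
    qed simp
    have "\<Delta> \<le> a" using I by (intro le[OF a] card_mono) auto
    moreover have "\<Delta> \<le> b" using J by (intro le[OF b] card_mono) auto
    ultimately have "\<Delta> * \<Delta> \<le> a * b" using pos by (intro mult_mono) auto
    then have "\<Delta> \<le> sqrt (a * b)" using pos real_le_rsqrt[of \<Delta> "a * b"] by (simp add: power2_eq_square)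
    then have "\<Delta> / sqrt (a * b) \<le> 1" "0 \<le> \<Delta> / sqrt (a * b)" using pos by simp_all
    then show "0 \<le> r" "r \<le> 1" by (auto simp: r_def power_le_one)
  qed
  then have r: "r\<^sup>2 \<le> 1" by (simp add: power_le_one)
  have polyW: "poly_on edges (\<lambda>\<omega>. u * S N \<omega> + v * T N \<omega>)" for u v N
    by (intro poly_on.add poly_on.mult poly_on.const poly)
  have int2: "integrable M (\<lambda>\<omega>. (S N \<omega>)\<^sup>2)" "integrable M (\<lambda>\<omega>. (T N \<omega>)\<^sup>2)" for N
    using poly_on_integrable[OF poly_on_power[OF poly(1)]] poly_on_integrable[OF poly_on_power[OF poly(2)]]
    by blast+
  have measq: "(\<lambda>z. (fst z)\<^sup>2 + (snd z)\<^sup>2) \<in> borel_measurable (borel :: (real \<times> real) measure)"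
    by (intro borel_measurable_continuous_onI continuous_intros)
  \<comment> \<open>Convergent second moments are bounded. The coefficients (1, 0) and (0, 1)
    isolate the two statistics.\<close>
  obtain K where K: "\<And>N. expectation (\<lambda>\<omega>. (S N \<omega>)\<^sup>2 + (T N \<omega>)\<^sup>2) \<le> K"
  proof -
    have "(\<lambda>N. expectation (\<lambda>\<omega>. (1 * S N \<omega> + 0 * T N \<omega>) ^ 2) + expectation (\<lambda>\<omega>. (0 * S N \<omega> + 1 * T N \<omega>) ^ 2))
        \<longlonglongrightarrow> gaussian_moment (combined_var 1 0) 2 + gaussian_moment (combined_var 0 1) 2"
      by (intro tendsto_add moments_tendsto)
    then have "Bseq (\<lambda>N. expectation (\<lambda>\<omega>. (S N \<omega>)\<^sup>2) + expectation (\<lambda>\<omega>. (T N \<omega>)\<^sup>2))"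
      by (intro convergent_imp_Bseq convergentI) simp
    then obtain K where "\<And>N. norm (expectation (\<lambda>\<omega>. (S N \<omega>)\<^sup>2) + expectation (\<lambda>\<omega>. (T N \<omega>)\<^sup>2)) \<le> K"
      unfolding Bseq_def by blast
    then have "expectation (\<lambda>\<omega>. (S N \<omega>)\<^sup>2 + (T N \<omega>)\<^sup>2) \<le> K" for N
      using int2[of N] by (simp add: abs_le_iff)
    then show thesis by (rule that)
  qed
  show ?thesis
  proof (rule weakly_converges_if_char_tendsto)
    show "prob_space (distr M borel (\<lambda>\<omega>. (S N \<omega>, T N \<omega>)))" for N by (rule prob_space_distr[OF ST])
    show "integrable (distr M borel (\<lambda>\<omega>. (S N \<omega>, T N \<omega>))) (\<lambda>z. (fst z)\<^sup>2 + (snd z)\<^sup>2)" for N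
      using int2 by (subst integrable_distr_eq[OF ST measq]) simp
    show "(\<integral>z. (fst z)\<^sup>2 + (snd z)\<^sup>2 \<partial>distr M borel (\<lambda>\<omega>. (S N \<omega>, T N \<omega>))) \<le> K" for N
      using K by (subst integral_distr[OF ST measq]) simp
    fix u v
    have meas: "(\<lambda>z. iexp (u * fst z + v * snd z)) \<in> borel_measurable (borel :: (real \<times> real) measure)"
      by (intro borel_measurable_continuous_onI continuous_intros)
    have "(\<lambda>N. \<integral>\<omega>. iexp (u * S N \<omega> + v * T N \<omega>) \<partial>M) \<longlonglongrightarrow> of_real (exp (- combined_var u v / 2))"
      by (rule iexp_expectation_tendsto[OF prob_space_axioms poly_on_measurable[OF polyW]
            poly_on_integrable[OF poly_on_power[OF polyW]] moments_tendsto])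
    moreover have "(u * sqrt (limit_var k) + v * (r * sqrt (limit_var l)))\<^sup>2 + (v * (sqrt (1 - r\<^sup>2) * sqrt (limit_var l)))\<^sup>2 = combined_var u v"
    proof -
      have "(u * p + v * (r * q))\<^sup>2 + (v * (sqrt (1 - r\<^sup>2) * q))\<^sup>2 =
          u\<^sup>2 * (p * p) + v\<^sup>2 * (q * q) * (r\<^sup>2 + (sqrt (1 - r\<^sup>2))\<^sup>2) + 2 * u * v * r * (p * q)" for p q
        by (simp add: power2_eq_square algebra_simps)
      then have "(u * sqrt (limit_var k) + v * (r * sqrt (limit_var l)))\<^sup>2 + (v * (sqrt (1 - r\<^sup>2) * sqrt (limit_var l)))\<^sup>2 =
          u\<^sup>2 * limit_var k + v\<^sup>2 * limit_var l + 2 * u * v * r * (sqrt (limit_var k) * sqrt (limit_var l))"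
        using r limit_var_nonneg[OF k] limit_var_nonneg[OF l] by simp
      also have "\<dots> = combined_var u v" using limit_var_nonneg[OF k] by (auto simp: combined_var_def r_def)
      finally show ?thesis .
    qed
    ultimately show "(\<lambda>N. \<integral>z. iexp (u * fst z + v * snd z) \<partial>distr M borel (\<lambda>\<omega>. (S N \<omega>, T N \<omega>))) \<longlonglongrightarrow>
        (\<integral>z. iexp (u * fst z + v * snd z) \<partial>gaussian_pair (sqrt (limit_var k)) (r * sqrt (limit_var l)) (sqrt (1 - r\<^sup>2) * sqrt (limit_var l)))"
      unfolding char_gaussian_pair integral_distr[OF ST meas] by simp
  qed (simp_all add: prob_space_gaussian_pair sets_gaussian_pair gaussian_pair_moments(1))
qed

end

theorem theorem1p1:
  fixes M :: "'w measure" and X :: "nat \<Rightarrow> nat \<Rightarrow> 'w \<Rightarrow> real"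
    and I J :: "nat \<Rightarrow> nat set" and t :: "nat \<Rightarrow> real"
    and a b \<Delta> d2 m4 :: real and k l :: nat
  assumes "wigner_matrix M X d2 m4"
    and "\<And>N. finite (I N)" and "\<And>N. finite (J N)"
    and "filterlim t at_top sequentially"
    and "(\<lambda>N. real (card (I N)) / t N) \<longlonglongrightarrow> a"
    and "(\<lambda>N. real (card (J N)) / t N) \<longlonglongrightarrow> b"
    and "(\<lambda>N. real (card (I N \<inter> J N)) / t N) \<longlonglongrightarrow> \<Delta>"
    and "a > 0" and "b > 0" and "\<Delta> > 0"
    and "k \<ge> 1" and "l \<ge> 1"
  shows "\<exists>G. gaussian_2d G \<and>
    coord_covariance G =
      (if k = l \<and> k \<ge> 3 then real k / 2 * (\<Delta> / sqrt (a * b)) ^ k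
       else if k = l \<and> k = 2 then (m4 - 1) / 2 * (\<Delta> / sqrt (a * b)) ^ 2
       else if k = l \<and> k = 1 then d2 / 4 * (\<Delta> / sqrt (a * b))
       else 0) \<and>
    weakly_converges
      (\<lambda>N. distr M borel (\<lambda>\<omega>.
         (centered_linear_stat M X (poly (cheb_T k)) (I N) \<omega>,
          centered_linear_stat M X (poly (cheb_T l)) (J N) \<omega>))) G"
proof -
  interpret overlapping_submatrices M X d2 m4 I J t a b \<Delta> k l
    using assms by (simp add: overlapping_submatrices_def overlapping_submatrices_axioms_def)
  define r where "r = (if k = l then (\<Delta> / sqrt (a * b)) ^ k else 0)"
  define G where "G = gaussian_pair (sqrt (limit_var k)) (r * sqrt (limit_var l)) (sqrt (1 - r\<^sup>2) * sqrt (limit_var l))"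
  have "gaussian_2d G" unfolding G_def by (rule gaussian_2d_gaussian_pair)
  moreover have "coord_covariance G =
      (if k = l \<and> k \<ge> 3 then real k / 2 * (\<Delta> / sqrt (a * b)) ^ k
       else if k = l \<and> k = 2 then (m4 - 1) / 2 * (\<Delta> / sqrt (a * b)) ^ 2
       else if k = l \<and> k = 1 then d2 / 4 * (\<Delta> / sqrt (a * b))
       else 0)"
  proof (cases "k = l")
    case True
    have cov: "coord_covariance G = limit_var k * (\<Delta> / sqrt (a * b)) ^ k"
      using limit_var_nonneg[OF assms(11)] True by (simp add: G_def gaussian_pair_moments(2) r_def)
    have lv: "limit_var (Suc 0) = d2 / 4" "limit_var 2 = (m4 - 1) / 2"
      "j \<ge> 3 \<Longrightarrow> limit_var j = real j / 2" for j
      by (auto simp: limit_var_def weight_var_def dihedral_order_def)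
    consider "k \<ge> 3" | "k = 2" | "k = 1" using assms(11) by linarith
    then show ?thesis by cases (use True in \<open>simp_all add: cov lv\<close>)
  next
    case False
    then show ?thesis by (simp add: G_def gaussian_pair_moments(2) r_def)
  qed
  moreover have "weakly_converges (\<lambda>N. distr M borel (\<lambda>\<omega>.
         (centered_linear_stat M X (poly (cheb_T k)) (I N) \<omega>,
          centered_linear_stat M X (poly (cheb_T l)) (J N) \<omega>))) G"
    using linear_stats_converge by (simp add: S_def T_def G_def r_def)
  ultimately show ?thesis by blast
qed

end
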